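(* Suppose that the Standing Assumption (stated in full in the context) holds, let the chain $\boldsymbol\Phi$ evolve according to $P(\boldsymbol\theta_0)$, and let $\hat f$ be a solution of Poisson's equation $\hat f-P(\boldsymbol\theta_0)\hat f=f-\pi(\boldsymbol\theta_0)f$ with $|\hat f|\le c_1\sqrt V$ for some constant $c_1<\infty$. Let $g_{ij}$, $0\le i,j\le d$, be the functions defined in the context. Then, as $n\to\infty$, $$(\alpha_n-\alpha(\boldsymbol\theta_0))\,\nabla L_n(\boldsymbol\theta_0)\Rightarrow Z_0\hat Z,$$ where $Z=(Z_0,Z_1,\dots,Z_d)'$ is a $(d+1)$-dimensional mean-zero multivariate normal random vector with covariance matrix $\Sigma=(\sigma_{ij})$, $\sigma_{ij}=\pi(\boldsymbol\theta_0)g_{ij}$ for $0\le i,j\le d$, and $\hat Z=(Z_1,\dots,Z_d)'$.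
   Context: Setting. $\mathsf X$ is a space with a countably generated $\sigma$-field $\mathcal B(\mathsf X)$; $\boldsymbol\Theta\subseteq\mathbb R^d$ and $\boldsymbol\theta_0$ is an interior point of $\boldsymbol\Theta$; for each $\boldsymbol\theta\in\boldsymbol\Theta$, $P(\boldsymbol\theta)=\{P(\boldsymbol\theta,x,A)\}$ is a Markov transition kernel on $\mathsf X$; $\boldsymbol\Phi=\{\Phi_k:k\ge0\}$ is the Markov chain with one-step transition kernel $P(\boldsymbol\theta)$; $f:\mathsf X\to\mathbb R$ is measurable. For a measure $\nu$ and kernel $P$ (possibly signed), $\nu g=\int g\,d\nu$, $Pg(x)=\int g(y)P(x,dy)$. $\pi(\boldsymbol\theta)$ denotes the unique invariant probability of $P(\boldsymbol\theta)$ (it exists for $\boldsymbol\theta\in B_\epsilon(\boldsymbol\theta_0)$ under the assumption below). Norms. For $h:\mathsf X\to[1,\infty)$: $|g|_h=\sup_x|g(x)|/h(x)$; $L_h^\infty$ is the space of measurable $g$ with $|g|_h<\infty$. For $V:\mathsf X\to[1,\infty)$ and a (signed) kernel $Q$ (e.g. a difference of kernels), $|||Q|||_V=\sup_{g\in L_V^\infty,\,|g|_V=1}|Qg|_V$. Standing Assumption. Fix $\epsilon>0$, let $B_\epsilon(\boldsymbol\theta_0)=\{\boldsymbol\theta\in\boldsymbol\Theta:\max_i|\theta_i-\theta_{0,i}|<\epsilon\}$, and let $\mathbf e_i$ be the $i$th unit vector of $\mathbb R^d$. (i) $\boldsymbol\Phi$ is $\psi$-irreducible for all $\boldsymbol\theta\in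 B_\epsilon(\boldsymbol\theta_0)$. (ii) For all $\boldsymbol\theta\in B_\epsilon(\boldsymbol\theta_0)$ there are densities $p(\boldsymbol\theta,x,y)$, differentiable in $\boldsymbol\theta$ at $\boldsymbol\theta_0$, with $P(\boldsymbol\theta,x,dy)=p(\boldsymbol\theta,x,y)P(\boldsymbol\theta_0,x,dy)$. (iii) There are $K\in\mathcal B(\mathsf X)$, $\delta>0$, $m\in\mathbb N$ and a probability measure $\nu$ with $P^m(\boldsymbol\theta,x,dy)\ge\delta\nu(dy)$ for all $x\in K$ and all $\boldsymbol\theta\in B_\epsilon(\boldsymbol\theta_0)$. (iv) For this $K$ there are $V:\mathsf X\to[1,\infty)$, $0<\lambda<1$, $b<\infty$ with $P(\boldsymbol\theta)V(x)\le\lambda V(x)+b1_K(x)$ for all $x$ and all $\boldsymbol\theta\in B_\epsilon(\boldsymbol\theta_0)$. (v) With $P^{(i)}(\boldsymbol\theta_0,x,dy)=\frac{\partial}{\partial\theta_i}p(\boldsymbol\theta,x,y)|_{\boldsymbol\theta=\boldsymbol\theta_0}P(\boldsymbol\theta_0,x,dy)$, for each $1\le i\le d$: $|||P^{(i)}(\boldsymbol\theta_0)|||_V<\infty$ and $\lim_{h\to0}\left|\left|\left|\frac{P(\boldsymbol\theta_0+h\mathbf e_i)-P(\boldsymbol\theta_0)}{h}-P^{(i)}(\boldsymbol\theta_0)\right|\right|\right|_V=0$. (vi) For each $1\le i\le d$, $|g_{ii}|_V<\infty$ where $g_{ii}(x)=\int_{\mathsf X}\left(\frac{\partial}{\partial\theta_i}p(\boldsymbol\theta_0,x,y)\right)^2P(\boldsymbol\theta_0,x,dy)$.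 (vii) $|f|_{\sqrt V}<\infty$. Functions $g_{ij}$. For $1\le i,j\le d$, $g_{ij}(x)=\int_{\mathsf X}\frac{\partial}{\partial\theta_i}p(\boldsymbol\theta_0,x,y)\frac{\partial}{\partial\theta_j}p(\boldsymbol\theta_0,x,y)P(\boldsymbol\theta_0,x,dy)$; for $1\le i\le d$, $g_{i0}(x)=g_{0i}(x)=\int_{\mathsf X}\hat f(y)\frac{\partial}{\partial\theta_i}p(\boldsymbol\theta_0,x,y)P(\boldsymbol\theta_0,x,dy)$; and $g_{00}(x)=\int_{\mathsf X}(\hat f(y)-P(\boldsymbol\theta_0)\hat f(x))^2P(\boldsymbol\theta_0,x,dy)=P(\boldsymbol\theta_0)\hat f^2(x)-(P(\boldsymbol\theta_0)\hat f(x))^2$. (A solution $\hat f$ as in the claim exists under the Standing Assumption.) Further notation. $\alpha(\boldsymbol\theta)=\pi(\boldsymbol\theta)f$; $\alpha_n=\frac1n\sum_{j=0}^{n-1}f(\Phi_j)$; $L_n(\boldsymbol\theta)=\prod_{j=1}^np(\boldsymbol\theta,\Phi_{j-1},\Phi_j)$; $\nabla$ is the gradient in $\boldsymbol\theta$ (column vector); $'$ is transpose. The chain starts from some fixed initial distribution $\mu$. $\Rightarrow$ denotes weak convergence (convergence in distribution). *)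

theory Defs
  imports "HOL-Probability.Probability"
begin

section \<open>Markov kernels and Markov chains\<close>

text \<open>The state space is a measure \<open>M\<close>, of which only the \<open>\<sigma>\<close>-algebra is used. A Markov kernel
  is a function \<open>K \<in> M \<rightarrow>\<^sub>M prob_algebra M\<close>, so \<open>K x\<close> is the measure \<open>K(x, dy)\<close>.\<close>

definition countably_generated_space :: "'x measure \<Rightarrow> bool" where
  "countably_generated_space M \<longleftrightarrow>
     (\<exists>G. countable G \<and> G \<subseteq> Pow (space M) \<and> sets M = sigma_sets (space M) G)"

primrec kernel_pow :: "'x measure \<Rightarrow> ('x \<Rightarrow> 'x measure) \<Rightarrow> nat \<Rightarrow> 'x \<Rightarrow> 'x measure" where
  "kernel_pow M K 0 = return M"
| "kernel_pow M K (Suc n) = (\<lambda>x. K x \<bind> kernel_pow M K n)"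

text \<open>Irreducibility in the sense of Meyn and Tweedie: there is a nontrivial irreducibility measure
  (a maximal one, usually called \<open>\<psi>\<close>, then exists as well).\<close>

definition psi_irreducible :: "'x measure \<Rightarrow> ('x \<Rightarrow> 'x measure) \<Rightarrow> bool" where
  "psi_irreducible M K \<longleftrightarrow>
     (\<exists>\<phi>. sets \<phi> = sets M \<and> sigma_finite_measure \<phi> \<and> emeasure \<phi> (space M) > 0 \<and>
        (\<forall>A\<in>sets M. emeasure \<phi> A > 0 \<longrightarrow>
           (\<forall>x\<in>space M. \<exists>n\<ge>1. emeasure (kernel_pow M K n x) A > 0)))"

definition invariant_prob :: "'x measure \<Rightarrow> ('x \<Rightarrow> 'x measure) \<Rightarrow> 'x measure \<Rightarrow> bool" where
  "invariant_prob M K \<pi> \<longleftrightarrow> \<pi> \<in> space (prob_algebra M) \<and> \<pi> \<bind> K = \<pi>"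

definition the_invariant_prob :: "'x measure \<Rightarrow> ('x \<Rightarrow> 'x measure) \<Rightarrow> 'x measure" where
  "the_invariant_prob M K = (THE \<pi>. invariant_prob M K \<pi>)"

definition natural_filtration ::
  "'w measure \<Rightarrow> 'x measure \<Rightarrow> (nat \<Rightarrow> 'w \<Rightarrow> 'x) \<Rightarrow> nat \<Rightarrow> 'w measure" where
  "natural_filtration \<Omega> M \<Phi> n =
     vimage_algebra (space \<Omega>) (\<lambda>\<omega>. \<lambda>i\<in>{..n}. \<Phi> i \<omega>) (Pi\<^sub>M {..n} (\<lambda>_. M))"

definition markov_chain ::
  "'x measure \<Rightarrow> ('x \<Rightarrow> 'x measure) \<Rightarrow> 'x measure \<Rightarrow> 'w measure \<Rightarrow> (nat \<Rightarrow> 'w \<Rightarrow> 'x) \<Rightarrow> bool" where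
  "markov_chain M K \<mu> \<Omega> \<Phi> \<longleftrightarrow>
     prob_space \<Omega> \<and> (\<forall>n. \<Phi> n \<in> \<Omega> \<rightarrow>\<^sub>M M) \<and> distr \<Omega> M (\<Phi> 0) = \<mu> \<and>
     (\<forall>n. \<forall>A\<in>sets M. AE \<omega> in \<Omega>.
        real_cond_exp \<Omega> (natural_filtration \<Omega> M \<Phi> n)
          (indicator (\<Phi> (Suc n) -` A \<inter> space \<Omega>)) \<omega> = measure (K (\<Phi> n \<omega>)) A)"

section \<open>Weighted norms\<close>

text \<open>The norms take the value \<open>\<infinity>\<close> outside the corresponding spaces.\<close>

definition wnorm :: "'x measure \<Rightarrow> ('x \<Rightarrow> real) \<Rightarrow> ('x \<Rightarrow> real) \<Rightarrow> ennreal" where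
  "wnorm M h g = (SUP x\<in>space M. ennreal (\<bar>g x\<bar> / h x))"

definition Linf :: "'x measure \<Rightarrow> ('x \<Rightarrow> real) \<Rightarrow> ('x \<Rightarrow> real) set" where
  "Linf M h = {g \<in> borel_measurable M. wnorm M h g < \<infinity>}"

text \<open>A signed kernel \<open>Q\<close> enters through its action \<open>g \<mapsto> Qg\<close> on functions. Because Bochner integrals of
  non-integrable functions are \<open>0\<close>, this is only meaningful if \<open>Qg\<close> is well defined for all
  \<open>g \<in> Linf M V\<close>, which has to be required separately.\<close>

definition kernel_norm ::
  "'x measure \<Rightarrow> ('x \<Rightarrow> real) \<Rightarrow> (('x \<Rightarrow> real) \<Rightarrow> 'x \<Rightarrow> real) \<Rightarrow> ennreal" where
  "kernel_norm M V Q = (SUP g\<in>{g \<in> Linf M V. wnorm M V g = 1}. wnorm M V (Q g))"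

definition kernel_op :: "('x \<Rightarrow> 'x measure) \<Rightarrow> ('x \<Rightarrow> real) \<Rightarrow> 'x \<Rightarrow> real" where
  "kernel_op K g x = (\<integral>y. g y \<partial>K x)"

section \<open>Derivatives in the parameter\<close>

definition param_ball :: "(real^'d) set \<Rightarrow> real^'d \<Rightarrow> real \<Rightarrow> (real^'d) set" where
  "param_ball \<Theta> \<theta>\<^sub>0 \<epsilon> = {\<theta>\<in>\<Theta>. (MAX i. \<bar>\<theta> $ i - \<theta>\<^sub>0 $ i\<bar>) < \<epsilon>}"

definition pderivative :: "'d \<Rightarrow> (real^'d \<Rightarrow> real) \<Rightarrow> real^'d \<Rightarrow> real" where
  "pderivative i F \<theta> = deriv (\<lambda>h. F (\<theta> + h *\<^sub>R axis i 1)) 0"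

definition gradient :: "(real^'d \<Rightarrow> real) \<Rightarrow> real^'d \<Rightarrow> real^'d" where
  "gradient F \<theta> = (\<chi> i. pderivative i F \<theta>)"

text \<open>\<open>dens_deriv p \<theta>\<^sub>0 i x y\<close> is the partial derivative of \<open>p(\<theta>,x,y)\<close> with respect to \<open>\<theta>\<^sub>i\<close> at
  \<open>\<theta>\<^sub>0\<close>; \<open>deriv_kernel_op\<close> is the action of the signed kernel with this density with respect to
  \<open>K(x, dy)\<close>.\<close>

definition dens_deriv ::
  "(real^'d \<Rightarrow> 'x \<Rightarrow> 'x \<Rightarrow> real) \<Rightarrow> real^'d \<Rightarrow> 'd \<Rightarrow> 'x \<Rightarrow> 'x \<Rightarrow> real" where
  "dens_deriv p \<theta>\<^sub>0 i x y = pderivative i (\<lambda>\<theta>. p \<theta> x y) \<theta>\<^sub>0"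

definition deriv_kernel_op ::
  "('x \<Rightarrow> 'x measure) \<Rightarrow> (real^'d \<Rightarrow> 'x \<Rightarrow> 'x \<Rightarrow> real) \<Rightarrow> real^'d \<Rightarrow> 'd \<Rightarrow> ('x \<Rightarrow> real) \<Rightarrow> 'x \<Rightarrow> real" where
  "deriv_kernel_op K p \<theta>\<^sub>0 i g x = (\<integral>y. g y * dens_deriv p \<theta>\<^sub>0 i x y \<partial>K x)"

definition time_average :: "('x \<Rightarrow> real) \<Rightarrow> (nat \<Rightarrow> 'w \<Rightarrow> 'x) \<Rightarrow> nat \<Rightarrow> 'w \<Rightarrow> real" where
  "time_average f \<Phi> n \<omega> = (\<Sum>j<n. f (\<Phi> j \<omega>)) / real n"

definition likelihood_ratio ::
  "(real^'d \<Rightarrow> 'x \<Rightarrow> 'x \<Rightarrow> real) \<Rightarrow> (nat \<Rightarrow> 'w \<Rightarrow> 'x) \<Rightarrow> nat \<Rightarrow> 'w \<Rightarrow> real^'d \<Rightarrow> real" where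
  "likelihood_ratio p \<Phi> n \<omega> \<theta> = (\<Prod>j=1..n. p \<theta> (\<Phi> (j - 1) \<omega>) (\<Phi> j \<omega>))"

text \<open>The index set \<open>{0, 1, \<dots>, d}\<close> is \<open>'d option\<close>, with \<open>None\<close> in the role of \<open>0\<close>.\<close>

fun gfun ::
  "('x \<Rightarrow> 'x measure) \<Rightarrow> (real^'d \<Rightarrow> 'x \<Rightarrow> 'x \<Rightarrow> real) \<Rightarrow> real^'d \<Rightarrow> ('x \<Rightarrow> real) \<Rightarrow>
     'd option \<Rightarrow> 'd option \<Rightarrow> 'x \<Rightarrow> real" where
  "gfun K p \<theta>\<^sub>0 fh None None x = (\<integral>y. (fh y - kernel_op K fh x)\<^sup>2 \<partial>K x)"
| "gfun K p \<theta>\<^sub>0 fh None (Some i) x = (\<integral>y. fh y * dens_deriv p \<theta>\<^sub>0 i x y \<partial>K x)"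
| "gfun K p \<theta>\<^sub>0 fh (Some i) None x = (\<integral>y. fh y * dens_deriv p \<theta>\<^sub>0 i x y \<partial>K x)"
| "gfun K p \<theta>\<^sub>0 fh (Some i) (Some j) x =
     (\<integral>y. dens_deriv p \<theta>\<^sub>0 i x y * dens_deriv p \<theta>\<^sub>0 j x y \<partial>K x)"

section \<open>Multivariate normal laws and convergence in distribution\<close>

text \<open>The univariate normal law with mean \<open>m\<close> and standard deviation \<open>s \<ge> 0\<close>; it is a point mass if
  \<open>s = 0\<close>, so that singular covariance matrices are covered below.\<close>

definition normal_law :: "real \<Rightarrow> real \<Rightarrow> real measure" where
  "normal_law m s = (if s = 0 then return borel m else density lborel (normal_density m s))"

definition multivariate_normal :: "real^'n \<Rightarrow> real^'n^'n \<Rightarrow> (real^'n) measure \<Rightarrow> bool" where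
  "multivariate_normal m \<Sigma> N \<longleftrightarrow>
     prob_space N \<and> sets N = sets borel \<and>
     (\<forall>a. \<exists>c. \<exists>s\<ge>0. distr N borel (\<lambda>z. a \<bullet> z) = normal_law c s) \<and>
     (\<forall>i. (\<integral>z. z $ i \<partial>N) = m $ i) \<and>
     (\<forall>i j. (\<integral>z. (z $ i - m $ i) * (z $ j - m $ j) \<partial>N) = \<Sigma> $ i $ j)"

definition weakly_converges ::
  "(nat \<Rightarrow> 'a::topological_space measure) \<Rightarrow> 'a measure \<Rightarrow> bool" where
  "weakly_converges Q R \<longleftrightarrow>
     (\<forall>\<phi>::'a \<Rightarrow> real. continuous_on UNIV \<phi> \<and> bounded (range \<phi>) \<longrightarrow>
        (\<lambda>n. \<integral>z. \<phi> z \<partial>Q n) \<longlonglongrightarrow> (\<integral>z. \<phi> z \<partial>R))"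

end

theory Submission
  imports Defs "HOL-Real_Asymp.Real_Asymp"
begin

text \<open>
  For a transition from \<open>x\<close> to \<open>y\<close> let \<open>\<xi>(x, y)\<close> be the vector with entries
  \<open>fh y - (P fh) x\<close> and \<open>\<partial>p/\<partial>\<theta>\<^sub>i(\<theta>\<^sub>0, x, y)\<close>, where \<open>P = P \<theta>\<^sub>0\<close>. Everything comes down to the sums of
  \<open>\<xi>\<close> along the chain. Summing Poisson's equation over \<open>j < n\<close> shows that \<open>n (\<alpha>\<^sub>n - \<alpha>)\<close> is the sum of the
  first entries plus the boundary term \<open>fh (\<Phi> 0) - fh (\<Phi> n)\<close>. The density \<open>p \<theta>\<^sub>0\<close> equals \<open>1\<close> at almost
  every transition, so by the product rule the gradient of the likelihood ratio at \<open>\<theta>\<^sub>0\<close> is the sum of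
  the other entries. All entries have conditional mean zero: the first by construction, the others because
  the total mass of \<open>P \<theta> x\<close> is constant in \<open>\<theta>\<close> and, by the convergence of difference quotients in the
  \<open>V\<close>-norm, may be differentiated under the integral sign. Hence the sums are martingales with conditional
  covariances \<open>g\<^sub>i\<^sub>j\<close>, and the vector of sums divided by \<open>sqrt n\<close> converges to a normal law with covariance
  \<open>\<pi> g\<^sub>i\<^sub>j\<close> (\<open>central_limit_vector\<close>). One factor \<open>sqrt n\<close> normalises the time average and the other one the
  gradient; in the product they cancel, and the continuous map \<open>(z\<^sub>0, z) \<mapsto> z\<^sub>0 z\<close> yields the limit.

  The central limit theorem rests on ergodicity in the weight \<open>V\<close>: there is exactly one invariant
  probability \<open>\<pi>\<close>, and for every measurable \<open>g\<close> with \<open>|g| \<le> c V\<close> the equation \<open>u - P u = g - \<pi> g\<close> has a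
  solution with \<open>|u| \<le> C V\<close> (\<open>invariant_prob_exists_unique\<close>). The minorization concerns \<open>P\<^sup>m\<close> while the
  drift concerns \<open>P\<close>, and periodicity is not excluded. Both defects disappear for the resolvent
  \<open>Q = (1 - \<eta>) \<Sum>\<^sub>j \<eta>\<^sup>j P\<^sup>j\<close>: with \<open>s x\<close> a multiple of \<open>Q x K\<close>, one has \<open>Q x \<ge> s x \<nu>\<close> and
  \<open>Q V \<le> \<lambda> V + b s\<close> with the same function \<open>s\<close>. The residual operator \<open>R g = Q g - s \<nu>(g)\<close> then
  contracts the norm with weight \<open>V + b\<close>, and \<open>\<Sum>\<^sub>k R\<^sup>k\<close> solves Poisson's equation for \<open>Q\<close>, from which the
  one for \<open>P\<close> follows (\<open>poisson_uniform\<close>). The measure \<open>\<pi>\<close> is the limit of the resolvents as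
  \<open>\<eta>\<close> tends to \<open>1\<close>; uniformity in \<open>g\<close> makes the limit \<open>\<sigma>\<close>-additive.

  In the proof of the central limit theorem the expectation \<open>A\<^sub>k\<close> of \<open>exp (i S\<^sub>k / sqrt n)\<close> satisfies
  \<open>A\<^sub>k\<^sub>+\<^sub>1 \<approx> exp (- \<sigma>\<^sup>2 / 2n) A\<^sub>k\<close> up to an error containing \<open>v (\<Phi> k) - \<sigma>\<^sup>2\<close>, where \<open>v\<close> is the conditional
  variance and \<open>\<sigma>\<^sup>2 = \<pi> v\<close>. Replacing \<open>v - \<sigma>\<^sup>2\<close> by \<open>u - P u\<close> turns this error into a telescoping
  sum, and what remains is controlled by the time averages of expectations. The initial law is arbitrary, and the chain
  may have no moments; therefore all estimates are made on the event \<open>V (\<Phi> 0) \<le> r\<close>, whose probability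
  tends to \<open>1\<close> as \<open>r\<close> grows.
\<close>

section \<open>Integration with respect to kernels\<close>

text \<open>
  The nonnegative case is \<open>nn_integral_bind\<close>. For signed \<open>g\<close> the inner integrals of the positive and
  the negative part are finite only outside a null set of \<open>M\<close>, which is why absolute integrability is
  assumed in iterated form.
\<close>

lemma integral_bind_real:
  fixes g :: "'b \<Rightarrow> real"
  assumes N: "N \<in> M \<rightarrow>\<^sub>M subprob_algebra B" and g[measurable]: "g \<in> borel_measurable B"
    and ne: "space M \<noteq> {}"
    and fin: "(\<integral>\<^sup>+x. \<integral>\<^sup>+y. ennreal \<bar>g y\<bar> \<partial>N x \<partial>M) < \<infinity>"
  shows "integrable (M \<bind> N) g" "integrable M (\<lambda>x. \<integral>y. g y \<partial>N x)"
    "(\<integral>y. g y \<partial>(M \<bind> N)) = (\<integral>x. \<integral>y. g y \<partial>N x \<partial>M)"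
proof -
  have sets: "sets (M \<bind> N) = sets B"
    by (rule sets_bind[OF sets_kernel[OF N] ne])
  have gm: "g \<in> borel_measurable (M \<bind> N)"
    using g by (simp add: measurable_cong_sets[OF sets refl])
  have gN: "g \<in> borel_measurable (N x)" if "x \<in> space M" for x
    using g by (simp add: measurable_cong_sets[OF sets_kernel[OF N that] refl])
  note [measurable] = N nn_integral_measurable_subprob_algebra
  have nn: "(\<integral>\<^sup>+y. h y \<partial>(M \<bind> N)) = (\<integral>\<^sup>+x. \<integral>\<^sup>+y. h y \<partial>N x \<partial>M)" if "h \<in> borel_measurable B" for h
    by (rule nn_integral_bind[OF that N])
  show I: "integrable (M \<bind> N) g"
    using fin gm by (simp add: integrable_iff_bounded nn)
  let ?p = "\<lambda>x. \<integral>\<^sup>+y. ennreal (g y) \<partial>N x" and ?n = "\<lambda>x. \<integral>\<^sup>+y. ennreal (- g y) \<partial>N x"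
  have pm[measurable]: "?p \<in> borel_measurable M" "?n \<in> borel_measurable M"
    by measurable
  have lp: "?p x \<le> (\<integral>\<^sup>+y. ennreal \<bar>g y\<bar> \<partial>N x)" "?n x \<le> (\<integral>\<^sup>+y. ennreal \<bar>g y\<bar> \<partial>N x)" for x
    by (auto intro!: nn_integral_mono ennreal_leI)
  have finp: "(\<integral>\<^sup>+x. ?p x \<partial>M) < \<infinity>" "(\<integral>\<^sup>+x. ?n x \<partial>M) < \<infinity>"
    by (rule le_less_trans[OF nn_integral_mono fin], rule lp)+
  have fa: "AE x in M. (\<integral>\<^sup>+y. ennreal \<bar>g y\<bar> \<partial>N x) \<noteq> \<infinity>"
    using fin by (intro nn_integral_noteq_infinite) simp_all
  have eq: "AE x in M. (\<integral>y. g y \<partial>N x) = enn2real (?p x) - enn2real (?n x)"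
    using fa AE_space
  proof eventually_elim
    case (elim x)
    have "integrable (N x) g"
      using elim gN by (simp add: integrable_iff_bounded less_top)
    then show ?case by (rule real_lebesgue_integral_def)
  qed
  have meas: "(\<lambda>x. \<integral>y. g y \<partial>N x) \<in> borel_measurable M"
    by measurable
  have h: "integrable M (\<lambda>x. enn2real (F x)) \<and> (\<integral>x. enn2real (F x) \<partial>M) = enn2real (\<integral>\<^sup>+x. F x \<partial>M)"
    if [measurable]: "F \<in> borel_measurable M" and F: "(\<integral>\<^sup>+x. F x \<partial>M) < \<infinity>" for F
  proof -
    have "AE x in M. F x \<noteq> \<infinity>" using nn_integral_noteq_infinite[OF that(1)] F by (simp add: less_top)
    then have e: "(\<integral>\<^sup>+x. ennreal (enn2real (F x)) \<partial>M) = (\<integral>\<^sup>+x. F x \<partial>M)"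
      by (intro nn_integral_cong_AE) (auto simp: less_top)
    then show ?thesis using F
      by (auto simp: integral_eq_nn_integral integrable_iff_bounded)
  qed
  have i: "integrable M (\<lambda>x. enn2real (?p x) - enn2real (?n x))"
    using h[OF pm(1) finp(1)] h[OF pm(2) finp(2)] by auto
  show "integrable M (\<lambda>x. \<integral>y. g y \<partial>N x)"
    by (subst integrable_cong_AE[OF meas _ eq]) (use i in auto)
  have "(\<integral>x. \<integral>y. g y \<partial>N x \<partial>M) = (\<integral>x. enn2real (?p x) - enn2real (?n x) \<partial>M)"
    by (rule integral_cong_AE[OF meas _ eq]) (use i in auto)
  also have "\<dots> = enn2real (\<integral>\<^sup>+x. ?p x \<partial>M) - enn2real (\<integral>\<^sup>+x. ?n x \<partial>M)"
    using h[OF pm(1) finp(1)] h[OF pm(2) finp(2)] by simp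
  also have "\<dots> = (\<integral>y. g y \<partial>(M \<bind> N))"
    by (simp add: real_lebesgue_integral_def[OF I] nn)
  finally show "(\<integral>y. g y \<partial>(M \<bind> N)) = (\<integral>x. \<integral>y. g y \<partial>N x \<partial>M)" ..
qed

text \<open>
  \<open>A = a B + b C\<close> as measures. This carries the resolvent equation, which is proved for nonnegative
  functions, over to signed functions.
\<close>

lemma integral_mixture:
  fixes g :: "'b \<Rightarrow> real"
  assumes sets: "sets B = sets A" "sets C = sets A" and ab: "0 \<le> a" "0 \<le> b"
    and mix: "\<And>u. u \<in> borel_measurable A \<Longrightarrow>
      (\<integral>\<^sup>+y. u y \<partial>A) = ennreal a * (\<integral>\<^sup>+y. u y \<partial>B) + ennreal b * (\<integral>\<^sup>+y. u y \<partial>C)"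
    and g: "integrable B g" "integrable C g"
  shows "integrable A g" "(\<integral>y. g y \<partial>A) = a * (\<integral>y. g y \<partial>B) + b * (\<integral>y. g y \<partial>C)"
proof -
  have [measurable]: "g \<in> borel_measurable A"
    using g(1) measurable_cong_sets[OF sets(1) refl] by auto
  show I: "integrable A g"
    using g by (auto simp: integrable_iff_bounded mix ennreal_mult_less_top)
  have f: "(\<integral>\<^sup>+y. ennreal (g y) \<partial>B) < \<infinity>" "(\<integral>\<^sup>+y. ennreal (g y) \<partial>C) < \<infinity>"
     "(\<integral>\<^sup>+y. ennreal (- g y) \<partial>B) < \<infinity>" "(\<integral>\<^sup>+y. ennreal (- g y) \<partial>C) < \<infinity>"
    using g by (auto simp: real_integrable_def less_top)
  have e: "enn2real (ennreal a * x + ennreal b * y) = a * enn2real x + b * enn2real y"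
    if "x < \<infinity>" "y < \<infinity>" for x y
    using that ab by (cases x; cases y) (auto simp: ennreal_mult''[symmetric] ennreal_plus[symmetric] simp del: ennreal_plus)
  show "(\<integral>y. g y \<partial>A) = a * (\<integral>y. g y \<partial>B) + b * (\<integral>y. g y \<partial>C)"
    unfolding real_lebesgue_integral_def[OF I] real_lebesgue_integral_def[OF g(1)]
      real_lebesgue_integral_def[OF g(2)]
    by (simp add: mix e[OF f(1,2)] e[OF f(3,4)] algebra_simps)
qed


lemma sets_prob_kernel: "L \<in> N \<rightarrow>\<^sub>M prob_algebra M \<Longrightarrow> x \<in> space N \<Longrightarrow> sets (L x) = sets M"
  by (rule sets_kernel[OF measurable_prob_algebraD])

lemma space_prob_kernel: "L \<in> N \<rightarrow>\<^sub>M prob_algebra M \<Longrightarrow> x \<in> space N \<Longrightarrow> space (L x) = space M"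
  by (rule sets_eq_imp_space_eq[OF sets_prob_kernel])

lemma prob_space_prob_kernel: "L \<in> N \<rightarrow>\<^sub>M prob_algebra M \<Longrightarrow> x \<in> space N \<Longrightarrow> prob_space (L x)"
  using measurable_space[of L N "prob_algebra M" x] by (simp add: space_prob_algebra)

text \<open>
  An integral with respect to a kernel of a function of both variables is an integral of a fixed
  function with respect to the kernel \<open>\<delta>\<^sub>x \<Otimes> L x\<close> on the product space.
\<close>

lemma measurable_kernel_integral:
  fixes f :: "'a \<Rightarrow> 'b \<Rightarrow> 'c::{banach, second_countable_topology}"
  assumes f: "(\<lambda>(x, y). f x y) \<in> borel_measurable (N \<Otimes>\<^sub>M M)" and L: "L \<in> N \<rightarrow>\<^sub>M subprob_algebra M"
  shows "(\<lambda>x. \<integral>y. f x y \<partial>L x) \<in> borel_measurable N"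
proof -
  have "(\<lambda>x. \<integral>p. (\<lambda>(x, y). f x y) p \<partial>distr (L x) (N \<Otimes>\<^sub>M M) (Pair x)) \<in> borel_measurable N"
    by (rule measurable_compose[OF measurable_distr2[OF _ L] integral_measurable_subprob_algebra[OF f]]) simp
  moreover have "(\<integral>p. (\<lambda>(x, y). f x y) p \<partial>distr (L x) (N \<Otimes>\<^sub>M M) (Pair x)) = (\<integral>y. f x y \<partial>L x)" if "x \<in> space N" for x
    using that f by (subst integral_distr) (auto simp: measurable_cong_sets[OF sets_kernel[OF L that] refl])
  ultimately show ?thesis by (simp cong: measurable_cong)
qed

text \<open>
  \<open>|f g| \<le> f\<^sup>2 + g\<^sup>2\<close>; the missing factor one half keeps the later constants simple.
\<close>

lemma integrable_mult_square:
  fixes f g :: "'a \<Rightarrow> real"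
  assumes [measurable]: "f \<in> borel_measurable N" "g \<in> borel_measurable N"
    and "integrable N (\<lambda>y. (f y)\<^sup>2)" "integrable N (\<lambda>y. (g y)\<^sup>2)"
  shows "integrable N (\<lambda>y. f y * g y)" "\<bar>\<integral>y. f y * g y \<partial>N\<bar> \<le> (\<integral>y. (f y)\<^sup>2 \<partial>N) + (\<integral>y. (g y)\<^sup>2 \<partial>N)"
proof -
  have le: "\<bar>f y * g y\<bar> \<le> (f y)\<^sup>2 + (g y)\<^sup>2" for y
  proof -
    have "2 * \<bar>f y\<bar> * \<bar>g y\<bar> \<le> \<bar>f y\<bar>\<^sup>2 + \<bar>g y\<bar>\<^sup>2" by (rule sum_squares_bound)
    moreover have "0 \<le> \<bar>f y\<bar> * \<bar>g y\<bar>" by (rule mult_nonneg_nonneg) auto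
    ultimately show ?thesis unfolding abs_mult power2_abs by linarith
  qed
  have s: "integrable N (\<lambda>y. (f y)\<^sup>2 + (g y)\<^sup>2)" using assms by simp
  show i: "integrable N (\<lambda>y. f y * g y)"
    by (rule Bochner_Integration.integrable_bound[OF s]) (use le in auto)
  have "\<bar>\<integral>y. f y * g y \<partial>N\<bar> \<le> (\<integral>y. \<bar>f y * g y\<bar> \<partial>N)" by (rule integral_abs_bound)
  also have "\<dots> \<le> (\<integral>y. (f y)\<^sup>2 + (g y)\<^sup>2 \<partial>N)" using i s le by (intro integral_mono) auto
  also have "\<dots> = (\<integral>y. (f y)\<^sup>2 \<partial>N) + (\<integral>y. (g y)\<^sup>2 \<partial>N)" using assms by simp
  finally show "\<bar>\<integral>y. f y * g y \<partial>N\<bar> \<le> (\<integral>y. (f y)\<^sup>2 \<partial>N) + (\<integral>y. (g y)\<^sup>2 \<partial>N)" .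
qed

section \<open>Functions dominated by a weight\<close>

text \<open>
  The weight \<open>V\<close> is a Lyapunov function. Since \<open>V \<ge> 1\<close>, every bounded measurable function is dominated by a
  multiple of it.
\<close>

locale weighted_space =
  fixes M :: "'x measure" and V :: "'x \<Rightarrow> real"
  assumes nonempty: "space M \<noteq> {}"
    and V_meas [measurable]: "V \<in> borel_measurable M"
    and V_ge_1: "\<And>x. x \<in> space M \<Longrightarrow> 1 \<le> V x"
begin

text \<open>
  The ball of radius \<open>c\<close> of the space \<open>Linf M V\<close>, with an explicit real radius in place of a norm, so that
  bounds can be composed by arithmetic.
\<close>

definition vbounded :: "real \<Rightarrow> ('x \<Rightarrow> real) \<Rightarrow> bool" where
  "vbounded c g \<longleftrightarrow> g \<in> borel_measurable M \<and> (\<forall>x\<in>space M. \<bar>g x\<bar> \<le> c * V x)"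

lemma vbounded_measurable: "vbounded c g \<Longrightarrow> g \<in> borel_measurable M"
  by (simp add: vbounded_def)

lemma vboundedD: "vbounded c g \<Longrightarrow> x \<in> space M \<Longrightarrow> \<bar>g x\<bar> \<le> c * V x"
  by (simp add: vbounded_def)

lemma V_nonneg: "x \<in> space M \<Longrightarrow> 0 \<le> V x"
  using V_ge_1[of x] by simp

lemma vbounded_nonneg: assumes "vbounded c g" shows "0 \<le> c"
proof -
  obtain x where x: "x \<in> space M" using nonempty by auto
  have "0 \<le> c * V x" using vboundedD[OF assms x] by linarith
  with V_ge_1[OF x] show ?thesis by (simp add: zero_le_mult_iff)
qed

lemma vbounded_mono: "vbounded c g \<Longrightarrow> c \<le> c' \<Longrightarrow> vbounded c' g"
  unfolding vbounded_def using V_nonneg by (meson mult_right_mono order_trans)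

lemma vbounded_const: "vbounded \<bar>k\<bar> (\<lambda>_. k)"
  unfolding vbounded_def using V_ge_1 by (auto simp: mult_le_cancel_left1)

lemma vbounded_V: "vbounded 1 V"
  unfolding vbounded_def using V_nonneg by auto

lemma vbounded_add: "vbounded c g \<Longrightarrow> vbounded c' h \<Longrightarrow> vbounded (c + c') (\<lambda>x. g x + h x)"
  unfolding vbounded_def
  by (auto simp: distrib_right intro!: order_trans[OF abs_triangle_ineq] add_mono)

lemma vbounded_scale: "vbounded c g \<Longrightarrow> vbounded (\<bar>k\<bar> * c) (\<lambda>x. k * g x)"
  unfolding vbounded_def
  by (auto simp: abs_mult mult.assoc intro!: mult_left_mono)

lemma vbounded_diff: "vbounded c g \<Longrightarrow> vbounded c' h \<Longrightarrow> vbounded (c + c') (\<lambda>x. g x - h x)"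
  using vbounded_add[OF _ vbounded_scale[of c' h "-1"]] by auto

lemma vbounded_integral:
  assumes N: "sets N = sets M" and fin: "(\<integral>\<^sup>+y. ennreal (V y) \<partial>N) \<le> ennreal B" and B: "0 \<le> B"
    and g: "vbounded c g"
  shows "integrable N g" "\<bar>\<integral>y. g y \<partial>N\<bar> \<le> c * B"
proof -
  note [measurable_cong] = N
  have sp: "space N = space M" using N by (rule sets_eq_imp_space_eq)
  have VI: "integrable N V"
    using V_nonneg sp le_less_trans[OF fin ennreal_less_top] by (intro integrableI_nonneg) auto
  have VB: "(\<integral>y. V y \<partial>N) \<le> B"
    using VI fin V_nonneg B sp by (subst (asm) nn_integral_eq_integral) auto
  have gm: "g \<in> borel_measurable N"
    using g by (simp add: vbounded_def measurable_cong_sets[OF N refl])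
  show I: "integrable N g"
    by (rule Bochner_Integration.integrable_bound[of _ "\<lambda>y. c * V y"])
       (use VI gm vboundedD[OF g] V_nonneg vbounded_nonneg[OF g] in \<open>auto simp: sp abs_mult intro!: AE_I2\<close>)
  have "\<bar>\<integral>y. g y \<partial>N\<bar> \<le> (\<integral>y. \<bar>g y\<bar> \<partial>N)" by simp
  also have "\<dots> \<le> (\<integral>y. c * V y \<partial>N)"
    using VI I vboundedD[OF g] by (intro integral_mono) (auto simp: sp)
  also have "\<dots> \<le> c * B" using VB vbounded_nonneg[OF g] by (simp add: mult_left_mono)
  finally show "\<bar>\<integral>y. g y \<partial>N\<bar> \<le> c * B" .
qed

definition bounded_kernel :: "('x \<Rightarrow> 'x measure) \<Rightarrow> real \<Rightarrow> bool" where
  "bounded_kernel L k \<longleftrightarrow> L \<in> M \<rightarrow>\<^sub>M prob_algebra M \<and> 0 \<le> k \<and>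
     (\<forall>x\<in>space M. (\<integral>\<^sup>+y. ennreal (V y) \<partial>L x) \<le> ennreal (k * V x))"

lemma bounded_kernel_integrable:
  assumes L: "bounded_kernel L k" and g: "vbounded c g" and x: "x \<in> space M"
  shows "integrable (L x) g"
  using L x V_nonneg[OF x] unfolding bounded_kernel_def
  by (intro vbounded_integral(1)[OF sets_prob_kernel _ _ g, where B="k * V x"]) auto

lemma kernel_op_vbounded:
  assumes L: "bounded_kernel L k" and g: "vbounded c g"
  shows "vbounded (c * k) (kernel_op L g)"
  unfolding vbounded_def
proof (intro conjI ballI)
  have "L \<in> M \<rightarrow>\<^sub>M subprob_algebra M"
    using L by (auto simp: bounded_kernel_def intro: measurable_prob_algebraD)
  then show "kernel_op L g \<in> borel_measurable M"
    unfolding kernel_op_def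
    by (rule measurable_compose[OF _ integral_measurable_subprob_algebra[OF vbounded_measurable[OF g]]])
next
  fix x assume x: "x \<in> space M"
  show "\<bar>kernel_op L g x\<bar> \<le> c * k * V x"
    using L x V_nonneg[OF x] unfolding bounded_kernel_def kernel_op_def mult.assoc
    by (intro vbounded_integral(2)[OF sets_prob_kernel _ _ g, where B="k * V x"]) auto
qed

lemma kernel_op_add:
  assumes "bounded_kernel L k" "vbounded c g" "vbounded c' h" "x \<in> space M"
  shows "kernel_op L (\<lambda>y. g y + h y) x = kernel_op L g x + kernel_op L h x"
  using assms by (simp add: kernel_op_def bounded_kernel_integrable)

lemma kernel_op_diff:
  assumes "bounded_kernel L k" "vbounded c g" "vbounded c' h" "x \<in> space M"
  shows "kernel_op L (\<lambda>y. g y - h y) x = kernel_op L g x - kernel_op L h x"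
  using assms by (simp add: kernel_op_def bounded_kernel_integrable)

lemma kernel_op_scale: "kernel_op L (\<lambda>y. a * g y) x = a * kernel_op L g x"
  by (simp add: kernel_op_def)

lemma kernel_op_const:
  assumes "L \<in> M \<rightarrow>\<^sub>M prob_algebra M" "x \<in> space M"
  shows "kernel_op L (\<lambda>_. a) x = a"
  using prob_space.prob_space[OF prob_space_prob_kernel[OF assms]] by (simp add: kernel_op_def)

text \<open>
  Dominated convergence, the dominating function being a multiple of \<open>V\<close>.
\<close>

lemma vbounded_integral_limit:
  assumes N: "sets N = sets M" and fin: "(\<integral>\<^sup>+y. ennreal (V y) \<partial>N) < \<infinity>"
    and g: "\<And>n. vbounded c (g n)" and lim: "\<And>y. y \<in> space M \<Longrightarrow> (\<lambda>n. g n y) \<longlonglongrightarrow> h y"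
    and h: "h \<in> borel_measurable M"
  shows "(\<lambda>n. \<integral>y. g n y \<partial>N) \<longlonglongrightarrow> (\<integral>y. h y \<partial>N)"
proof (rule integral_dominated_convergence[where w="\<lambda>y. c * V y"])
  note [measurable_cong] = N
  have sp: "space N = space M" using N by (rule sets_eq_imp_space_eq)
  show "h \<in> borel_measurable N" "\<And>n. g n \<in> borel_measurable N"
    using h g[THEN vbounded_measurable] by (simp_all add: measurable_cong_sets[OF N refl])
  have "integrable N V"
    using V_nonneg sp fin by (intro integrableI_nonneg) auto
  then show "integrable N (\<lambda>y. c * V y)" by simp
  show "AE y in N. (\<lambda>n. g n y) \<longlonglongrightarrow> h y" using lim by (auto simp: sp)
  show "AE y in N. norm (g n y) \<le> c * V y" for n using vboundedD[OF g] by (auto simp: sp)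
qed

lemma kernel_op_limit:
  assumes L: "bounded_kernel L k"
    and g: "\<And>n. vbounded c (g n)" and lim: "\<And>y. y \<in> space M \<Longrightarrow> (\<lambda>n. g n y) \<longlonglongrightarrow> h y"
    and h: "h \<in> borel_measurable M" and x: "x \<in> space M"
  shows "(\<lambda>n. kernel_op L (g n) x) \<longlonglongrightarrow> kernel_op L h x"
  unfolding kernel_op_def
  using L x unfolding bounded_kernel_def
  by (intro vbounded_integral_limit[OF sets_prob_kernel _ g lim h]) (auto intro: le_less_trans)

text \<open>
  \<open>L (L' g)\<close> is the integral of \<open>g\<close> with respect to the composed kernel. Finiteness of the iterated
  integral comes from applying both kernels to \<open>|g|\<close>.
\<close>

lemma kernel_op_bind:
  assumes L: "bounded_kernel L k" and L': "bounded_kernel L' k'" and g: "vbounded c g" and x: "x \<in> space M"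
  shows "integrable (L x \<bind> L') g" "(\<integral>y. g y \<partial>(L x \<bind> L')) = kernel_op L (kernel_op L' g) x"
proof -
  have lm: "L \<in> M \<rightarrow>\<^sub>M prob_algebra M" "L' \<in> M \<rightarrow>\<^sub>M prob_algebra M" and k: "0 \<le> k" "0 \<le> k'"
    using L L' by (auto simp: bounded_kernel_def)
  note s = sets_prob_kernel[OF lm(1) x] and sp = space_prob_kernel[OF lm(1) x]
  have N: "L' \<in> L x \<rightarrow>\<^sub>M subprob_algebra M"
    using measurable_prob_algebraD[OF lm(2)] by (simp add: measurable_cong_sets[OF s refl])
  have va: "vbounded c (\<lambda>y. \<bar>g y\<bar>)" using g by (auto simp: vbounded_def)
  have "(\<integral>\<^sup>+y. ennreal \<bar>g y\<bar> \<partial>L' z) = ennreal (kernel_op L' (\<lambda>y. \<bar>g y\<bar>) z)" if "z \<in> space M" for z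
    unfolding kernel_op_def by (intro nn_integral_eq_integral bounded_kernel_integrable[OF L' va that]) auto
  then have "(\<integral>\<^sup>+z. \<integral>\<^sup>+y. ennreal \<bar>g y\<bar> \<partial>L' z \<partial>L x) = (\<integral>\<^sup>+z. ennreal (kernel_op L' (\<lambda>y. \<bar>g y\<bar>) z) \<partial>L x)"
    by (intro nn_integral_cong) (simp add: sp)
  also have "\<dots> = ennreal (\<integral>z. kernel_op L' (\<lambda>y. \<bar>g y\<bar>) z \<partial>L x)"
    by (intro nn_integral_eq_integral bounded_kernel_integrable[OF L kernel_op_vbounded[OF L' va] x])
      (auto simp: kernel_op_def)
  finally have fin: "(\<integral>\<^sup>+z. \<integral>\<^sup>+y. ennreal \<bar>g y\<bar> \<partial>L' z \<partial>L x) < \<infinity>" by simp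
  have ne: "space (L x) \<noteq> {}" using sp nonempty by simp
  show "integrable (L x \<bind> L') g"
    by (rule integral_bind_real(1)[OF N vbounded_measurable[OF g] ne fin])
  show "(\<integral>y. g y \<partial>(L x \<bind> L')) = kernel_op L (kernel_op L' g) x"
    using integral_bind_real(3)[OF N vbounded_measurable[OF g] ne fin] by (simp add: kernel_op_def[abs_def])
qed

text \<open>
  Convergence of \<open>\<mu> n g\<close> to \<open>c g\<close>, uniformly over the unit ball of the weighted space, forces the limit
  functional \<open>c\<close> to be a measure: linearity and positivity pass to the limit, and by uniformity one may
  exchange the limit in \<open>n\<close> with the limit of a dominated sequence of functions, which gives
  \<open>\<sigma>\<close>-additivity as well as the identity of \<open>c\<close> with the integral.
\<close>

lemma uniform_limit_measure:
  assumes mu: "\<And>n. \<mu> n \<in> space (prob_algebra M)" and fin: "\<And>n. (\<integral>\<^sup>+y. ennreal (V y) \<partial>\<mu> n) < \<infinity>"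
    and unif: "\<And>k g n. vbounded k g \<Longrightarrow> \<bar>(\<integral>y. g y \<partial>\<mu> n) - c g\<bar> \<le> k * r n" and r: "r \<longlonglongrightarrow> 0"
  shows "\<exists>\<pi>\<in>space (prob_algebra M). \<forall>k g. vbounded k g \<longrightarrow> integrable \<pi> g \<and> (\<integral>y. g y \<partial>\<pi>) = c g"
proof -
  have s: "sets (\<mu> n) = sets M" and ps: "prob_space (\<mu> n)" for n
    using mu[of n] by (auto simp: space_prob_algebra)
  have sp: "space (\<mu> n) = space M" for n by (rule sets_eq_imp_space_eq[OF s])
  have int: "integrable (\<mu> n) g" if "vbounded k g" for k g n
    using fin[of n] that
    by (intro vbounded_integral(1)[OF s _ _ that, where B="enn2real (\<integral>\<^sup>+y. ennreal (V y) \<partial>\<mu> n)"]) auto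
  have lim: "(\<lambda>n. \<integral>y. g y \<partial>\<mu> n) \<longlonglongrightarrow> c g" if "vbounded k g" for k g
  proof -
    have "(\<lambda>n. k * r n) \<longlonglongrightarrow> 0" using tendsto_mult_right_zero[OF r] .
    then have "(\<lambda>n. (\<integral>y. g y \<partial>\<mu> n) - c g) \<longlonglongrightarrow> 0"
      using unif[OF that] by (intro Lim_null_comparison[OF _ \<open>(\<lambda>n. k * r n) \<longlonglongrightarrow> 0\<close>]) auto
    then show ?thesis by (simp add: LIM_zero_iff)
  qed
  have c_add: "c (\<lambda>x. g x + h x) = c g + c h" if "vbounded k g" "vbounded k' h" for k k' g h
    using tendsto_add[OF lim[OF that(1)] lim[OF that(2)]] lim[OF vbounded_add[OF that]] int[OF that(1)] int[OF that(2)]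
    by (simp add: LIMSEQ_unique)
  have c_scale: "c (\<lambda>x. a * g x) = a * c g" if "vbounded k g" for k a g
    using tendsto_mult_left[OF lim[OF that], of a] lim[OF vbounded_scale[OF that, of a]] by (simp add: LIMSEQ_unique)
  have c_nonneg: "0 \<le> c g" if "vbounded k g" "\<And>x. x \<in> space M \<Longrightarrow> 0 \<le> g x" for k g
  proof (rule tendsto_lowerbound[OF lim[OF that(1)]])
    have "0 \<le> (\<integral>y. g y \<partial>\<mu> n)" for n using that(2) by (intro integral_nonneg_AE) (auto simp: sp)
    then show "\<forall>\<^sub>F n in sequentially. 0 \<le> (\<integral>y. g y \<partial>\<mu> n)" by simp
  qed simp
  have c_lim: "(\<lambda>i. c (g i)) \<longlonglongrightarrow> c h"
    if g: "\<And>i. vbounded k (g i)" and h: "vbounded k h" and gh: "\<And>x. x \<in> space M \<Longrightarrow> (\<lambda>i. g i x) \<longlonglongrightarrow> h x" for k g h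
  proof (rule LIMSEQ_I)
    fix e :: real assume e: "0 < e"
    have "(\<lambda>n. k * r n) \<longlonglongrightarrow> 0" using tendsto_mult_right_zero[OF r] .
    then have "\<forall>\<^sub>F n in sequentially. k * r n < e / 3" using e by (intro order_tendstoD) auto
    then obtain n where n: "k * r n < e / 3" by (auto simp: eventually_sequentially)
    have "(\<lambda>i. \<integral>y. g i y \<partial>\<mu> n) \<longlonglongrightarrow> (\<integral>y. h y \<partial>\<mu> n)"
      by (rule vbounded_integral_limit[OF s fin g gh vbounded_measurable[OF h]])
    then obtain i0 where i0: "\<And>i. i \<ge> i0 \<Longrightarrow> norm ((\<integral>y. g i y \<partial>\<mu> n) - (\<integral>y. h y \<partial>\<mu> n)) < e / 3"
      using e by (meson LIMSEQ_D divide_pos_pos zero_less_numeral)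
    show "\<exists>no. \<forall>i\<ge>no. norm (c (g i) - c h) < e"
    proof (intro exI[of _ i0] allI impI)
      fix i assume "i0 \<le> i"
      from i0[OF this] unif[OF g[of i], of n] unif[OF h, of n] n show "norm (c (g i) - c h) < e"
        unfolding real_norm_def by linarith
    qed
  qed
  have vind: "vbounded 1 (indicator A)" if "A \<in> sets M" for A
    using that V_ge_1 V_nonneg by (auto simp: vbounded_def indicator_def)
  define \<pi> where "\<pi> = measure_of (space M) (sets M) (\<lambda>A. ennreal (c (indicator A)))"
  have cu: "c (indicator (A \<union> B)) = c (indicator A) + c (indicator B)"
    if "A \<in> sets M" "B \<in> sets M" "A \<inter> B = {}" for A B
    using c_add[OF vind[OF that(1)] vind[OF that(2)]] indicator_disj_union[OF that(3)]
    by (metis (no_types, lifting) ext)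
  have c0: "c (\<lambda>_. 0) = 0" using c_scale[OF vbounded_V, of 0] by simp
  have "countably_additive (sets M) (\<lambda>A. ennreal (c (indicator A)))"
  proof (rule countably_additiveI)
    fix A :: "nat \<Rightarrow> _" assume A: "range A \<subseteq> sets M" "disjoint_family A" "(\<Union>i. A i) \<in> sets M"
    have Am: "A i \<in> sets M" for i using A by auto
    have fs: "c (indicator (\<Union>i<n. A i)) = (\<Sum>i<n. c (indicator (A i)))" for n
    proof (induction n)
      case 0 then show ?case using c0 by (simp add: indicator_def)
    next
      case (Suc n)
      have "A i \<inter> A n = {}" if "i < n" for i
        using disjoint_family_onD[OF A(2)] that by simp
      then have "(\<Union>i<n. A i) \<inter> A n = {}" by blast
      moreover have "(\<Union>i<Suc n. A i) = (\<Union>i<n. A i) \<union> A n" by (auto simp: less_Suc_eq)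
      moreover have "(\<Union>i<n. A i) \<in> sets M" using Am by blast
      ultimately show ?case using cu[of "\<Union>i<n. A i" "A n"] Am Suc by simp
    qed
    have "(\<lambda>n. c (indicator (\<Union>i<n. A i))) \<longlonglongrightarrow> c (indicator (\<Union>i. A i))"
      using Am by (intro c_lim[where k=1] vind LIMSEQ_indicator_UN) auto
    then have "(\<lambda>i. c (indicator (A i))) sums c (indicator (\<Union>i. A i))" by (simp add: sums_def fs)
    then have "(\<lambda>i. ennreal (c (indicator (A i)))) sums ennreal (c (indicator (\<Union>i. A i)))"
      using c_nonneg[OF vind] Am A(3) by (subst sums_ennreal) auto
    then show "(\<Sum>i. ennreal (c (indicator (A i)))) = ennreal (c (indicator (\<Union>i. A i)))"
      by (rule sums_unique[symmetric])
  qed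
  moreover have "positive (sets M) (\<lambda>A. ennreal (c (indicator A)))"
  proof -
    have "(indicator {} :: 'x \<Rightarrow> real) = (\<lambda>_. 0)" by (simp add: fun_eq_iff)
    then show ?thesis using c0 by (simp add: positive_def)
  qed
  ultimately have em: "emeasure \<pi> A = ennreal (c (indicator A))" if "A \<in> sets M" for A
    unfolding \<pi>_def using that by (intro emeasure_measure_of_sigma sets.sigma_algebra_axioms)
  have spi: "sets \<pi> = sets M" "space \<pi> = space M" by (simp_all add: \<pi>_def)
  have "c (indicator (space M)) = 1"
  proof (rule LIMSEQ_unique[OF lim[OF vind[OF sets.top]]])
    have "(\<integral>y. indicator (space M) y \<partial>\<mu> n) = (1::real)" for n
      using prob_space.prob_space[OF ps, of n] sp[of n] by (simp add: s)
    then show "(\<lambda>n. \<integral>y. indicator (space M) y \<partial>\<mu> n) \<longlonglongrightarrow> (1::real)" by simp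
  qed
  then have pp: "prob_space \<pi>" by (intro prob_spaceI) (simp add: spi em)
  interpret pi: prob_space \<pi> by fact
  note [measurable_cong] = spi(1)
  have nn: "has_bochner_integral \<pi> g (c g)" if g: "vbounded k g" and pos: "\<And>x. 0 \<le> g x" for k g
  proof -
    have "\<forall>k. vbounded k g \<longrightarrow> has_bochner_integral \<pi> g (c g)"
      using vbounded_measurable[OF g] pos
    proof (induction rule: borel_measurable_induct_real)
      case (set A)
      then show ?case
        using has_bochner_integral_real_indicator[of A \<pi>] em[OF set] c_nonneg[OF vind[OF set]]
        by (simp add: spi measure_def)
    next
      case (mult u a)
      show ?case
      proof (cases "a = 0")
        case True then show ?thesis using c0 by (simp add: has_bochner_integral_zero)
      next
        case False
        show ?thesis
        proof (intro allI impI)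
          fix k assume k: "vbounded k (\<lambda>x. a * u x)"
          have "vbounded (\<bar>1 / a\<bar> * k) u" using vbounded_scale[OF k, of "1 / a"] False by simp
          with mult have "has_bochner_integral \<pi> u (c u)" by blast
          from has_bochner_integral_mult_right[OF this, of a] c_scale[OF \<open>vbounded (\<bar>1 / a\<bar> * k) u\<close>, of a]
          show "has_bochner_integral \<pi> (\<lambda>x. a * u x) (c (\<lambda>x. a * u x))" by simp
        qed
      qed
    next
      case (add u v)
      show ?case
      proof (intro allI impI)
        fix k assume k: "vbounded k (\<lambda>x. v x + u x)"
        have "\<bar>u x\<bar> \<le> k * V x" "\<bar>v x\<bar> \<le> k * V x" if "x \<in> space M" for x
          using vboundedD[OF k that] add.hyps(2)[of x] add.hyps(4)[of x] by linarith+
        then have "vbounded k u" "vbounded k v"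
          using add.hyps(1,3) unfolding vbounded_def by blast+
        with add.IH c_add[of k v k u] show "has_bochner_integral \<pi> (\<lambda>x. v x + u x) (c (\<lambda>x. v x + u x))"
          by (auto intro: has_bochner_integral_add)
      qed
    next
      case (seq U)
      show ?case
      proof (intro allI impI)
        fix k assume k: "vbounded k g"
        have le: "U i x \<le> g x" if "x \<in> space M" for i x
          using incseq_le[OF _ seq.hyps(4)[OF that]] \<open>incseq U\<close> by (simp add: incseq_def le_fun_def)
        have "\<bar>U i x\<bar> \<le> k * V x" if "x \<in> space M" for i x
          using vboundedD[OF k that] le[OF that, of i] seq.hyps(2)[of i x] by linarith
        then have kU: "vbounded k (U i)" for i
          using seq.hyps(1) unfolding vbounded_def by blast
        have b: "has_bochner_integral \<pi> (U i) (c (U i))" for i using seq.IH[of i] kU by blast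
        show "has_bochner_integral \<pi> g (c g)"
        proof (rule has_bochner_integral_monotone_convergence)
          show "integrable \<pi> (U i)" for i using b by (rule integrable.intros)
          show "AE x in \<pi>. mono (\<lambda>i. U i x)"
            using \<open>incseq U\<close> by (auto simp: incseq_def mono_def le_fun_def)
          show "AE x in \<pi>. (\<lambda>i. U i x) \<longlonglongrightarrow> g x" using seq.hyps(4) by (auto simp: spi)
          show "(\<lambda>i. \<integral>x. U i x \<partial>\<pi>) \<longlonglongrightarrow> c g"
            using c_lim[OF kU k seq.hyps(4)] by (simp add: has_bochner_integral_integral_eq[OF b])
          show "g \<in> borel_measurable \<pi>" using vbounded_measurable[OF k] by simp
        qed
      qed
    qed
    with g show ?thesis by blast
  qed
  have "has_bochner_integral \<pi> g (c g)" if g: "vbounded k g" for k g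
  proof -
    have p: "vbounded k (\<lambda>x. max 0 (g x))" and n: "vbounded k (\<lambda>x. max 0 (- g x))"
      using g vbounded_nonneg[OF g] V_nonneg by (auto simp: vbounded_def)
    have "c (\<lambda>x. max 0 (g x) + (-1) * max 0 (- g x)) = c (\<lambda>x. max 0 (g x)) + (-1) * c (\<lambda>x. max 0 (- g x))"
      using c_add[OF p vbounded_scale[OF n]] c_scale[OF n] by metis
    moreover have "(\<lambda>x. max 0 (g x) + (-1) * max 0 (- g x)) = g" by (auto simp: max_def)
    ultimately have "c g = c (\<lambda>x. max 0 (g x)) - c (\<lambda>x. max 0 (- g x))" by simp
    moreover have "has_bochner_integral \<pi> (\<lambda>x. max 0 (g x) - max 0 (- g x)) (c (\<lambda>x. max 0 (g x)) - c (\<lambda>x. max 0 (- g x)))"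
      by (intro has_bochner_integral_diff nn[OF p] nn[OF n]) auto
    moreover have "(\<lambda>x. max 0 (g x) - max 0 (- g x)) = g" by (auto simp: max_def)
    ultimately show ?thesis by simp
  qed
  then show ?thesis
    using pp spi by (intro bexI[of _ \<pi>]) (auto simp: space_prob_algebra has_bochner_integral_iff)
qed

lemma bounded_kernel_return: "bounded_kernel (return M) 1"
  unfolding bounded_kernel_def by (simp add: measurable_return_prob_space nn_integral_return)

lemma vbounded_sum:
  "finite A \<Longrightarrow> (\<And>i. i \<in> A \<Longrightarrow> vbounded (c i) (f i)) \<Longrightarrow> vbounded (\<Sum>i\<in>A. c i) (\<lambda>x. \<Sum>i\<in>A. f i x)"
proof (induction A rule: finite_induct)
  case empty then show ?case using vbounded_const[of 0] by simp
next
  case (insert i A) then show ?case using vbounded_add by simp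
qed

lemma wnorm_boundD:
  assumes g: "g \<in> borel_measurable M" and fin: "wnorm M V g < \<infinity>"
  shows "vbounded (enn2real (wnorm M V g)) g"
  unfolding vbounded_def
proof (intro conjI ballI g)
  fix x assume x: "x \<in> space M"
  have "ennreal (\<bar>g x\<bar> / V x) \<le> wnorm M V g" unfolding wnorm_def using x by (rule SUP_upper)
  also have "\<dots> = ennreal (enn2real (wnorm M V g))" using fin by simp
  finally have "\<bar>g x\<bar> / V x \<le> enn2real (wnorm M V g)" by simp
  then show "\<bar>g x\<bar> \<le> enn2real (wnorm M V g) * V x"
    using V_ge_1[OF x] by (simp add: divide_le_eq)
qed

text \<open>
  The constant \<open>inf V\<close> has norm one and is therefore an admissible test function in \<open>kernel_norm\<close>.
\<close>

lemma wnorm_const_INF: "wnorm M V (\<lambda>_. INF x\<in>space M. V x) = 1" and INF_V_ge_1: "1 \<le> (INF x\<in>space M. V x)"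
proof -
  define v where "v = (INF x\<in>space M. V x)"
  have bb: "bdd_below (V ` space M)" using V_nonneg by (auto intro: bdd_belowI[of _ 0])
  have v1: "1 \<le> v" unfolding v_def using V_ge_1 nonempty by (intro cINF_greatest) auto
  have vx: "v \<le> V x" if "x \<in> space M" for x unfolding v_def by (rule cINF_lower[OF bb that])
  have "wnorm M V (\<lambda>_. v) \<le> 1" unfolding wnorm_def
  proof (rule SUP_least)
    fix x assume x: "x \<in> space M"
    have "\<bar>v\<bar> / V x \<le> 1" using vx[OF x] v1 by (simp add: divide_le_eq)
    then show "ennreal (\<bar>v\<bar> / V x) \<le> 1" by simp
  qed
  moreover have "\<not> wnorm M V (\<lambda>_. v) < 1"
  proof
    assume less: "wnorm M V (\<lambda>_. v) < 1"
    define s where "s = enn2real (wnorm M V (\<lambda>_. v))"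
    have s: "wnorm M V (\<lambda>_. v) = ennreal s" "0 \<le> s"
      using less by (auto simp: s_def less_top[symmetric] dest: less_trans[OF _ ennreal_one_less_top])
    have s1: "s < 1" using less s by (simp add: ennreal_less_one_iff)
    have vs: "v \<le> s * V x" if x: "x \<in> space M" for x
    proof -
      have "ennreal (\<bar>v\<bar> / V x) \<le> wnorm M V (\<lambda>_. v)" unfolding wnorm_def using x by (rule SUP_upper)
      then have "\<bar>v\<bar> / V x \<le> s" using s by simp
      then show ?thesis using V_ge_1[OF x] v1 by (simp add: divide_le_eq)
    qed
    obtain x0 where x0: "x0 \<in> space M" using nonempty by blast
    have s0: "0 < s" using vs[OF x0] v1 s(2) by (cases "s = 0") auto
    have "v / s \<le> v"
      using cINF_greatest[OF nonempty, of "v / s" V] vs s0 by (simp add: v_def[symmetric] divide_le_eq mult.commute)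
    then show False using s0 s1 v1 by (simp add: divide_le_eq)
  qed
  ultimately show "wnorm M V (\<lambda>_. INF x\<in>space M. V x) = 1" by (simp add: v_def[symmetric])
  show "1 \<le> (INF x\<in>space M. V x)" using v1 by (simp add: v_def)
qed

lemma kernel_norm_const:
  assumes x: "x \<in> space M"
  shows "ennreal (\<bar>Q (\<lambda>_. INF x\<in>space M. V x) x\<bar> / V x) \<le> kernel_norm M V Q"
proof -
  have "ennreal (\<bar>Q (\<lambda>_. INF x\<in>space M. V x) x\<bar> / V x) \<le> wnorm M V (Q (\<lambda>_. INF x\<in>space M. V x))"
    unfolding wnorm_def using x by (rule SUP_upper)
  also have "\<dots> \<le> kernel_norm M V Q"
    unfolding kernel_norm_def using wnorm_const_INF by (intro SUP_upper) (simp add: Linf_def)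
  finally show ?thesis .
qed

end

section \<open>Poisson's equation for a minorized kernel\<close>

text \<open>
  The point of these hypotheses is that the same function \<open>s\<close> appears in the minorization and in the drift
  condition. Both a small set (\<open>s\<close> a multiple of its indicator) and the resolvent of a chain with a small set
  for a higher power of the kernel are of this form.
\<close>

locale minorized_kernel = weighted_space M V
  for M :: "'x measure" and V :: "'x \<Rightarrow> real" +
  fixes Q :: "'x \<Rightarrow> 'x measure" and s :: "'x \<Rightarrow> real" and \<nu> :: "'x measure" and lam b :: real
  assumes Q: "Q \<in> M \<rightarrow>\<^sub>M prob_algebra M"
    and s_meas [measurable]: "s \<in> borel_measurable M" and s_nonneg: "\<And>x. x \<in> space M \<Longrightarrow> 0 \<le> s x"
    and nu: "\<nu> \<in> space (prob_algebra M)" and nuV: "(\<integral>\<^sup>+y. ennreal (V y) \<partial>\<nu>) < \<infinity>"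
    and minor: "\<And>x A. x \<in> space M \<Longrightarrow> A \<in> sets M \<Longrightarrow>
         ennreal (s x) * emeasure \<nu> A \<le> emeasure (Q x) A"
    and lam: "0 \<le> lam" "lam < 1" and b: "0 \<le> b"
    and drift: "\<And>x. x \<in> space M \<Longrightarrow>
         (\<integral>\<^sup>+y. ennreal (V y) \<partial>Q x) \<le> ennreal (lam * V x + b * s x)"
begin

sublocale nu: prob_space \<nu> using nu by (simp add: space_prob_algebra)

lemma sets_nu [measurable_cong]: "sets \<nu> = sets M" using nu by (simp add: space_prob_algebra)

lemma s_le_1: assumes x: "x \<in> space M" shows "s x \<le> 1"
proof -
  have "emeasure \<nu> (space M) = 1"
    using nu.emeasure_space_1 sets_eq_imp_space_eq[OF sets_nu] by simp
  moreover have "emeasure (Q x) (space M) = 1"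
    using prob_space.emeasure_space_1[OF prob_space_prob_kernel[OF Q x]] space_prob_kernel[OF Q x] by simp
  ultimately show ?thesis using minor[OF x sets.top] by (simp add: ennreal_le_1)
qed

lemma bounded_kernel_Q: "bounded_kernel Q (lam + b)"
  unfolding bounded_kernel_def
proof (intro conjI ballI Q)
  show "0 \<le> lam + b" using lam b by simp
  fix x assume x: "x \<in> space M"
  have "b * s x \<le> b * V x"
    using s_le_1[OF x] V_ge_1[OF x] b by (intro mult_left_mono) auto
  then show "(\<integral>\<^sup>+y. ennreal (V y) \<partial>Q x) \<le> ennreal ((lam + b) * V x)"
    by (intro order_trans[OF drift[OF x]] ennreal_leI) (simp add: distrib_right)
qed

lemma nu_integrable: "vbounded c g \<Longrightarrow> integrable \<nu> g"
  using nuV by (intro vbounded_integral(1)[OF sets_nu, where B="enn2real (\<integral>\<^sup>+y. ennreal (V y) \<partial>\<nu>)"]) auto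

text \<open>
  The residual operator of Nummelin splitting: one step of the chain without regeneration. It is the action
  of the positive kernel \<open>Q x - s x \<nu>\<close>.
\<close>

definition R :: "('x \<Rightarrow> real) \<Rightarrow> 'x \<Rightarrow> real" where
  "R g x = kernel_op Q g x - s x * (\<integral>y. g y \<partial>\<nu>)"

lemma R_measurable: "vbounded c g \<Longrightarrow> R g \<in> borel_measurable M"
  unfolding R_def[abs_def]
  using vbounded_measurable[OF kernel_op_vbounded[OF bounded_kernel_Q]] by measurable

lemma R_add: "vbounded c g \<Longrightarrow> vbounded c' h \<Longrightarrow> x \<in> space M \<Longrightarrow> R (\<lambda>y. g y + h y) x = R g x + R h x"
  by (simp add: R_def kernel_op_add[OF bounded_kernel_Q] nu_integrable distrib_left)

lemma R_diff: "vbounded c g \<Longrightarrow> vbounded c' h \<Longrightarrow> x \<in> space M \<Longrightarrow> R (\<lambda>y. g y - h y) x = R g x - R h x"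
  by (simp add: R_def kernel_op_diff[OF bounded_kernel_Q] nu_integrable right_diff_distrib)

lemma R_scale: "R (\<lambda>y. a * g y) x = a * R g x"
  by (simp add: R_def kernel_op_scale algebra_simps)

lemma R_nonneg:
  assumes g: "vbounded c g" and pos: "\<And>y. y \<in> space M \<Longrightarrow> 0 \<le> g y" and x: "x \<in> space M"
  shows "0 \<le> R g x"
proof -
  note sQ = sets_prob_kernel[OF Q x]
  have sp: "space \<nu> = space M" "space (Q x) = space M"
    using sets_eq_imp_space_eq[OF sets_nu] space_prob_kernel[OF Q x] by auto
  have "scale_measure (ennreal (s x)) \<nu> \<le> Q x"
    using minor[OF x] by (subst le_measure) (auto simp: sets_nu sQ)
  then have "(\<integral>\<^sup>+y. ennreal (g y) \<partial>scale_measure (ennreal (s x)) \<nu>) \<le> (\<integral>\<^sup>+y. ennreal (g y) \<partial>Q x)"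
    by (intro nn_integral_mono_measure) (auto simp: sets_nu sQ)
  then have "ennreal (s x) * (\<integral>\<^sup>+y. ennreal (g y) \<partial>\<nu>) \<le> (\<integral>\<^sup>+y. ennreal (g y) \<partial>Q x)"
    using vbounded_measurable[OF g] by (simp add: nn_integral_scale_measure)
  moreover have "(\<integral>\<^sup>+y. ennreal (g y) \<partial>\<nu>) = ennreal (\<integral>y. g y \<partial>\<nu>)"
    using nu_integrable[OF g] pos by (intro nn_integral_eq_integral) (auto simp: sp)
  moreover have "(\<integral>\<^sup>+y. ennreal (g y) \<partial>Q x) = ennreal (\<integral>y. g y \<partial>Q x)"
    using bounded_kernel_integrable[OF bounded_kernel_Q g x] pos by (intro nn_integral_eq_integral) (auto simp: sp)
  moreover have "0 \<le> (\<integral>y. g y \<partial>Q x)" using pos by (intro integral_nonneg_AE) (auto simp: sp)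
  moreover have "0 \<le> (\<integral>y. g y \<partial>\<nu>)" using pos by (intro integral_nonneg_AE) (auto simp: sp)
  ultimately show ?thesis
    using s_nonneg[OF x] by (simp add: R_def kernel_op_def ennreal_mult[symmetric])
qed

text \<open>
  The constant \<open>b\<close> is the one that makes \<open>R\<close> a contraction: as \<open>R 1 = 1 - s\<close>, it turns the term \<open>b s\<close> of the
  drift condition into the constant \<open>b\<close>.
\<close>

definition W :: "'x \<Rightarrow> real" where "W x = V x + b"

definition \<gamma> :: real where "\<gamma> = (lam + b) / (1 + b)"

lemma gamma: "0 \<le> \<gamma>" "\<gamma> < 1" using lam b by (auto simp: \<gamma>_def)

lemma W_bounds: "x \<in> space M \<Longrightarrow> V x \<le> W x" "x \<in> space M \<Longrightarrow> W x \<le> (1 + b) * V x" "x \<in> space M \<Longrightarrow> 0 \<le> W x"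
  using b V_ge_1[of x] by (auto simp: W_def distrib_right mult_le_cancel_left1)

lemma W_meas [measurable]: "W \<in> borel_measurable M" unfolding W_def[abs_def] by simp

lemma W_vbounded: "vbounded (1 + b) W"
  unfolding vbounded_def using W_bounds by auto

lemma vbounded_of_W:
  assumes [measurable]: "g \<in> borel_measurable M" and "\<And>x. x \<in> space M \<Longrightarrow> \<bar>g x\<bar> \<le> c * W x" "0 \<le> c"
  shows "vbounded (c * (1 + b)) g"
  unfolding vbounded_def
proof (intro conjI ballI)
  fix x assume x: "x \<in> space M"
  have "\<bar>g x\<bar> \<le> c * W x" by (rule assms(2)[OF x])
  also have "\<dots> \<le> c * ((1 + b) * V x)" using W_bounds[OF x] \<open>0 \<le> c\<close> by (intro mult_left_mono)
  finally show "\<bar>g x\<bar> \<le> c * (1 + b) * V x" by (simp add: mult.assoc)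
qed simp

text \<open>
  \<open>R W \<le> (\<lambda> V + b s) + b (1 - s) = \<lambda> V + b\<close>, and this is at most \<open>\<gamma> (V + b)\<close> because \<open>V \<ge> 1\<close>.
\<close>

lemma R_W: assumes x: "x \<in> space M" shows "R W x \<le> \<gamma> * W x"
proof -
  have V1: "kernel_op Q V x \<le> lam * V x + b * s x"
  proof -
    have "ennreal (kernel_op Q V x) = (\<integral>\<^sup>+y. ennreal (V y) \<partial>Q x)"
      unfolding kernel_op_def using bounded_kernel_integrable[OF bounded_kernel_Q vbounded_V x] V_nonneg
      by (intro nn_integral_eq_integral[symmetric]) (auto simp: space_prob_kernel[OF Q x])
    then have "ennreal (kernel_op Q V x) \<le> ennreal (lam * V x + b * s x)" using drift[OF x] by (simp only:)
    then show ?thesis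
      using V_nonneg[OF x] lam b s_nonneg[OF x] by (subst (asm) ennreal_le_iff) auto
  qed
  have nuV: "0 \<le> (\<integral>y. V y \<partial>\<nu>)"
    using V_nonneg by (intro integral_nonneg_AE) (auto simp: sets_eq_imp_space_eq[OF sets_nu])
  have "kernel_op Q W x = kernel_op Q V x + b"
    unfolding W_def[abs_def]
    using kernel_op_add[OF bounded_kernel_Q vbounded_V vbounded_const x] kernel_op_const[OF Q x] by simp
  moreover have "(\<integral>y. W y \<partial>\<nu>) = (\<integral>y. V y \<partial>\<nu>) + b"
    unfolding W_def[abs_def] using nu_integrable[OF vbounded_V] by (simp add: nu.prob_space)
  ultimately have "R W x \<le> lam * V x + b * s x + b - s x * ((\<integral>y. V y \<partial>\<nu>) + b)"
    using V1 by (simp add: R_def)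
  also have "\<dots> \<le> lam * V x + b"
    using s_nonneg[OF x] nuV by (simp add: algebra_simps)
  also have "\<dots> \<le> \<gamma> * W x"
  proof -
    have "(1 + b) * (\<gamma> * W x - (lam * V x + b)) = b * (1 - lam) * (V x - 1)"
      using b by (simp add: \<gamma>_def W_def field_simps)
    moreover have "0 \<le> b * (1 - lam) * (V x - 1)"
      using b lam V_ge_1[OF x] by simp
    ultimately have "0 \<le> \<gamma> * W x - (lam * V x + b)"
      using b by (metis add_increasing2 add_nonneg_eq_0_iff less_eq_real_def mult_le_0_iff not_one_le_zero
          zero_le_mult_iff zero_le_one linorder_not_less)
    then show ?thesis by simp
  qed
  finally show ?thesis .
qed

text \<open>
  \<open>R\<close> is positive, so \<open>|g| \<le> c W\<close> implies \<open>|R g| \<le> c R W\<close>.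
\<close>

lemma R_contracts:
  assumes g: "g \<in> borel_measurable M" and gW: "\<And>x. x \<in> space M \<Longrightarrow> \<bar>g x\<bar> \<le> c * W x" and c: "0 \<le> c"
    and x: "x \<in> space M"
  shows "\<bar>R g x\<bar> \<le> \<gamma> * c * W x"
proof -
  note vg = vbounded_of_W[OF g gW c]
  note vW = vbounded_scale[OF W_vbounded, of c]
  have "0 \<le> R (\<lambda>y. c * W y - g y) x" "0 \<le> R (\<lambda>y. c * W y + g y) x"
    using gW by (auto intro!: R_nonneg[OF vbounded_diff[OF vW vg]] R_nonneg[OF vbounded_add[OF vW vg]] x
      simp: abs_le_iff) (smt (verit) gW)+
  then have "\<bar>R g x\<bar> \<le> c * R W x"
    using R_diff[OF vW vg x] R_add[OF vW vg x] by (simp add: R_scale)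
  also have "\<dots> \<le> c * (\<gamma> * W x)" using R_W[OF x] c by (rule mult_left_mono)
  finally show ?thesis by (simp add: ac_simps)
qed

lemma R_iter:
  assumes g: "g \<in> borel_measurable M" and gW: "\<And>x. x \<in> space M \<Longrightarrow> \<bar>g x\<bar> \<le> c * W x" and c: "0 \<le> c"
  shows "(R ^^ k) g \<in> borel_measurable M \<and> (\<forall>x\<in>space M. \<bar>(R ^^ k) g x\<bar> \<le> (\<gamma> ^ k * c) * W x)"
proof (induction k)
  case 0 then show ?case using g gW by simp
next
  case (Suc k)
  have c': "0 \<le> \<gamma> ^ k * c" using gamma c by simp
  show ?case
    using R_measurable[OF vbounded_of_W[OF _ _ c']] R_contracts[OF _ _ c'] Suc by (auto simp: mult.assoc)
qed

definition potential :: "('x \<Rightarrow> real) \<Rightarrow> 'x \<Rightarrow> real" where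
  "potential g x = (\<Sum>k. (R ^^ k) g x)"

text \<open>
  The Neumann series \<open>\<Sum>\<^sub>k R\<^sup>k\<close> inverts \<open>1 - R\<close>; \<open>R\<close> may be applied termwise by dominated convergence.
\<close>

lemma potential:
  assumes g: "g \<in> borel_measurable M" and gW: "\<And>x. x \<in> space M \<Longrightarrow> \<bar>g x\<bar> \<le> c * W x" and c: "0 \<le> c"
  shows "potential g \<in> borel_measurable M"
    and "\<And>x. x \<in> space M \<Longrightarrow> \<bar>potential g x\<bar> \<le> c / (1 - \<gamma>) * W x"
    and "\<And>x. x \<in> space M \<Longrightarrow> R (potential g) x = potential g x - g x"
    and "\<And>x. x \<in> space M \<Longrightarrow> (\<lambda>k. (R ^^ k) g x) sums potential g x"
proof -
  note it = R_iter[OF g gW c]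
  note [measurable] = it[THEN conjunct1]
  have b: "\<bar>(R ^^ k) g x\<bar> \<le> \<gamma> ^ k * (c * W x)" if "x \<in> space M" for x k
    using it that by (auto simp: mult.assoc)
  have geo: "(\<lambda>k. \<gamma> ^ k * (c * W x)) sums (1 / (1 - \<gamma>) * (c * W x))" for x
    using gamma by (intro sums_mult2 geometric_sums) auto
  have summ: "summable (\<lambda>k. \<bar>(R ^^ k) g x\<bar>)" if "x \<in> space M" for x
    using b[OF that] by (intro summable_comparison_test'[OF sums_summable[OF geo]]) auto
  show S: "(\<lambda>k. (R ^^ k) g x) sums potential g x" if "x \<in> space M" for x
    unfolding potential_def using summable_rabs_cancel[OF summ[OF that]] by (rule summable_sums)
  show m: "potential g \<in> borel_measurable M" unfolding potential_def[abs_def] by measurable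
  have part: "\<bar>\<Sum>k<n. (R ^^ k) g x\<bar> \<le> c / (1 - \<gamma>) * W x" if x: "x \<in> space M" for n x
  proof -
    have "\<bar>\<Sum>k<n. (R ^^ k) g x\<bar> \<le> (\<Sum>k<n. \<gamma> ^ k * (c * W x))"
      using b[OF x] by (intro order_trans[OF sum_abs] sum_mono)
    also have "\<dots> \<le> (\<Sum>k. \<gamma> ^ k * (c * W x))"
      using gamma c W_bounds(3)[OF x] by (intro sum_le_suminf sums_summable[OF geo]) auto
    also have "\<dots> = c / (1 - \<gamma>) * W x" using sums_unique[OF geo] by simp
    finally show ?thesis .
  qed
  have lim: "(\<lambda>n. \<Sum>k<n. (R ^^ k) g x) \<longlonglongrightarrow> potential g x" if "x \<in> space M" for x
    using S[OF that] by (simp add: sums_def)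
  show "\<bar>potential g x\<bar> \<le> c / (1 - \<gamma>) * W x" if x: "x \<in> space M" for x
    using part[OF x] by (intro tendsto_upperbound[OF tendsto_rabs[OF lim[OF x]]]) auto
  fix x assume x: "x \<in> space M"
  have c': "0 \<le> c / (1 - \<gamma>)" using c gamma by simp
  have vp: "vbounded (c / (1 - \<gamma>) * (1 + b)) (\<lambda>x. \<Sum>k<n. (R ^^ k) g x)" for n
    using part by (intro vbounded_of_W[OF _ _ c']) auto
  have vk: "vbounded (\<gamma> ^ k * c * (1 + b)) ((R ^^ k) g)" for k
    using it[of k] gamma c by (intro vbounded_of_W) auto
  have RS: "R (\<lambda>x. \<Sum>k<n. (R ^^ k) g x) x = (\<Sum>k<Suc n. (R ^^ k) g x) - g x" for n
  proof (induction n)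
    case 0 then show ?case by (simp add: R_def kernel_op_def)
  next
    case (Suc n)
    then show ?case using R_add[OF vp vk x, of n n] by simp
  qed
  have "(\<lambda>n. R (\<lambda>x. \<Sum>k<n. (R ^^ k) g x) x) \<longlonglongrightarrow> R (potential g) x"
    unfolding R_def[of _ x]
    by (intro tendsto_intros kernel_op_limit[OF bounded_kernel_Q vp lim m x] vbounded_integral_limit[OF sets_nu nuV vp lim m])
  moreover have "(\<lambda>n. (\<Sum>k<Suc n. (R ^^ k) g x) - g x) \<longlonglongrightarrow> potential g x - g x"
    by (intro tendsto_intros LIMSEQ_Suc lim x)
  ultimately show "R (potential g) x = potential g x - g x"
    unfolding RS by (rule LIMSEQ_unique)
qed

text \<open>
  \<open>h = \<Sum>\<^sub>k R\<^sup>k (g - a)\<close> satisfies \<open>h - R h = g - a\<close>. If \<open>a\<close> is chosen such that \<open>\<nu> h = 0\<close>, then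
  \<open>Q h = R h\<close>. The choice is possible because the potential of the constant \<open>1\<close> is at least \<open>1\<close>. The bound
  \<open>C\<close> does not depend on \<open>g\<close>.
\<close>

lemma poisson_minorized:
  "\<exists>C. \<forall>g. vbounded 1 g \<longrightarrow> (\<exists>a h. vbounded C h \<and> (\<forall>x\<in>space M. h x - kernel_op Q h x = g x - a))"
proof -
  define D where "D = 1 / (1 - \<gamma>) * (1 + b)"
  define I where "I = (\<integral>y. V y \<partial>\<nu>)"
  have D: "0 \<le> D" using b gamma by (simp add: D_def)
  have W1: "\<bar>g x\<bar> \<le> 1 * W x" if "vbounded 1 g" "x \<in> space M" for g x
    using vboundedD[OF that] W_bounds(1)[OF that(2)] by simp
  have one: "vbounded 1 (\<lambda>_. 1)" using vbounded_const[of 1] by simp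
  have p: "potential g \<in> borel_measurable M"
    "\<And>x. x \<in> space M \<Longrightarrow> \<bar>potential g x\<bar> \<le> 1 / (1 - \<gamma>) * W x"
    "\<And>x. x \<in> space M \<Longrightarrow> R (potential g) x = potential g x - g x"
    "\<And>x. x \<in> space M \<Longrightarrow> (\<lambda>k. (R ^^ k) g x) sums potential g x" if "vbounded 1 g" for g
    using potential[OF vbounded_measurable[OF that] W1[OF that] zero_le_one] by blast+
  have vp: "vbounded D (potential g)" if "vbounded 1 g" for g
    using vbounded_of_W[OF p(1)[OF that] p(2)[OF that]] gamma by (simp add: D_def)
  have I_le: "\<bar>\<integral>y. potential g y \<partial>\<nu>\<bar> \<le> D * I" if "vbounded 1 g" for g
  proof (rule vbounded_integral(2)[OF sets_nu _ _ vp[OF that]])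
    show "(\<integral>\<^sup>+y. ennreal (V y) \<partial>\<nu>) \<le> ennreal I" unfolding I_def
      using nu_integrable[OF vbounded_V] V_nonneg
      by (subst nn_integral_eq_integral) (auto simp: sets_eq_imp_space_eq[OF sets_nu])
    show "0 \<le> I" unfolding I_def using V_nonneg
      by (intro integral_nonneg_AE) (auto simp: sets_eq_imp_space_eq[OF sets_nu])
  qed
  have R1_pos: "0 \<le> (R ^^ k) (\<lambda>_. 1) x" if "x \<in> space M" for k x
    using that
  proof (induction k arbitrary: x)
    case (Suc k)
    have "vbounded (\<gamma> ^ k * 1 * (1 + b)) ((R ^^ k) (\<lambda>_. 1))"
      using R_iter[OF vbounded_measurable[OF one] W1[OF one]] gamma by (intro vbounded_of_W) auto
    from R_nonneg[OF this Suc.IH Suc.prems] show ?case by simp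
  qed simp
  have h1: "1 \<le> potential (\<lambda>_. 1) x" if "x \<in> space M" for x
    using sum_le_suminf[of "\<lambda>k. (R ^^ k) (\<lambda>_. 1) x" "{..<1}"] p(4)[OF one that] R1_pos[OF that]
    by (simp add: sums_iff)
  define z where "z = (\<integral>y. potential (\<lambda>_. 1) y \<partial>\<nu>)"
  have z: "1 \<le> z"
  proof -
    have "(\<integral>y. 1 \<partial>\<nu>) \<le> z" unfolding z_def
      using h1 by (intro integral_mono nu_integrable[OF vp[OF one]]) (auto simp: sets_eq_imp_space_eq[OF sets_nu])
    then show ?thesis by (simp add: nu.prob_space)
  qed
  show ?thesis
  proof (rule exI[of _ "D + D * I * D"], intro allI impI)
    fix g assume g: "vbounded 1 g"
    define a where "a = (\<integral>y. potential g y \<partial>\<nu>) / z"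
    define h where "h = (\<lambda>x. potential g x - a * potential (\<lambda>_. 1) x)"
    have a: "\<bar>a\<bar> \<le> D * I"
    proof -
      have "\<bar>a\<bar> \<le> D * I / z" using I_le[OF g] z by (simp add: a_def divide_right_mono)
      also have "\<dots> \<le> D * I / 1" using z I_le[OF g] by (intro divide_left_mono) auto
      finally show ?thesis by simp
    qed
    note vs = vbounded_scale[OF vp[OF one], of a]
    have vh: "vbounded (D + \<bar>a\<bar> * D) h"
      unfolding h_def by (rule vbounded_diff[OF vp[OF g] vs])
    \<comment> \<open>this is where the choice of \<open>a\<close> enters: the regeneration term of \<open>Q h\<close> vanishes\<close>
    have nuh: "(\<integral>y. h y \<partial>\<nu>) = 0"
      using z nu_integrable[OF vp[OF g]] nu_integrable[OF vp[OF one]] unfolding h_def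
      by (simp add: z_def[symmetric]) (simp add: a_def)
    have "h x - kernel_op Q h x = g x - a" if x: "x \<in> space M" for x
    proof -
      have "kernel_op Q h x = R h x" by (simp add: R_def nuh)
      also have "\<dots> = R (potential g) x - a * R (potential (\<lambda>_. 1)) x"
        unfolding h_def R_diff[OF vp[OF g] vs x] R_scale ..
      also have "\<dots> = h x - (g x - a)"
        by (simp add: p(3)[OF g x] p(3)[OF one x] h_def algebra_simps)
      finally show ?thesis by simp
    qed
    moreover have "vbounded (D + D * I * D) h"
      by (rule vbounded_mono[OF vh]) (use a D in \<open>simp add: mult_right_mono\<close>)
    ultimately show "\<exists>a h. vbounded (D + D * I * D) h \<and> (\<forall>x\<in>space M. h x - kernel_op Q h x = g x - a)"
      by blast
  qed
qed

end

section \<open>Ergodicity from drift and minorization\<close>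

locale drift_minorization = weighted_space M V
  for M :: "'x measure" and V :: "'x \<Rightarrow> real" +
  fixes P :: "'x \<Rightarrow> 'x measure" and K :: "'x set" and \<delta> :: real and m :: nat
    and \<nu> :: "'x measure" and lam b :: real
  assumes kernel: "P \<in> M \<rightarrow>\<^sub>M prob_algebra M"
    and K: "K \<in> sets M" and delta: "\<delta> > 0" and nu: "\<nu> \<in> space (prob_algebra M)"
    and minor: "\<And>x A. x \<in> K \<Longrightarrow> A \<in> sets M \<Longrightarrow>
         ennreal \<delta> * emeasure \<nu> A \<le> emeasure (kernel_pow M P m x) A"
    and lam: "0 < lam" "lam < 1" and b: "0 \<le> b"
    and drift: "\<And>x. x \<in> space M \<Longrightarrow>
         (\<integral>\<^sup>+y. ennreal (V y) \<partial>P x) \<le> ennreal (lam * V x + b * indicator K x)"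
begin

lemma kernel_pow_kernel: "kernel_pow M P n \<in> M \<rightarrow>\<^sub>M prob_algebra M"
proof (induction n)
  case 0 show ?case by (simp add: measurable_return_prob_space)
next
  case (Suc n) then show ?case using measurable_bind_prob_space[OF kernel Suc] by simp
qed

lemma nn_integral_kernel_pow_add:
  assumes [measurable]: "g \<in> borel_measurable M" and x: "x \<in> space M"
  shows "(\<integral>\<^sup>+y. g y \<partial>kernel_pow M P (i + j) x) =
    (\<integral>\<^sup>+z. \<integral>\<^sup>+y. g y \<partial>kernel_pow M P j z \<partial>kernel_pow M P i x)"
  using x
proof (induction i arbitrary: x)
  case 0
  show ?case
    using nn_integral_return[OF 0 measurable_compose[OF measurable_prob_algebraD[OF kernel_pow_kernel]
      nn_integral_measurable_subprob_algebra[OF assms(1)]]] by simp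
next
  case (Suc i)
  note k = kernel_pow_kernel[THEN measurable_prob_algebraD] kernel[THEN measurable_prob_algebraD]
  have P: "P \<in> P x \<rightarrow>\<^sub>M subprob_algebra M" "kernel_pow M P n \<in> P x \<rightarrow>\<^sub>M subprob_algebra M" for n
    using k by (auto simp: measurable_cong_sets[OF sets_prob_kernel[OF kernel Suc.prems] refl])
  have sp: "space (P x) = space M"
    by (rule sets_eq_imp_space_eq[OF sets_prob_kernel[OF kernel Suc.prems]])
  have "(\<integral>\<^sup>+y. g y \<partial>kernel_pow M P (Suc i + j) x) = (\<integral>\<^sup>+z. \<integral>\<^sup>+y. g y \<partial>kernel_pow M P (i + j) z \<partial>P x)"
    by (simp add: nn_integral_bind[OF _ P(2)])
  also have "\<dots> = (\<integral>\<^sup>+w. \<integral>\<^sup>+z. \<integral>\<^sup>+y. g y \<partial>kernel_pow M P j z \<partial>kernel_pow M P i w \<partial>P x)"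
    by (intro nn_integral_cong Suc.IH) (simp add: sp)
  also have "\<dots> = (\<integral>\<^sup>+z. \<integral>\<^sup>+y. g y \<partial>kernel_pow M P j z \<partial>kernel_pow M P (Suc i) x)"
    using k by (simp add: nn_integral_bind[OF _ P(2)] measurable_compose[OF _ nn_integral_measurable_subprob_algebra])
  finally show ?case .
qed

text \<open>
  Iterating the drift condition, with \<open>1\<^sub>K \<le> 1\<close>, gives the bound \<open>\<lambda>\<^sup>n V + b \<Sum>\<^sub>i\<^sub><\<^sub>n \<lambda>\<^sup>i\<close>.
\<close>

lemma kernel_pow_V:
  assumes x: "x \<in> space M"
  shows "(\<integral>\<^sup>+y. ennreal (V y) \<partial>kernel_pow M P n x) \<le> ennreal ((1 + b / (1 - lam)) * V x)"
proof -
  have "(\<integral>\<^sup>+y. ennreal (V y) \<partial>kernel_pow M P n x) \<le> ennreal (lam ^ n * V x + b * (\<Sum>i<n. lam ^ i))"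
    using x
  proof (induction n arbitrary: x)
    case 0 then show ?case by (simp add: nn_integral_return)
  next
    case (Suc n)
    note s = sets_prob_kernel[OF kernel Suc.prems]
    have sp: "space (P x) = space M" by (rule sets_eq_imp_space_eq[OF s])
    interpret Px: prob_space "P x"
      using measurable_space[OF kernel Suc.prems] by (simp add: space_prob_algebra)
    have k: "kernel_pow M P n \<in> P x \<rightarrow>\<^sub>M subprob_algebra M"
      using kernel_pow_kernel[THEN measurable_prob_algebraD] by (simp add: measurable_cong_sets[OF s refl])
    have "(\<integral>\<^sup>+y. ennreal (V y) \<partial>kernel_pow M P (Suc n) x)
        = (\<integral>\<^sup>+z. \<integral>\<^sup>+y. ennreal (V y) \<partial>kernel_pow M P n z \<partial>P x)"
      by (simp add: nn_integral_bind[OF _ k])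
    also have "\<dots> \<le> (\<integral>\<^sup>+z. ennreal (lam ^ n * V z + b * (\<Sum>i<n. lam ^ i)) \<partial>P x)"
      by (intro nn_integral_mono Suc.IH) (simp add: sp)
    also have "\<dots> = (\<integral>\<^sup>+z. ennreal (lam ^ n) * ennreal (V z) + ennreal (b * (\<Sum>i<n. lam ^ i)) \<partial>P x)"
      using lam b V_nonneg by (intro nn_integral_cong) (simp add: sp ennreal_mult ennreal_plus sum_nonneg)
    also have "\<dots> = ennreal (lam ^ n) * (\<integral>\<^sup>+z. ennreal (V z) \<partial>P x) + ennreal (b * (\<Sum>i<n. lam ^ i))"
    proof -
      have [measurable]: "V \<in> borel_measurable (P x)" by (simp add: measurable_cong_sets[OF s refl])
      show ?thesis by (simp add: nn_integral_add nn_integral_cmult Px.emeasure_space_1)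
    qed
    also have "\<dots> \<le> ennreal (lam ^ n) * ennreal (lam * V x + b) + ennreal (b * (\<Sum>i<n. lam ^ i))"
      using b lam by (intro add_mono mult_left_mono order.trans[OF drift[OF Suc.prems]] ennreal_leI)
        (auto simp: indicator_def)
    also have "\<dots> = ennreal (lam ^ Suc n * V x + b * (\<Sum>i<Suc n. lam ^ i))"
      using lam b V_nonneg[OF Suc.prems]
      by (simp add: ennreal_plus[symmetric] ennreal_mult[symmetric] sum_nonneg algebra_simps del: ennreal_plus)
    finally show ?case .
  qed
  also have "\<dots> \<le> ennreal ((1 + b / (1 - lam)) * V x)"
  proof (intro ennreal_leI)
    have "(\<Sum>i<n. lam ^ i) \<le> 1 / (1 - lam)"
      using lam by (simp add: sum_gp_strict field_simps)
    then have "b * (\<Sum>i<n. lam ^ i) \<le> b / (1 - lam) * 1"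
      using b mult_left_mono by fastforce
    also have "\<dots> \<le> b / (1 - lam) * V x"
      using b lam V_ge_1[OF x] by (intro mult_left_mono) auto
    finally show "lam ^ n * V x + b * (\<Sum>i<n. lam ^ i) \<le> (1 + b / (1 - lam)) * V x"
      using lam V_nonneg[OF x] mult_right_mono[of "lam ^ n" 1 "V x"]
      by (simp add: distrib_right power_le_one)
  qed
  finally show ?thesis .
qed

text \<open>
  A bound, uniform in \<open>n\<close>, for the norm of \<open>P\<^sup>n\<close> on the weighted space.
\<close>

definition growth :: real where "growth = 1 + b / (1 - lam)"

lemma growth_ge_1: "1 \<le> growth" using lam b by (simp add: growth_def)

text \<open>
  \<open>(1 - \<eta>) \<Sum>\<^sub>j \<eta>\<^sup>j P\<^sup>j\<close>: the state of the chain at an independent geometric time.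
\<close>

definition resolvent :: "real \<Rightarrow> 'x \<Rightarrow> 'x measure" where
  "resolvent \<eta> x = measure_pmf (geometric_pmf (1 - \<eta>)) \<bind> (\<lambda>j. kernel_pow M P j x)"

context
  fixes \<eta> :: real assumes eta: "0 < \<eta>" "\<eta> < 1"
begin

lemma nn_integral_resolvent:
  assumes x: "x \<in> space M" and g: "g \<in> borel_measurable M"
  shows "(\<integral>\<^sup>+y. g y \<partial>resolvent \<eta> x) = (\<Sum>j. ennreal ((1 - \<eta>) * \<eta> ^ j) * (\<integral>\<^sup>+y. g y \<partial>kernel_pow M P j x))"
proof -
  have k: "(\<lambda>j. kernel_pow M P j x) \<in> measure_pmf (geometric_pmf (1 - \<eta>)) \<rightarrow>\<^sub>M subprob_algebra M"
    using measurable_space[OF measurable_prob_algebraD[OF kernel_pow_kernel] x] by auto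
  show ?thesis
    unfolding resolvent_def nn_integral_bind[OF g k]
    using eta by (simp add: nn_integral_measure_pmf nn_integral_count_space_nat mult.commute)
qed

lemma sets_resolvent: "x \<in> space M \<Longrightarrow> sets (resolvent \<eta> x) = sets M"
  unfolding resolvent_def
  by (rule sets_bind) (simp_all add: sets_prob_kernel[OF kernel_pow_kernel])

lemma space_resolvent: "x \<in> space M \<Longrightarrow> space (resolvent \<eta> x) = space M"
  by (rule sets_eq_imp_space_eq[OF sets_resolvent])

lemma resolvent_kernel: "resolvent \<eta> \<in> M \<rightarrow>\<^sub>M prob_algebra M"
proof -
  have prob: "prob_space (resolvent \<eta> x)" if x: "x \<in> space M" for x
  proof -
  have "(\<lambda>j. ennreal ((1 - \<eta>) * \<eta> ^ j)) sums ennreal ((1 - \<eta>) * (1 / (1 - \<eta>)))"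
    using eta by (intro sums_ennreal[THEN iffD2] sums_mult geometric_sums) auto
  then have s: "(\<Sum>j. ennreal ((1 - \<eta>) * \<eta> ^ j)) = 1"
    using eta by (simp add: sums_iff)
  have "emeasure (kernel_pow M P j x) (space M) = 1" for j
    using measurable_space[OF kernel_pow_kernel x, of j] prob_space.emeasure_space_1[of "kernel_pow M P j x"]
      sets_eq_imp_space_eq[OF sets_prob_kernel[OF kernel_pow_kernel x, of j]]
    by (simp add: space_prob_algebra)
  then have "emeasure (resolvent \<eta> x) (space M) = 1"
    using nn_integral_resolvent[OF x, of "indicator (space M)"] s sets_resolvent[OF x]
      sets_prob_kernel[OF kernel_pow_kernel x]
    by simp
  then show ?thesis
    by (intro prob_spaceI) (simp add: space_resolvent[OF x])
  qed
  show ?thesis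
  proof (rule measurable_prob_algebraI[OF prob])
  show "resolvent \<eta> \<in> M \<rightarrow>\<^sub>M subprob_algebra M"
  proof (rule measurable_subprob_algebra)
    fix A assume A[measurable]: "A \<in> sets M"
    have "emeasure (resolvent \<eta> x) A = (\<Sum>j. ennreal ((1 - \<eta>) * \<eta> ^ j) * emeasure (kernel_pow M P j x) A)"
      if "x \<in> space M" for x
      using nn_integral_resolvent[OF that, of "indicator A"] sets_resolvent[OF that]
       sets_prob_kernel[OF kernel_pow_kernel that] by simp
    moreover have [measurable]: "(\<lambda>x. emeasure (kernel_pow M P j x) A) \<in> borel_measurable M" for j
      using measurable_prob_algebraD[OF kernel_pow_kernel] A by (rule measurable_emeasure_kernel)
    have "(\<lambda>x. \<Sum>j. ennreal ((1 - \<eta>) * \<eta> ^ j) * emeasure (kernel_pow M P j x) A) \<in> borel_measurable M"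
      by measurable
    ultimately show "(\<lambda>x. emeasure (resolvent \<eta> x) A) \<in> borel_measurable M"
      by (simp cong: measurable_cong)
  next
    fix x assume x: "x \<in> space M"
    show "subprob_space (resolvent \<eta> x)" using prob[OF x] by (rule prob_space_imp_subprob_space)
  qed (auto simp: sets_resolvent)
  qed
qed

end

lemma bounded_kernel_pow: "bounded_kernel (kernel_pow M P n) growth"
  unfolding bounded_kernel_def
proof (intro conjI ballI kernel_pow_kernel)
  show "0 \<le> growth" using growth_ge_1 by simp
  show "(\<integral>\<^sup>+y. ennreal (V y) \<partial>kernel_pow M P n x) \<le> ennreal (growth * V x)" if "x \<in> space M" for x
    unfolding growth_def by (rule kernel_pow_V[OF that])
qed

lemma kernel_pow_1:
  assumes "x \<in> space M" shows "kernel_pow M P (Suc 0) x = P x"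
  using sets_prob_kernel[OF kernel assms] by (simp add: bind_return'')

lemma bounded_kernel_P: "bounded_kernel P growth"
  using bounded_kernel_pow[of "Suc 0"] kernel_pow_1 kernel by (simp add: bounded_kernel_def)

context
  fixes \<eta> :: real assumes eta: "0 < \<eta>" "\<eta> < 1"
begin

lemma suminf_geometric_weights: "(\<Sum>j. ennreal ((1 - \<eta>) * \<eta> ^ j)) = 1"
proof -
  have "(\<lambda>j. ennreal ((1 - \<eta>) * \<eta> ^ j)) sums ennreal ((1 - \<eta>) * (1 / (1 - \<eta>)))"
    using eta by (intro sums_ennreal[THEN iffD2] sums_mult geometric_sums) auto
  then show ?thesis using eta by (simp add: sums_iff)
qed

lemma bounded_kernel_resolvent: "bounded_kernel (resolvent \<eta>) growth"
  unfolding bounded_kernel_def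
proof (intro conjI ballI resolvent_kernel[OF eta])
  show "0 \<le> growth" using growth_ge_1 by simp
  fix x assume x: "x \<in> space M"
  have "(\<integral>\<^sup>+y. ennreal (V y) \<partial>resolvent \<eta> x) =
      (\<Sum>j. ennreal ((1 - \<eta>) * \<eta> ^ j) * (\<integral>\<^sup>+y. ennreal (V y) \<partial>kernel_pow M P j x))"
    by (rule nn_integral_resolvent[OF eta x]) simp
  also have "\<dots> \<le> (\<Sum>j. ennreal ((1 - \<eta>) * \<eta> ^ j) * ennreal (growth * V x))"
    using kernel_pow_V[OF x] by (intro suminf_le mult_left_mono summableI) (auto simp: growth_def)
  also have "\<dots> = ennreal (growth * V x)" by (simp add: suminf_geometric_weights)
  finally show "(\<integral>\<^sup>+y. ennreal (V y) \<partial>resolvent \<eta> x) \<le> ennreal (growth * V x)" .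
qed

lemma resolvent_shift:
  assumes x: "x \<in> space M" and g: "g \<in> borel_measurable M"
  shows "(\<integral>\<^sup>+y. g y \<partial>resolvent \<eta> x) = ennreal (1 - \<eta>) * (\<integral>\<^sup>+y. g y \<partial>return M x)
    + ennreal \<eta> * (\<Sum>j. ennreal ((1 - \<eta>) * \<eta> ^ j) * (\<integral>\<^sup>+y. g y \<partial>kernel_pow M P (Suc j) x))"
proof -
  let ?I = "\<lambda>j. \<integral>\<^sup>+y. g y \<partial>kernel_pow M P j x"
  have "(\<lambda>j. ennreal ((1 - \<eta>) * \<eta> ^ Suc j) * ?I (Suc j)) sums
      (\<Sum>j. ennreal ((1 - \<eta>) * \<eta> ^ Suc j) * ?I (Suc j))"
    by (intro summable_sums summableI)
  from sums_Suc[OF this]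
  have "(\<integral>\<^sup>+y. g y \<partial>resolvent \<eta> x) = (\<Sum>j. ennreal ((1 - \<eta>) * \<eta> ^ Suc j) * ?I (Suc j)) + ennreal (1 - \<eta>) * ?I 0"
    unfolding nn_integral_resolvent[OF eta x g] by (simp add: sums_iff)
  moreover have "(\<Sum>j. ennreal ((1 - \<eta>) * \<eta> ^ Suc j) * ?I (Suc j)) = (\<Sum>j. ennreal \<eta> * (ennreal ((1 - \<eta>) * \<eta> ^ j) * ?I (Suc j)))"
  proof (intro suminf_cong)
    fix j
    have "(1 - \<eta>) * \<eta> ^ Suc j = \<eta> * ((1 - \<eta>) * \<eta> ^ j)" by simp
    moreover have "0 \<le> (1 - \<eta>) * \<eta> ^ j" using eta by simp
    ultimately have e: "ennreal ((1 - \<eta>) * \<eta> ^ Suc j) = ennreal \<eta> * ennreal ((1 - \<eta>) * \<eta> ^ j)"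
      by (simp only: ennreal_mult'')
    show "ennreal ((1 - \<eta>) * \<eta> ^ Suc j) * ?I (Suc j) = ennreal \<eta> * (ennreal ((1 - \<eta>) * \<eta> ^ j) * ?I (Suc j))"
      unfolding e by (simp only: mult.assoc)
  qed
  ultimately show ?thesis by (simp add: add.commute)
qed

lemma nn_integral_resolvent_left:
  assumes x: "x \<in> space M" and g: "g \<in> borel_measurable M"
  shows "(\<integral>\<^sup>+y. g y \<partial>resolvent \<eta> x) = ennreal (1 - \<eta>) * (\<integral>\<^sup>+y. g y \<partial>return M x)
    + ennreal \<eta> * (\<integral>\<^sup>+y. g y \<partial>(P x \<bind> resolvent \<eta>))"
proof -
  note s = sets_prob_kernel[OF kernel x] and sp = space_prob_kernel[OF kernel x]
  have N: "resolvent \<eta> \<in> P x \<rightarrow>\<^sub>M subprob_algebra M"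
    using measurable_prob_algebraD[OF resolvent_kernel[OF eta]] by (simp add: measurable_cong_sets[OF s refl])
  have Nk: "kernel_pow M P n \<in> P x \<rightarrow>\<^sub>M subprob_algebra M" for n
    using measurable_prob_algebraD[OF kernel_pow_kernel] by (simp add: measurable_cong_sets[OF s refl])
  have [measurable]: "(\<lambda>z. \<integral>\<^sup>+y. g y \<partial>kernel_pow M P n z) \<in> borel_measurable (P x)" for n
    by (rule measurable_compose[OF Nk nn_integral_measurable_subprob_algebra[OF g]])
  have "(\<integral>\<^sup>+y. g y \<partial>(P x \<bind> resolvent \<eta>)) = (\<integral>\<^sup>+z. \<integral>\<^sup>+y. g y \<partial>resolvent \<eta> z \<partial>P x)"
    by (rule nn_integral_bind[OF g N])
  also have "\<dots> = (\<integral>\<^sup>+z. (\<Sum>j. ennreal ((1 - \<eta>) * \<eta> ^ j) * (\<integral>\<^sup>+y. g y \<partial>kernel_pow M P j z)) \<partial>P x)"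
    by (intro nn_integral_cong nn_integral_resolvent[OF eta _ g]) (simp add: sp)
  also have "\<dots> = (\<Sum>j. ennreal ((1 - \<eta>) * \<eta> ^ j) * (\<integral>\<^sup>+z. \<integral>\<^sup>+y. g y \<partial>kernel_pow M P j z \<partial>P x))"
    by (subst nn_integral_suminf) (auto simp: nn_integral_cmult)
  also have "\<dots> = (\<Sum>j. ennreal ((1 - \<eta>) * \<eta> ^ j) * (\<integral>\<^sup>+y. g y \<partial>kernel_pow M P (Suc j) x))"
    by (simp add: nn_integral_bind[OF g Nk])
  finally show ?thesis using resolvent_shift[OF x g] by simp
qed

lemma nn_integral_resolvent_right:
  assumes x: "x \<in> space M" and g: "g \<in> borel_measurable M"
  shows "(\<integral>\<^sup>+y. g y \<partial>resolvent \<eta> x) = ennreal (1 - \<eta>) * (\<integral>\<^sup>+y. g y \<partial>return M x)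
    + ennreal \<eta> * (\<integral>\<^sup>+y. g y \<partial>(resolvent \<eta> x \<bind> P))"
proof -
  note s = sets_prob_kernel[OF resolvent_kernel[OF eta] x]
  have N: "P \<in> resolvent \<eta> x \<rightarrow>\<^sub>M subprob_algebra M"
    using measurable_prob_algebraD[OF kernel] by (simp add: measurable_cong_sets[OF s refl])
  have Pg: "(\<lambda>z. \<integral>\<^sup>+y. g y \<partial>P z) \<in> borel_measurable M"
    by (rule measurable_compose[OF measurable_prob_algebraD[OF kernel] nn_integral_measurable_subprob_algebra[OF g]])
  have "(\<integral>\<^sup>+y. g y \<partial>(resolvent \<eta> x \<bind> P)) = (\<integral>\<^sup>+z. \<integral>\<^sup>+y. g y \<partial>P z \<partial>resolvent \<eta> x)"
    by (rule nn_integral_bind[OF g N])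
  also have "\<dots> = (\<Sum>j. ennreal ((1 - \<eta>) * \<eta> ^ j) * (\<integral>\<^sup>+z. \<integral>\<^sup>+y. g y \<partial>P z \<partial>kernel_pow M P j x))"
    by (rule nn_integral_resolvent[OF eta x Pg])
  also have "(\<lambda>j. \<integral>\<^sup>+z. \<integral>\<^sup>+y. g y \<partial>P z \<partial>kernel_pow M P j x) = (\<lambda>j. \<integral>\<^sup>+y. g y \<partial>kernel_pow M P (Suc j) x)"
  proof
    fix j
    have "(\<integral>\<^sup>+y. g y \<partial>kernel_pow M P (j + Suc 0) x) = (\<integral>\<^sup>+z. \<integral>\<^sup>+y. g y \<partial>kernel_pow M P (Suc 0) z \<partial>kernel_pow M P j x)"
      by (rule nn_integral_kernel_pow_add[OF g x])
    also have "\<dots> = (\<integral>\<^sup>+z. \<integral>\<^sup>+y. g y \<partial>P z \<partial>kernel_pow M P j x)"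
      using kernel_pow_1 space_prob_kernel[OF kernel_pow_kernel x] by (intro nn_integral_cong) simp
    finally show "(\<integral>\<^sup>+z. \<integral>\<^sup>+y. g y \<partial>P z \<partial>kernel_pow M P j x) = (\<integral>\<^sup>+y. g y \<partial>kernel_pow M P (Suc j) x)" by simp
  qed
  finally show ?thesis using resolvent_shift[OF x g] by simp
qed

text \<open>
  The resolvent equation \<open>Q = (1 - \<eta>) I + \<eta> P Q\<close>: condition on whether the geometric time is zero, and
  otherwise on the first step.
\<close>

lemma resolvent_left:
  assumes g: "vbounded c g" and x: "x \<in> space M"
  shows "kernel_op (resolvent \<eta>) g x = (1 - \<eta>) * g x + \<eta> * kernel_op P (kernel_op (resolvent \<eta>) g) x"
proof -
  have s: "sets (resolvent \<eta> x) = sets M" "sets (P x \<bind> resolvent \<eta>) = sets M"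
    using sets_prob_kernel[OF resolvent_kernel[OF eta]] x nonempty
    by (auto intro!: sets_bind simp: space_prob_kernel[OF kernel x])
  have "(\<integral>y. g y \<partial>resolvent \<eta> x) = (1 - \<eta>) * (\<integral>y. g y \<partial>return M x) + \<eta> * (\<integral>y. g y \<partial>(P x \<bind> resolvent \<eta>))"
    using vbounded_measurable[OF g] eta x nn_integral_resolvent_left[OF x]
    by (intro integral_mixture(2) kernel_op_bind(1)[OF bounded_kernel_P bounded_kernel_resolvent g x])
       (auto simp: s measurable_cong_sets[OF s(1) refl] intro!: bounded_kernel_integrable[OF bounded_kernel_return g x])
  then show ?thesis
    using vbounded_measurable[OF g] x
    by (simp add: kernel_op_bind(2)[OF bounded_kernel_P bounded_kernel_resolvent g x] integral_return kernel_op_def[of "resolvent \<eta>" g x])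
qed

text \<open>
  \<open>Q = (1 - \<eta>) I + \<eta> Q P\<close>, conditioning on the last step instead.
\<close>

lemma resolvent_right:
  assumes g: "vbounded c g" and x: "x \<in> space M"
  shows "kernel_op (resolvent \<eta>) g x = (1 - \<eta>) * g x + \<eta> * kernel_op (resolvent \<eta>) (kernel_op P g) x"
proof -
  have s: "sets (resolvent \<eta> x) = sets M" "sets (resolvent \<eta> x \<bind> P) = sets M"
    using sets_prob_kernel[OF resolvent_kernel[OF eta]] x nonempty sets_prob_kernel[OF kernel]
    by (auto intro!: sets_bind simp: space_prob_kernel[OF resolvent_kernel[OF eta] x])
  have "(\<integral>y. g y \<partial>resolvent \<eta> x) = (1 - \<eta>) * (\<integral>y. g y \<partial>return M x) + \<eta> * (\<integral>y. g y \<partial>(resolvent \<eta> x \<bind> P))"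
    using vbounded_measurable[OF g] eta x nn_integral_resolvent_right[OF x]
    by (intro integral_mixture(2) kernel_op_bind(1)[OF bounded_kernel_resolvent bounded_kernel_P g x])
       (auto simp: s measurable_cong_sets[OF s(1) refl] intro!: bounded_kernel_integrable[OF bounded_kernel_return g x])
  then show ?thesis
    using vbounded_measurable[OF g] x
    by (simp add: kernel_op_bind(2)[OF bounded_kernel_resolvent bounded_kernel_P g x] integral_return kernel_op_def[of "resolvent \<eta>" g x])
qed

text \<open>
  \<open>P\<^sup>j\<^sup>+\<^sup>m x \<ge> \<delta> P\<^sup>j x K \<nu>\<close>, and the weight of \<open>j + m\<close> in the resolvent is \<open>\<eta>\<^sup>m\<close> times the weight of \<open>j\<close>.
\<close>

lemma resolvent_minor:
  assumes x: "x \<in> space M" and A: "A \<in> sets M"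
  shows "ennreal (\<delta> * \<eta> ^ m * measure (resolvent \<eta> x) K) * emeasure \<nu> A \<le> emeasure (resolvent \<eta> x) A"
proof -
  let ?w = "\<lambda>j. ennreal ((1 - \<eta>) * \<eta> ^ j)"
  note kp = sets_prob_kernel[OF kernel_pow_kernel x] space_prob_kernel[OF kernel_pow_kernel x]
  have em: "emeasure (resolvent \<eta> x) B = (\<Sum>j. ?w j * emeasure (kernel_pow M P j x) B)" if "B \<in> sets M" for B
    using nn_integral_resolvent[OF eta x, of "indicator B"] that sets_resolvent[OF eta x] kp by simp
  interpret Q: prob_space "resolvent \<eta> x" by (rule prob_space_prob_kernel[OF resolvent_kernel[OF eta] x])
  have step: "ennreal \<delta> * emeasure \<nu> A * emeasure (kernel_pow M P j x) K \<le> emeasure (kernel_pow M P (j + m) x) A" for j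
  proof -
    have "ennreal \<delta> * emeasure \<nu> A * emeasure (kernel_pow M P j x) K = (\<integral>\<^sup>+z. ennreal \<delta> * emeasure \<nu> A * indicator K z \<partial>kernel_pow M P j x)"
      using K by (subst nn_integral_cmult_indicator) (simp_all add: kp)
    also have "\<dots> \<le> (\<integral>\<^sup>+z. \<integral>\<^sup>+y. indicator A y \<partial>kernel_pow M P m z \<partial>kernel_pow M P j x)"
      using minor[OF _ A] A sets_prob_kernel[OF kernel_pow_kernel]
      by (intro nn_integral_mono) (auto simp: kp indicator_def[of K])
    also have "\<dots> = emeasure (kernel_pow M P (j + m) x) A"
      using nn_integral_kernel_pow_add[OF _ x, of "indicator A" j m] A kp by simp
    finally show ?thesis .
  qed
  have "ennreal (\<delta> * \<eta> ^ m * measure (resolvent \<eta> x) K) * emeasure \<nu> A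
      = ennreal \<delta> * ennreal (\<eta> ^ m) * emeasure (resolvent \<eta> x) K * emeasure \<nu> A"
    using delta eta by (simp add: Q.emeasure_eq_measure ennreal_mult)
  also have "\<dots> = (\<Sum>j. ennreal \<delta> * ennreal (\<eta> ^ m) * emeasure \<nu> A * (?w j * emeasure (kernel_pow M P j x) K))"
    unfolding em[OF K] ennreal_suminf_cmult by (simp add: ac_simps)
  also have "\<dots> = (\<Sum>j. ?w (j + m) * (ennreal \<delta> * emeasure \<nu> A * emeasure (kernel_pow M P j x) K))"
  proof (intro suminf_cong)
    fix j
    have "(1 - \<eta>) * \<eta> ^ (j + m) = \<eta> ^ m * ((1 - \<eta>) * \<eta> ^ j)" by (simp add: power_add)
    moreover have "0 \<le> (1 - \<eta>) * \<eta> ^ j" using eta by simp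
    ultimately have e: "?w (j + m) = ennreal (\<eta> ^ m) * ?w j" by (simp only: ennreal_mult'')
    show "ennreal \<delta> * ennreal (\<eta> ^ m) * emeasure \<nu> A * (?w j * emeasure (kernel_pow M P j x) K)
        = ?w (j + m) * (ennreal \<delta> * emeasure \<nu> A * emeasure (kernel_pow M P j x) K)"
      unfolding e by (simp only: ac_simps)
  qed
  also have "\<dots> \<le> (\<Sum>j. ?w (j + m) * emeasure (kernel_pow M P (j + m) x) A)"
    by (intro suminf_le mult_left_mono step summableI) auto
  also have "\<dots> \<le> (\<Sum>j. ?w j * emeasure (kernel_pow M P j x) A)" (is "(\<Sum>j. ?a (j + m)) \<le> _")
  proof (rule suminf_le_const[OF summableI])
    fix n
    have "(\<Sum>j<n. ?a (j + m)) = sum ?a {m..<n+m}"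
      using sum.shift_bounds_nat_ivl[of ?a 0 m n] by (simp add: atLeast0LessThan)
    also have "\<dots> \<le> (\<Sum>j. ?a j)" by (intro sum_le_suminf summableI) auto
    finally show "(\<Sum>j<n. ?a (j + m)) \<le> (\<Sum>j. ?a j)" .
  qed
  finally show ?thesis by (simp add: em[OF A])
qed

text \<open>
  Apply \<open>Q\<close> to the drift condition and eliminate \<open>Q P V\<close> by the resolvent equation. The indicator of \<open>K\<close> turns
  into \<open>Q x K\<close>, the same function that governs the minorization.
\<close>

lemma resolvent_drift:
  assumes x: "x \<in> space M"
  shows "kernel_op (resolvent \<eta>) V x \<le> (1 - \<eta>) / (1 - \<eta> * lam) * V x + \<eta> * b / (1 - \<eta> * lam) * measure (resolvent \<eta> x) K"
proof -
  let ?Q = "resolvent \<eta>"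
  interpret Q: prob_space "?Q x" by (rule prob_space_prob_kernel[OF resolvent_kernel[OF eta] x])
  have PV: "kernel_op P V z \<le> lam * V z + b * indicator K z" if z: "z \<in> space M" for z
  proof -
    have "ennreal (kernel_op P V z) = (\<integral>\<^sup>+y. ennreal (V y) \<partial>P z)"
      unfolding kernel_op_def using V_nonneg
      by (intro nn_integral_eq_integral[symmetric] bounded_kernel_integrable[OF bounded_kernel_P vbounded_V z])
        (auto simp: space_prob_kernel[OF kernel z])
    then have "ennreal (kernel_op P V z) \<le> ennreal (lam * V z + b * indicator K z)"
      using drift[OF z] by (simp only:)
    then show ?thesis
      using V_nonneg[OF z] lam b by (subst (asm) ennreal_le_iff) auto
  qed
  have [measurable]: "K \<in> sets M" by (rule K)
  have vK: "vbounded 1 (indicator K)"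
    using V_ge_1 V_nonneg by (auto simp: vbounded_def indicator_def)
  note v1 = vbounded_scale[OF vbounded_V, of lam] and v2 = vbounded_scale[OF vK, of b]
  have "kernel_op ?Q (kernel_op P V) x \<le> kernel_op ?Q (\<lambda>z. lam * V z + b * indicator K z) x"
    unfolding kernel_op_def[of ?Q]
    using PV bounded_kernel_integrable[OF bounded_kernel_resolvent kernel_op_vbounded[OF bounded_kernel_P vbounded_V] x]
       bounded_kernel_integrable[OF bounded_kernel_resolvent vbounded_add[OF v1 v2] x]
    by (intro integral_mono) (simp_all add: space_resolvent[OF eta x])
  also have "\<dots> = lam * kernel_op ?Q V x + b * measure (?Q x) K"
    unfolding kernel_op_add[OF bounded_kernel_resolvent v1 v2 x] kernel_op_scale
    using sets_resolvent[OF eta x] K by (simp add: kernel_op_def)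
  finally have "kernel_op ?Q V x \<le> (1 - \<eta>) * V x + \<eta> * (lam * kernel_op ?Q V x + b * measure (?Q x) K)"
    unfolding resolvent_right[OF vbounded_V x] using eta by simp
  then have "kernel_op ?Q V x * (1 - \<eta> * lam) \<le> (1 - \<eta>) * V x + \<eta> * b * measure (?Q x) K"
    by (simp add: algebra_simps)
  moreover have "0 < 1 - \<eta> * lam"
    using eta lam mult_strict_mono[of \<eta> 1 lam 1] by simp
  ultimately have "kernel_op ?Q V x \<le> ((1 - \<eta>) * V x + \<eta> * b * measure (?Q x) K) / (1 - \<eta> * lam)"
    by (simp add: pos_le_divide_eq)
  then show ?thesis by (simp add: add_divide_distrib)
qed

end

text \<open>
  If \<open>K\<close> were empty, then \<open>P V \<le> \<lambda> V\<close> everywhere, which is impossible near the infimum of \<open>V\<close>.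
\<close>

lemma K_nonempty: "K \<noteq> {}"
proof
  assume K: "K = {}"
  define v where "v = (INF x\<in>space M. V x)"
  have bb: "bdd_below (V ` space M)" using V_nonneg by (auto intro: bdd_belowI[of _ 0])
  have v1: "1 \<le> v" unfolding v_def using V_ge_1 nonempty by (intro cINF_greatest) auto
  then have "v < v / lam" using lam by (simp add: field_simps)
  then obtain x where x: "x \<in> space M" "V x < v / lam"
    unfolding v_def using cINF_less_iff[OF nonempty bb] by blast
  interpret Px: prob_space "P x" by (rule prob_space_prob_kernel[OF kernel x(1)])
  have "ennreal v = (\<integral>\<^sup>+y. ennreal v \<partial>P x)" by (simp add: Px.emeasure_space_1)
  also have "\<dots> \<le> (\<integral>\<^sup>+y. ennreal (V y) \<partial>P x)"
    using bb by (intro nn_integral_mono ennreal_leI) (auto simp: v_def space_prob_kernel[OF kernel x(1)] intro: cINF_lower)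
  also have "\<dots> \<le> ennreal (lam * V x)" using drift[OF x(1)] K by simp
  finally have "v \<le> lam * V x" using v1 lam V_nonneg[OF x(1)] by (subst (asm) ennreal_le_iff) auto
  then show False using x(2) lam by (simp add: field_simps)
qed

text \<open>
  At a point of \<open>K\<close> the measure \<open>\<delta> \<nu>\<close> is dominated by \<open>P\<^sup>m x\<close>, which integrates \<open>V\<close>.
\<close>

lemma nu_V_finite: "(\<integral>\<^sup>+y. ennreal (V y) \<partial>\<nu>) < \<infinity>"
proof -
  obtain x where xK: "x \<in> K" using K_nonempty by auto
  then have x: "x \<in> space M" using K sets.sets_into_space by auto
  have sn: "sets \<nu> = sets M" using nu by (simp add: space_prob_algebra)
  note kp = sets_prob_kernel[OF kernel_pow_kernel x]
  have "scale_measure (ennreal \<delta>) \<nu> \<le> kernel_pow M P m x"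
    using minor[OF xK] by (subst le_measure) (auto simp: sn kp)
  then have "(\<integral>\<^sup>+y. ennreal (V y) \<partial>scale_measure (ennreal \<delta>) \<nu>) \<le> (\<integral>\<^sup>+y. ennreal (V y) \<partial>kernel_pow M P m x)"
    by (intro nn_integral_mono_measure) (auto simp: sn kp)
  moreover have "(\<integral>\<^sup>+y. ennreal (V y) \<partial>scale_measure (ennreal \<delta>) \<nu>) = ennreal \<delta> * (\<integral>\<^sup>+y. ennreal (V y) \<partial>\<nu>)"
    by (simp add: nn_integral_scale_measure measurable_cong_sets[OF sn refl])
  ultimately have "ennreal \<delta> * (\<integral>\<^sup>+y. ennreal (V y) \<partial>\<nu>) \<le> ennreal ((1 + b / (1 - lam)) * V x)"
    using kernel_pow_V[OF x, of m] by (metis order_trans)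
  then have "ennreal \<delta> * (\<integral>\<^sup>+y. ennreal (V y) \<partial>\<nu>) < \<infinity>"
    by (auto intro: le_less_trans[OF _ ennreal_less_top])
  then show ?thesis using delta by (auto simp: ennreal_mult_less_top)
qed

text \<open>
  For \<open>\<eta> = 1/2\<close> let \<open>h - Q h = g - a\<close> and \<open>u = Q h\<close>. The resolvent equation reads \<open>u = h/2 + P u/2\<close>, and
  substituting \<open>h = u + g - a\<close> gives \<open>u - P u = g - a\<close>.
\<close>

lemma poisson_uniform:
  "\<exists>C\<ge>0. \<forall>c g. vbounded c g \<longrightarrow> (\<exists>a u. vbounded (C * c) u \<and> (\<forall>x\<in>space M. u x - kernel_op P u x = g x - a))"
proof -
  define \<eta> where "\<eta> = (1 / 2 :: real)"
  have eta: "0 < \<eta>" "\<eta> < 1" by (auto simp: \<eta>_def)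
  define \<kappa> where "\<kappa> = \<delta> * \<eta> ^ m"
  have kappa: "0 < \<kappa>" using delta eta by (simp add: \<kappa>_def)
  define s where "s = (\<lambda>x. \<kappa> * measure (resolvent \<eta> x) K)"
  have el: "0 < 1 - \<eta> * lam" "\<eta> * lam < \<eta>"
    using eta lam mult_strict_mono[of \<eta> 1 lam 1] by simp_all
  interpret Q: minorized_kernel M V "resolvent \<eta>" s \<nu> "(1 - \<eta>) / (1 - \<eta> * lam)" "\<eta> * b / (1 - \<eta> * lam) / \<kappa>"
  proof
    show "resolvent \<eta> \<in> M \<rightarrow>\<^sub>M prob_algebra M" by (rule resolvent_kernel[OF eta])
    show "s \<in> borel_measurable M" unfolding s_def
      using measure_measurable_subprob_algebra2[of M "\<lambda>_. K" M "resolvent \<eta>"] K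
        measurable_prob_algebraD[OF resolvent_kernel[OF eta]]
      by (intro borel_measurable_times borel_measurable_const measurable_compose[OF _ measurable_measure_subprob_algebra])
    show "0 \<le> s x" for x using kappa by (simp add: s_def)
    show "\<nu> \<in> space (prob_algebra M)" by (rule nu)
    show "(\<integral>\<^sup>+y. ennreal (V y) \<partial>\<nu>) < \<infinity>" by (rule nu_V_finite)
    show "ennreal (s x) * emeasure \<nu> A \<le> emeasure (resolvent \<eta> x) A" if "x \<in> space M" "A \<in> sets M" for x A
      using resolvent_minor[OF eta that] by (simp add: s_def \<kappa>_def)
    show "0 \<le> (1 - \<eta>) / (1 - \<eta> * lam)" using eta less_imp_le[OF el(1)] by (intro divide_nonneg_nonneg) auto
    show "(1 - \<eta>) / (1 - \<eta> * lam) < 1" using el by (subst pos_divide_less_eq) auto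
    show "0 \<le> \<eta> * b / (1 - \<eta> * lam) / \<kappa>"
      using eta less_imp_le[OF el(1)] b kappa by (intro divide_nonneg_nonneg) auto
    fix x assume x: "x \<in> space M"
    have "(\<integral>\<^sup>+y. ennreal (V y) \<partial>resolvent \<eta> x) = ennreal (kernel_op (resolvent \<eta>) V x)"
      unfolding kernel_op_def using V_nonneg
      by (intro nn_integral_eq_integral bounded_kernel_integrable[OF bounded_kernel_resolvent[OF eta] vbounded_V x])
        (auto simp: space_resolvent[OF eta x])
    also have "\<dots> \<le> ennreal ((1 - \<eta>) / (1 - \<eta> * lam) * V x + \<eta> * b / (1 - \<eta> * lam) / \<kappa> * s x)"
      using resolvent_drift[OF eta x] kappa by (intro ennreal_leI) (simp add: s_def)
    finally show "(\<integral>\<^sup>+y. ennreal (V y) \<partial>resolvent \<eta> x) \<le> ennreal ((1 - \<eta>) / (1 - \<eta> * lam) * V x + \<eta> * b / (1 - \<eta> * lam) / \<kappa> * s x)" .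
  qed
  obtain C where C: "\<And>g. vbounded 1 g \<Longrightarrow> \<exists>a h. vbounded C h \<and> (\<forall>x\<in>space M. h x - kernel_op (resolvent \<eta>) h x = g x - a)"
    using Q.poisson_minorized by blast
  have one: "vbounded 1 (\<lambda>_. 1)" using vbounded_const[of 1] by simp
  have C0: "0 \<le> C" using C[OF one] vbounded_nonneg by blast
  have P1: "\<exists>a u. vbounded (C * growth) u \<and> (\<forall>x\<in>space M. u x - kernel_op P u x = g x - a)" if g: "vbounded 1 g" for g
  proof -
    obtain a h where h: "vbounded C h" "\<And>x. x \<in> space M \<Longrightarrow> h x - kernel_op (resolvent \<eta>) h x = g x - a"
      using C[OF g] by blast
    let ?u = "kernel_op (resolvent \<eta>) h"
    have "?u x - kernel_op P ?u x = g x - a" if x: "x \<in> space M" for x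
      using resolvent_left[OF eta h(1) x] h(2)[OF x] by (simp add: \<eta>_def)
    then show ?thesis using kernel_op_vbounded[OF bounded_kernel_resolvent[OF eta] h(1)] by blast
  qed
  show ?thesis
  proof (rule exI[of _ "C * growth"], intro conjI allI impI)
    show "0 \<le> C * growth" using C0 growth_ge_1 by simp
    fix c g assume g: "vbounded c g"
    show "\<exists>a u. vbounded (C * growth * c) u \<and> (\<forall>x\<in>space M. u x - kernel_op P u x = g x - a)"
    proof (cases "c = 0")
      case True
      then have "g x = 0" if "x \<in> space M" for x using vboundedD[OF g that] by simp
      then show ?thesis
        by (intro exI[of _ 0] exI[of _ "\<lambda>_. 0"]) (auto simp: vbounded_def kernel_op_def True)
    next
      case False
      with vbounded_nonneg[OF g] have c: "0 < c" by simp
      have "vbounded 1 (\<lambda>x. 1 / c * g x)" using vbounded_scale[OF g, of "1 / c"] c by simp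
      from P1[OF this] obtain a u where u: "vbounded (C * growth) u"
        "\<And>x. x \<in> space M \<Longrightarrow> u x - kernel_op P u x = 1 / c * g x - a" by blast
      have "c * u x - kernel_op P (\<lambda>x. c * u x) x = g x - c * a" if "x \<in> space M" for x
      proof -
        have "c * u x - kernel_op P (\<lambda>x. c * u x) x = c * (u x - kernel_op P u x)"
          by (simp add: kernel_op_scale right_diff_distrib)
        also have "\<dots> = g x - c * a" using c by (simp add: u(2)[OF that] right_diff_distrib)
        finally show ?thesis .
      qed
      then show ?thesis
        using vbounded_scale[OF u(1), of c] c
        by (intro exI[of _ "c * a"] exI[of _ "\<lambda>x. c * u x"]) (auto simp: mult.commute)
    qed
  qed
qed


text \<open>
  Bounded functions suffice for the uniqueness argument, where the invariant probability is not yet known to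
  integrate \<open>V\<close>.
\<close>

lemma invariant_integral:
  assumes inv: "invariant_prob M P \<pi>" and g: "g \<in> borel_measurable M" and gB: "\<And>x. x \<in> space M \<Longrightarrow> \<bar>g x\<bar> \<le> B"
  shows "(\<integral>x. kernel_op P g x \<partial>\<pi>) = (\<integral>x. g x \<partial>\<pi>)"
proof -
  have s: "sets \<pi> = sets M" and p: "prob_space \<pi>" and b: "\<pi> \<bind> P = \<pi>"
    using inv by (auto simp: invariant_prob_def space_prob_algebra)
  interpret pi: prob_space \<pi> by fact
  have sp: "space \<pi> = space M" by (rule sets_eq_imp_space_eq[OF s])
  have N: "P \<in> \<pi> \<rightarrow>\<^sub>M subprob_algebra M"
    using measurable_prob_algebraD[OF kernel] by (simp add: measurable_cong_sets[OF s refl])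
  have "(\<integral>\<^sup>+y. ennreal \<bar>g y\<bar> \<partial>P x) \<le> ennreal B" if x: "x \<in> space M" for x
  proof -
    interpret Px: prob_space "P x" by (rule prob_space_prob_kernel[OF kernel x])
    have "(\<integral>\<^sup>+y. ennreal \<bar>g y\<bar> \<partial>P x) \<le> (\<integral>\<^sup>+y. ennreal B \<partial>P x)"
      using gB by (intro nn_integral_mono ennreal_leI) (simp add: space_prob_kernel[OF kernel x])
    then show ?thesis by (simp add: Px.emeasure_space_1)
  qed
  then have "(\<integral>\<^sup>+x. \<integral>\<^sup>+y. ennreal \<bar>g y\<bar> \<partial>P x \<partial>\<pi>) \<le> (\<integral>\<^sup>+x. ennreal B \<partial>\<pi>)"
    by (intro nn_integral_mono) (simp add: sp)
  also have "\<dots> < \<infinity>" by (simp add: pi.emeasure_space_1)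
  finally have fin: "(\<integral>\<^sup>+x. \<integral>\<^sup>+y. ennreal \<bar>g y\<bar> \<partial>P x \<partial>\<pi>) < \<infinity>" .
  have ne: "space \<pi> \<noteq> {}" using sp nonempty by simp
  show ?thesis
    using integral_bind_real(3)[OF N g ne fin] unfolding b by (simp add: kernel_op_def)
qed

lemma vbounded_indicator: "A \<in> sets M \<Longrightarrow> vbounded 1 (indicator A)"
  using V_ge_1 V_nonneg by (auto simp: vbounded_def indicator_def)

lemma kernel_op_indicator:
  "L \<in> M \<rightarrow>\<^sub>M prob_algebra M \<Longrightarrow> x \<in> space M \<Longrightarrow> A \<in> sets M \<Longrightarrow> kernel_op L (indicator A) x = measure (L x) A"
  by (simp add: kernel_op_def sets_prob_kernel)

text \<open>
  With \<open>u - P u = g - a\<close> the resolvent equation gives \<open>Q g - a = (1 - \<eta>) (u - Q P u)\<close>, which tends to zero as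
  \<open>\<eta>\<close> tends to \<open>1\<close>, uniformly over balls of the weighted space. In particular \<open>a\<close> is determined by \<open>g\<close>.
\<close>

lemma resolvent_converges:
  obtains D c where "0 \<le> D"
    "\<And>\<eta> k g x. 0 < \<eta> \<Longrightarrow> \<eta> < 1 \<Longrightarrow> vbounded k g \<Longrightarrow> x \<in> space M \<Longrightarrow>
       \<bar>kernel_op (resolvent \<eta>) g x - c g\<bar> \<le> k * ((1 - \<eta>) * D * V x)"
    "\<And>k g. vbounded k g \<Longrightarrow> \<exists>C u. vbounded C u \<and> (\<forall>x\<in>space M. u x - kernel_op P u x = g x - c g)"
proof -
  obtain C where C: "0 \<le> C"
    "\<And>k g. vbounded k g \<Longrightarrow> \<exists>a u. vbounded (C * k) u \<and> (\<forall>x\<in>space M. u x - kernel_op P u x = g x - a)"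
    using poisson_uniform by blast
  define D where "D = C * (1 + growth * growth)"
  have bound: "\<bar>kernel_op (resolvent \<eta>) g x - a\<bar> \<le> k * ((1 - \<eta>) * D * V x)"
    if eta: "0 < \<eta>" "\<eta> < 1" and g: "vbounded k g" and u: "vbounded (C * k) u"
      and eq: "\<And>x. x \<in> space M \<Longrightarrow> u x - kernel_op P u x = g x - a" and x: "x \<in> space M" for \<eta> k g u a x
  proof -
    let ?Q = "resolvent \<eta>"
    note Pu = kernel_op_vbounded[OF bounded_kernel_P u]
    note QPu = kernel_op_vbounded[OF bounded_kernel_resolvent[OF eta] Pu]
    have "kernel_op ?Q g x - a = kernel_op ?Q (\<lambda>y. g y - a) x"
      using kernel_op_diff[OF bounded_kernel_resolvent[OF eta] g vbounded_const x]
        kernel_op_const[OF resolvent_kernel[OF eta] x] by simp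
    also have "\<dots> = kernel_op ?Q (\<lambda>y. u y - kernel_op P u y) x"
      unfolding kernel_op_def[of ?Q]
      by (rule Bochner_Integration.integral_cong) (simp_all add: eq space_resolvent[OF eta x])
    also have "\<dots> = kernel_op ?Q u x - kernel_op ?Q (kernel_op P u) x"
      by (rule kernel_op_diff[OF bounded_kernel_resolvent[OF eta] u Pu x])
    also have "\<dots> = (1 - \<eta>) * (u x - kernel_op ?Q (kernel_op P u) x)"
      unfolding resolvent_right[OF eta u x] by (simp add: algebra_simps)
    finally have "\<bar>kernel_op ?Q g x - a\<bar> = (1 - \<eta>) * \<bar>u x - kernel_op ?Q (kernel_op P u) x\<bar>"
      using eta by (simp add: abs_mult)
    also have "\<dots> \<le> (1 - \<eta>) * (C * k * V x + C * k * growth * growth * V x)"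
      using eta vboundedD[OF u x] vboundedD[OF QPu x]
      by (intro mult_left_mono order_trans[OF abs_triangle_ineq4] add_mono) auto
    also have "\<dots> = k * ((1 - \<eta>) * D * V x)" by (simp add: D_def algebra_simps)
    finally show ?thesis .
  qed
  obtain x0 where x0: "x0 \<in> space M" using nonempty by blast
  define \<eta>n where "\<eta>n = (\<lambda>n::nat. 1 - 1 / (real n + 2))"
  have \<eta>n: "0 < \<eta>n n" "\<eta>n n < 1" for n by (auto simp: \<eta>n_def field_simps)
  have \<eta>l: "(\<lambda>n. 1 - \<eta>n n) \<longlonglongrightarrow> 0" unfolding \<eta>n_def by real_asymp
  define c where "c = (\<lambda>g. lim (\<lambda>n. kernel_op (resolvent (\<eta>n n)) g x0))"
  have c: "c g = a" if g: "vbounded k g" and u: "vbounded (C * k) u"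
      and eq: "\<And>x. x \<in> space M \<Longrightarrow> u x - kernel_op P u x = g x - a" for k g u a
  proof -
    have "(\<lambda>n. k * ((1 - \<eta>n n) * D * V x0)) \<longlonglongrightarrow> k * (0 * D * V x0)"
      by (intro tendsto_intros \<eta>l)
    then have A: "(\<lambda>n. k * ((1 - \<eta>n n) * D * V x0)) \<longlonglongrightarrow> 0" by simp
    have B: "\<forall>n. norm (kernel_op (resolvent (\<eta>n n)) g x0 - a) \<le> k * ((1 - \<eta>n n) * D * V x0)"
      using bound[OF \<eta>n g u eq x0] by simp
    have "(\<lambda>n. kernel_op (resolvent (\<eta>n n)) g x0 - a) \<longlonglongrightarrow> 0"
      by (rule Lim_null_comparison[OF always_eventually[OF B] A])
    then show ?thesis unfolding c_def by (intro limI) (simp add: LIM_zero_iff)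
  qed
  have ex: "\<exists>u. vbounded (C * k) u \<and> (\<forall>x\<in>space M. u x - kernel_op P u x = g x - c g)" if g: "vbounded k g" for k g
    using C(2)[OF g] c[OF g] by metis
  show ?thesis
  proof (rule that[of D c])
    show "0 \<le> D" using C(1) growth_ge_1 by (simp add: D_def)
    show "\<bar>kernel_op (resolvent \<eta>) g x - c g\<bar> \<le> k * ((1 - \<eta>) * D * V x)"
      if "0 < \<eta>" "\<eta> < 1" "vbounded k g" "x \<in> space M" for \<eta> k g x
      using ex[OF that(3)] bound[OF that(1-3) _ _ that(4)] by blast
    show "\<exists>C u. vbounded C u \<and> (\<forall>x\<in>space M. u x - kernel_op P u x = g x - c g)" if "vbounded k g" for k g
      using ex[OF that] by blast
  qed
qed

text \<open>
  The limit functional of the resolvents is a probability measure by \<open>uniform_limit_measure\<close> and is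
  invariant by the resolvent equation. Conversely an invariant probability is invariant under every resolvent,
  and \<open>Q g\<close> converges pointwise to the constant \<open>\<pi> g\<close>; integrating identifies the two measures.
\<close>

theorem invariant_prob_exists_unique:
  obtains \<pi> where "invariant_prob M P \<pi>" "\<And>\<pi>'. invariant_prob M P \<pi>' \<Longrightarrow> \<pi>' = \<pi>"
    "\<And>k g. vbounded k g \<Longrightarrow> integrable \<pi> g"
    "\<And>k g. vbounded k g \<Longrightarrow> \<exists>C u. vbounded C u \<and> (\<forall>x\<in>space M. u x - kernel_op P u x = g x - (\<integral>y. g y \<partial>\<pi>))"
proof -
  obtain D c where D: "0 \<le> D"
    and conv: "\<And>\<eta> k g x. 0 < \<eta> \<Longrightarrow> \<eta> < 1 \<Longrightarrow> vbounded k g \<Longrightarrow> x \<in> space M \<Longrightarrow>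
       \<bar>kernel_op (resolvent \<eta>) g x - c g\<bar> \<le> k * ((1 - \<eta>) * D * V x)"
    and pois: "\<And>k g. vbounded k g \<Longrightarrow> \<exists>C u. vbounded C u \<and> (\<forall>x\<in>space M. u x - kernel_op P u x = g x - c g)"
    using resolvent_converges by blast
  obtain x0 where x0: "x0 \<in> space M" using nonempty by blast
  define \<eta> where "\<eta> = (\<lambda>n::nat. 1 - 1 / (real n + 2))"
  have eta: "0 < \<eta> n" "\<eta> n < 1" for n by (auto simp: \<eta>_def field_simps)
  have etal: "\<eta> \<longlonglongrightarrow> 1" unfolding \<eta>_def by real_asymp
  have lim: "(\<lambda>n. kernel_op (resolvent (\<eta> n)) g x) \<longlonglongrightarrow> c g" if "vbounded k g" "x \<in> space M" for k g x
  proof -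
    have "(\<lambda>n. k * ((1 - \<eta> n) * D * V x)) \<longlonglongrightarrow> k * ((1 - 1) * D * V x)"
      by (intro tendsto_intros etal)
    then have A: "(\<lambda>n. k * ((1 - \<eta> n) * D * V x)) \<longlonglongrightarrow> 0" by simp
    have B: "\<forall>n. norm (kernel_op (resolvent (\<eta> n)) g x - c g) \<le> k * ((1 - \<eta> n) * D * V x)"
      using conv[OF eta that] by simp
    have "(\<lambda>n. kernel_op (resolvent (\<eta> n)) g x - c g) \<longlonglongrightarrow> 0"
      by (rule Lim_null_comparison[OF always_eventually[OF B] A])
    then show ?thesis by (simp add: LIM_zero_iff)
  qed
  have "\<exists>\<pi>\<in>space (prob_algebra M). \<forall>k g. vbounded k g \<longrightarrow> integrable \<pi> g \<and> (\<integral>y. g y \<partial>\<pi>) = c g"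
  proof (rule uniform_limit_measure[where \<mu>="\<lambda>n. resolvent (\<eta> n) x0" and r="\<lambda>n. (1 - \<eta> n) * D * V x0"])
    show "resolvent (\<eta> n) x0 \<in> space (prob_algebra M)" for n
      by (rule measurable_space[OF resolvent_kernel[OF eta] x0])
    show "(\<integral>\<^sup>+y. ennreal (V y) \<partial>resolvent (\<eta> n) x0) < \<infinity>" for n
      using bounded_kernel_resolvent[OF eta, of n] x0 unfolding bounded_kernel_def
      by (auto intro: le_less_trans[OF _ ennreal_less_top])
    show "\<bar>(\<integral>y. g y \<partial>resolvent (\<eta> n) x0) - c g\<bar> \<le> k * ((1 - \<eta> n) * D * V x0)" if "vbounded k g" for k g n
      using conv[OF eta that x0, of n] by (simp add: kernel_op_def)
    have "(\<lambda>n. (1 - \<eta> n) * D * V x0) \<longlonglongrightarrow> (1 - 1) * D * V x0" by (intro tendsto_intros etal)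
    then show "(\<lambda>n. (1 - \<eta> n) * D * V x0) \<longlonglongrightarrow> 0" by simp
  qed
  then obtain \<pi> where pi: "\<pi> \<in> space (prob_algebra M)"
    and int: "\<And>k g. vbounded k g \<Longrightarrow> integrable \<pi> g" and pic: "\<And>k g. vbounded k g \<Longrightarrow> (\<integral>y. g y \<partial>\<pi>) = c g"
    by blast
  have s: "sets \<pi> = sets M" and pp: "prob_space \<pi>" using pi by (auto simp: space_prob_algebra)
  interpret pi: prob_space \<pi> by fact
  have sp: "space \<pi> = space M" by (rule sets_eq_imp_space_eq[OF s])
  have N: "P \<in> \<pi> \<rightarrow>\<^sub>M subprob_algebra M"
    using measurable_prob_algebraD[OF kernel] by (simp add: measurable_cong_sets[OF s refl])
  have mA: "measure \<pi> A = c (indicator A)" if "A \<in> sets M" for A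
    using pic[OF vbounded_indicator[OF that]] that s by simp
  have cP: "c (kernel_op P g) = c g" if g: "vbounded k g" for k g
  proof (rule LIMSEQ_unique)
    show "(\<lambda>n. \<eta> n * kernel_op (resolvent (\<eta> n)) (kernel_op P g) x0) \<longlonglongrightarrow> c (kernel_op P g)"
      using tendsto_mult[OF etal lim[OF kernel_op_vbounded[OF bounded_kernel_P g] x0]] by simp
    have "\<eta> n * kernel_op (resolvent (\<eta> n)) (kernel_op P g) x0 = kernel_op (resolvent (\<eta> n)) g x0 - (1 - \<eta> n) * g x0" for n
      using resolvent_right[OF eta g x0, of n] by simp
    moreover have "(\<lambda>n. kernel_op (resolvent (\<eta> n)) g x0 - (1 - \<eta> n) * g x0) \<longlonglongrightarrow> c g - (1 - 1) * g x0"
      by (intro tendsto_intros lim[OF g x0] etal)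
    ultimately show "(\<lambda>n. \<eta> n * kernel_op (resolvent (\<eta> n)) (kernel_op P g) x0) \<longlonglongrightarrow> c g" by simp
  qed
  have inv: "invariant_prob M P \<pi>"
    unfolding invariant_prob_def
  proof (intro conjI pi measure_eqI)
    show sb: "sets (\<pi> \<bind> P) = sets \<pi>"
      using nonempty sets_prob_kernel[OF kernel] by (subst sets_bind[where N=M]) (auto simp: sp s)
    fix A assume "A \<in> sets (\<pi> \<bind> P)"
    then have A: "A \<in> sets M" using sb s by simp
    have "emeasure (\<pi> \<bind> P) A = (\<integral>\<^sup>+x. emeasure (P x) A \<partial>\<pi>)"
      by (rule emeasure_bind[OF _ N A]) (simp add: nonempty sp)
    also have "\<dots> = (\<integral>\<^sup>+x. ennreal (kernel_op P (indicator A) x) \<partial>\<pi>)"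
      using finite_measure.emeasure_eq_measure[OF prob_space.finite_measure[OF prob_space_prob_kernel[OF kernel]]]
      by (intro nn_integral_cong) (simp add: sp kernel_op_indicator[OF kernel _ A])
    also have "\<dots> = ennreal (\<integral>x. kernel_op P (indicator A) x \<partial>\<pi>)"
      using int[OF kernel_op_vbounded[OF bounded_kernel_P vbounded_indicator[OF A]]]
      by (intro nn_integral_eq_integral) (auto simp: sp kernel_op_indicator[OF kernel _ A])
    also have "\<dots> = emeasure \<pi> A"
      by (simp add: pic[OF kernel_op_vbounded[OF bounded_kernel_P vbounded_indicator[OF A]]]
         cP[OF vbounded_indicator[OF A]] mA[OF A] pi.emeasure_eq_measure)
    finally show "emeasure (\<pi> \<bind> P) A = emeasure \<pi> A" .
  qed
  have uniq: "\<pi>' = \<pi>" if inv': "invariant_prob M P \<pi>'" for \<pi>'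
  proof (rule measure_eqI)
    have s': "sets \<pi>' = sets M" and p': "prob_space \<pi>'" using inv' by (auto simp: invariant_prob_def space_prob_algebra)
    interpret pi': prob_space \<pi>' by fact
    have sp': "space \<pi>' = space M" by (rule sets_eq_imp_space_eq[OF s'])
    show "sets \<pi>' = sets \<pi>" using s s' by simp
    fix A assume "A \<in> sets \<pi>'"
    then have A: "A \<in> sets M" using s' by simp
    let ?G = "\<lambda>n. kernel_op (resolvent (\<eta> n)) (indicator A)"
    note vA = vbounded_indicator[OF A]
    have Gm: "?G n \<in> borel_measurable M" for n
      by (rule vbounded_measurable[OF kernel_op_vbounded[OF bounded_kernel_resolvent[OF eta] vA]])
    have G1: "\<bar>?G n x\<bar> \<le> 1" if "x \<in> space M" for n x
      using prob_space.prob_le_1[OF prob_space_prob_kernel[OF resolvent_kernel[OF eta] that]]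
      by (simp add: kernel_op_indicator[OF resolvent_kernel[OF eta] that A])
    have bi: "integrable \<pi>' h" if "h \<in> borel_measurable M" "\<And>x. x \<in> space M \<Longrightarrow> \<bar>h x\<bar> \<le> 1" for h :: "'x \<Rightarrow> real"
      using that s' by (intro pi'.integrable_const_bound[where B=1]) (auto simp: sp' measurable_cong_sets[OF s' refl])
    \<comment> \<open>\<open>\<pi>'\<close> is invariant under the resolvents as well\<close>
    have "(\<integral>x. ?G n x \<partial>\<pi>') = measure \<pi>' A" for n
    proof -
      have PG1: "\<bar>kernel_op P (?G n) x\<bar> \<le> 1" if x: "x \<in> space M" for x
      proof -
        interpret Px: prob_space "P x" by (rule prob_space_prob_kernel[OF kernel x])
        have "\<bar>\<integral>y. ?G n y \<partial>P x\<bar> \<le> (\<integral>y. \<bar>?G n y\<bar> \<partial>P x)" by (rule integral_abs_bound)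
        also have "\<dots> \<le> 1"
          using G1 by (intro Px.integral_le_const) (auto intro!: Px.integrable_const_bound[where B=1] borel_measurable_abs
            simp: space_prob_kernel[OF kernel x] measurable_cong_sets[OF sets_prob_kernel[OF kernel x] refl] Gm)
        finally show ?thesis by (simp add: kernel_op_def[of P])
      qed
      have PGm: "kernel_op P (?G n) \<in> borel_measurable M"
        by (rule vbounded_measurable[OF kernel_op_vbounded[OF bounded_kernel_P kernel_op_vbounded[OF bounded_kernel_resolvent[OF eta] vA]]])
      have "(\<integral>x. ?G n x \<partial>\<pi>') = (\<integral>x. (1 - \<eta> n) * indicator A x + \<eta> n * kernel_op P (?G n) x \<partial>\<pi>')"
        by (rule Bochner_Integration.integral_cong) (simp_all add: sp' resolvent_left[OF eta vA])
      also have "\<dots> = (1 - \<eta> n) * measure \<pi>' A + \<eta> n * (\<integral>x. kernel_op P (?G n) x \<partial>\<pi>')"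
      proof -
        have "integrable \<pi>' (indicator A :: 'x \<Rightarrow> real)" using A by (intro bi) (auto simp: indicator_def)
        then show ?thesis using bi[OF PGm PG1] A s' by simp
      qed
      also have "(\<integral>x. kernel_op P (?G n) x \<partial>\<pi>') = (\<integral>x. ?G n x \<partial>\<pi>')"
        by (rule invariant_integral[OF inv' Gm G1])
      finally have "(1 - \<eta> n) * ((\<integral>x. ?G n x \<partial>\<pi>') - measure \<pi>' A) = 0" by (simp add: algebra_simps)
      then show ?thesis using eta[of n] by simp
    qed
    moreover have "(\<lambda>n. \<integral>x. ?G n x \<partial>\<pi>') \<longlonglongrightarrow> (\<integral>x. c (indicator A) \<partial>\<pi>')"
      using lim[OF vA] G1 Gm
      by (intro integral_dominated_convergence[where w="\<lambda>_. 1"]) (auto simp: sp' measurable_cong_sets[OF s' refl])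
    ultimately have "measure \<pi>' A = c (indicator A)"
      using pi'.prob_space by (simp add: LIMSEQ_const_iff)
    then show "emeasure \<pi>' A = emeasure \<pi> A"
      by (simp add: mA[OF A] pi.emeasure_eq_measure pi'.emeasure_eq_measure)
  qed
  show ?thesis
    using pois pic by (intro that[OF inv uniq int]) auto
qed

end

section \<open>The Markov property\<close>

locale kernel_chain =
  fixes M :: "'x measure" and P :: "'x \<Rightarrow> 'x measure" and \<mu> :: "'x measure"
    and \<Omega> :: "'w measure" and \<Phi> :: "nat \<Rightarrow> 'w \<Rightarrow> 'x"
  assumes kernel: "P \<in> M \<rightarrow>\<^sub>M prob_algebra M"
    and chain: "markov_chain M P \<mu> \<Omega> \<Phi>"
begin

sublocale \<Omega>: prob_space \<Omega> using chain by (simp add: markov_chain_def)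

lemma chain_measurable [measurable]: "\<Phi> n \<in> \<Omega> \<rightarrow>\<^sub>M M"
  using chain by (simp add: markov_chain_def)

lemma chain_space: "\<omega> \<in> space \<Omega> \<Longrightarrow> \<Phi> n \<omega> \<in> space M"
  by (rule measurable_space[OF chain_measurable])

abbreviation F :: "nat \<Rightarrow> 'w measure" where "F \<equiv> natural_filtration \<Omega> M \<Phi>"

lemma space_F [simp]: "space (F n) = space \<Omega>"
  by (simp add: natural_filtration_def)

lemma history_measurable: "(\<lambda>\<omega>. \<lambda>i\<in>{..n}. \<Phi> i \<omega>) \<in> \<Omega> \<rightarrow>\<^sub>M Pi\<^sub>M {..n} (\<lambda>_. M)"
  by (rule measurable_restrict) simp

lemma subalgebra_F: "subalgebra \<Omega> (F n)"
proof -
  have "(\<lambda>\<omega>. \<lambda>i\<in>{..n}. \<Phi> i \<omega>) \<in> space \<Omega> \<rightarrow> space (Pi\<^sub>M {..n} (\<lambda>_. M))"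
    using measurable_space[OF history_measurable] by blast
  then have "sets (F n) = {(\<lambda>\<omega>. \<lambda>i\<in>{..n}. \<Phi> i \<omega>) -` A \<inter> space \<Omega> | A. A \<in> sets (Pi\<^sub>M {..n} (\<lambda>_. M))}"
    unfolding natural_filtration_def by (rule sets_vimage_algebra2)
  then show ?thesis
    unfolding subalgebra_def using measurable_sets[OF history_measurable] by auto
qed

lemma id_measurable_F: "(\<lambda>\<omega>. \<omega>) \<in> \<Omega> \<rightarrow>\<^sub>M F n"
  using subalgebra_F[of n] by (auto simp: subalgebra_def intro!: measurableI)

lemma measurable_F_chain:
  assumes "k \<le> n" shows "\<Phi> k \<in> F n \<rightarrow>\<^sub>M M"
proof -
  have "(\<lambda>\<omega>. \<lambda>i\<in>{..n}. \<Phi> i \<omega>) \<in> space \<Omega> \<rightarrow> space (Pi\<^sub>M {..n} (\<lambda>_. M))"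
    using measurable_space[OF history_measurable] by blast
  then have "(\<lambda>\<omega>. \<lambda>i\<in>{..n}. \<Phi> i \<omega>) \<in> F n \<rightarrow>\<^sub>M Pi\<^sub>M {..n} (\<lambda>_. M)"
    unfolding natural_filtration_def by (rule measurable_vimage_algebra1)
  from measurable_compose[OF this measurable_component_singleton[of k]] assms
  show ?thesis by simp
qed

text \<open>
  The conditional law of the pair (history, next state), given the history up to time \<open>n\<close>. The history enters
  as the point \<open>\<omega>\<close>, seen through the filtration.
\<close>

definition step_kernel :: "nat \<Rightarrow> 'w \<Rightarrow> ('w \<times> 'x) measure" where
  "step_kernel n \<omega> = distr (P (\<Phi> n \<omega>)) (F n \<Otimes>\<^sub>M M) (\<lambda>y. (\<omega>, y))"

lemma P_chain_measurable: "(\<lambda>\<omega>. P (\<Phi> n \<omega>)) \<in> \<Omega> \<rightarrow>\<^sub>M subprob_algebra M"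
  by (rule measurable_compose[OF chain_measurable measurable_prob_algebraD[OF kernel]])

lemma pair_id_measurable: "(\<lambda>(\<omega>, y). (\<omega>, y)) \<in> \<Omega> \<Otimes>\<^sub>M M \<rightarrow>\<^sub>M F n \<Otimes>\<^sub>M M"
proof -
  have "(\<lambda>p. (fst p, snd p)) \<in> \<Omega> \<Otimes>\<^sub>M M \<rightarrow>\<^sub>M F n \<Otimes>\<^sub>M M"
    by (intro measurable_Pair measurable_compose[OF measurable_fst id_measurable_F] measurable_snd)
  then show ?thesis by (simp add: case_prod_beta')
qed

lemma step_kernel_measurable: "step_kernel n \<in> \<Omega> \<rightarrow>\<^sub>M subprob_algebra (F n \<Otimes>\<^sub>M M)"
  unfolding step_kernel_def[abs_def]
  by (rule measurable_distr2[OF pair_id_measurable P_chain_measurable])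

lemma Pair_measurable_P:
  assumes "\<omega> \<in> space \<Omega>" shows "(\<lambda>y. (\<omega>, y)) \<in> P (\<Phi> n \<omega>) \<rightarrow>\<^sub>M F n \<Otimes>\<^sub>M M"
  unfolding measurable_cong_sets[OF sets_prob_kernel[OF kernel chain_space[OF assms]] refl]
  using assms by (intro measurable_Pair1') simp

text \<open>
  The definition of a Markov chain, integrated over an event of the past.
\<close>

lemma markov_rectangle:
  assumes B: "B \<in> sets (F n)" and A: "A \<in> sets M"
  shows "emeasure \<Omega> (B \<inter> (\<Phi> (Suc n) -` A \<inter> space \<Omega>)) = (\<integral>\<^sup>+\<omega>. indicator B \<omega> * emeasure (P (\<Phi> n \<omega>)) A \<partial>\<Omega>)"
proof -
  interpret sub: finite_measure_subalgebra \<Omega> "F n"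
    by unfold_locales (rule subalgebra_F)
  have [measurable]: "A \<in> sets M" by fact
  have B'[measurable]: "B \<in> sets \<Omega>" using B subalgebra_F by (auto simp: subalgebra_def)
  let ?E = "\<Phi> (Suc n) -` A \<inter> space \<Omega>"
  have E[measurable]: "?E \<in> sets \<Omega>" by measurable
  have Pm[measurable]: "(\<lambda>\<omega>. measure (P (\<Phi> n \<omega>)) A) \<in> borel_measurable \<Omega>"
    using measurable_compose[OF P_chain_measurable measurable_measure_subprob_algebra[OF A]] .
  have ae: "AE \<omega> in \<Omega>. real_cond_exp \<Omega> (F n) (indicator ?E) \<omega> = measure (P (\<Phi> n \<omega>)) A"
    using chain A by (auto simp: markov_chain_def)
  have iE: "integrable \<Omega> (indicator ?E :: _ \<Rightarrow> real)"
    by (intro \<Omega>.integrable_const_bound[where B=1]) auto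
  have Pi: "integrable \<Omega> (\<lambda>\<omega>. indicator B \<omega> * measure (P (\<Phi> n \<omega>)) A)"
    using prob_space.prob_le_1[OF prob_space_prob_kernel[OF kernel chain_space]]
    by (intro \<Omega>.integrable_const_bound[where B=1]) (auto simp: indicator_def)
  have "measure \<Omega> (B \<inter> ?E) = (\<integral>\<omega>\<in>B. indicator ?E \<omega> \<partial>\<Omega>)"
    using measurable_sets[OF chain_measurable A, of "Suc n"] B'
    by (simp add: set_lebesgue_integral_def indicator_inter_arith[symmetric])
  also have "\<dots> = (\<integral>\<omega>\<in>B. real_cond_exp \<Omega> (F n) (indicator ?E) \<omega> \<partial>\<Omega>)"
    by (rule sub.real_cond_exp_intA[OF iE B])
  also have "\<dots> = (\<integral>\<omega>. indicator B \<omega> * measure (P (\<Phi> n \<omega>)) A \<partial>\<Omega>)"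
    unfolding set_lebesgue_integral_def using ae
    by (intro integral_cong_AE) auto
  finally have "emeasure \<Omega> (B \<inter> ?E) = ennreal (\<integral>\<omega>. indicator B \<omega> * measure (P (\<Phi> n \<omega>)) A \<partial>\<Omega>)"
    by (simp add: \<Omega>.emeasure_eq_measure)
  also have "\<dots> = (\<integral>\<^sup>+\<omega>. ennreal (indicator B \<omega> * measure (P (\<Phi> n \<omega>)) A) \<partial>\<Omega>)"
    by (intro nn_integral_eq_integral[symmetric] Pi) (auto simp: indicator_def)
  also have "\<dots> = (\<integral>\<^sup>+\<omega>. indicator B \<omega> * emeasure (P (\<Phi> n \<omega>)) A \<partial>\<Omega>)"
    using finite_measure.emeasure_eq_measure[OF prob_space.finite_measure[OF prob_space_prob_kernel[OF kernel chain_space]]]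
    by (intro nn_integral_cong) (auto simp: indicator_def)
  finally show ?thesis .
qed

text \<open>
  Both sides agree on rectangles, which generate the product \<open>\<sigma>\<close>-algebra.
\<close>

lemma markov_distr: "distr \<Omega> (F n \<Otimes>\<^sub>M M) (\<lambda>\<omega>. (\<omega>, \<Phi> (Suc n) \<omega>)) = \<Omega> \<bind> step_kernel n"
proof (rule measure_eqI_generator_eq[OF Int_stable_pair_measure_generator[of "F n" M]])
  let ?D = "distr \<Omega> (F n \<Otimes>\<^sub>M M) (\<lambda>\<omega>. (\<omega>, \<Phi> (Suc n) \<omega>))"
  have m: "(\<lambda>\<omega>. (\<omega>, \<Phi> (Suc n) \<omega>)) \<in> \<Omega> \<rightarrow>\<^sub>M F n \<Otimes>\<^sub>M M"
    by (intro measurable_Pair id_measurable_F chain_measurable)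
  show "{a \<times> b |a b. a \<in> sets (F n) \<and> b \<in> sets M} \<subseteq> Pow (space (F n) \<times> space M)"
    by (rule pair_measure_closed)
  show "sets ?D = sigma_sets (space (F n) \<times> space M) {a \<times> b |a b. a \<in> sets (F n) \<and> b \<in> sets M}"
    by (simp add: sets_pair_measure)
  have sb: "sets (\<Omega> \<bind> step_kernel n) = sets (F n \<Otimes>\<^sub>M M)"
    by (rule sets_bind[OF sets_kernel[OF step_kernel_measurable] \<Omega>.not_empty])
  then show "sets (\<Omega> \<bind> step_kernel n) = sigma_sets (space (F n) \<times> space M) {a \<times> b |a b. a \<in> sets (F n) \<and> b \<in> sets M}"
    by (simp add: sets_pair_measure)
  show "range (\<lambda>_::nat. space (F n) \<times> space M) \<subseteq> {a \<times> b |a b. a \<in> sets (F n) \<and> b \<in> sets M}" by blast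
  show "(\<Union>i::nat. space (F n) \<times> space M) = space (F n) \<times> space M" by simp
  show "emeasure ?D (space (F n) \<times> space M) \<noteq> \<infinity>" for i :: nat
    using prob_space.emeasure_le_1[OF \<Omega>.prob_space_distr[OF m]] by (metis ennreal_one_less_top infinity_ennreal_def leD)
  fix X assume "X \<in> {a \<times> b |a b. a \<in> sets (F n) \<and> b \<in> sets M}"
  then obtain B A where X: "X = B \<times> A" and B: "B \<in> sets (F n)" and A: "A \<in> sets M" by blast
  have BO: "B \<subseteq> space \<Omega>" using sets.sets_into_space[OF B] by simp
  have "emeasure ?D X = emeasure \<Omega> (B \<inter> (\<Phi> (Suc n) -` A \<inter> space \<Omega>))"
    unfolding X using A B BO by (subst emeasure_distr[OF m]) (auto intro!: arg_cong2[where f=emeasure])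
  also have "\<dots> = (\<integral>\<^sup>+\<omega>. indicator B \<omega> * emeasure (P (\<Phi> n \<omega>)) A \<partial>\<Omega>)" by (rule markov_rectangle[OF B A])
  also have "\<dots> = (\<integral>\<^sup>+\<omega>. emeasure (step_kernel n \<omega>) X \<partial>\<Omega>)"
  proof (rule nn_integral_cong)
    fix \<omega> assume w: "\<omega> \<in> space \<Omega>"
    have "emeasure (step_kernel n \<omega>) X = emeasure (P (\<Phi> n \<omega>)) ((\<lambda>y. (\<omega>, y)) -` X \<inter> space (P (\<Phi> n \<omega>)))"
      unfolding step_kernel_def using A B X by (intro emeasure_distr Pair_measurable_P[OF w]) auto
    also have "(\<lambda>y. (\<omega>, y)) -` X \<inter> space (P (\<Phi> n \<omega>)) = (if \<omega> \<in> B then A else {})"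
      using sets.sets_into_space[OF A] by (auto simp: X space_prob_kernel[OF kernel chain_space[OF w]])
    finally show "indicator B \<omega> * emeasure (P (\<Phi> n \<omega>)) A = emeasure (step_kernel n \<omega>) X" by simp
  qed
  also have "\<dots> = emeasure (\<Omega> \<bind> step_kernel n) X"
    using A B X by (intro emeasure_bind[OF \<Omega>.not_empty step_kernel_measurable, symmetric]) auto
  finally show "emeasure ?D X = emeasure (\<Omega> \<bind> step_kernel n) X" .
qed

lemma markov_nn_integral:
  assumes h: "h \<in> borel_measurable (F n \<Otimes>\<^sub>M M)"
  shows "(\<integral>\<^sup>+\<omega>. h (\<omega>, \<Phi> (Suc n) \<omega>) \<partial>\<Omega>) = (\<integral>\<^sup>+\<omega>. \<integral>\<^sup>+y. h (\<omega>, y) \<partial>P (\<Phi> n \<omega>) \<partial>\<Omega>)"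
proof -
  have m: "(\<lambda>\<omega>. (\<omega>, \<Phi> (Suc n) \<omega>)) \<in> \<Omega> \<rightarrow>\<^sub>M F n \<Otimes>\<^sub>M M"
    by (intro measurable_Pair id_measurable_F chain_measurable)
  have "(\<integral>\<^sup>+\<omega>. h (\<omega>, \<Phi> (Suc n) \<omega>) \<partial>\<Omega>) = (\<integral>\<^sup>+p. h p \<partial>(\<Omega> \<bind> step_kernel n))"
    unfolding markov_distr[symmetric] by (subst nn_integral_distr[OF m]) (use h in auto)
  also have "\<dots> = (\<integral>\<^sup>+\<omega>. \<integral>\<^sup>+p. h p \<partial>step_kernel n \<omega> \<partial>\<Omega>)"
    by (rule nn_integral_bind[OF h step_kernel_measurable])
  also have "\<dots> = (\<integral>\<^sup>+\<omega>. \<integral>\<^sup>+y. h (\<omega>, y) \<partial>P (\<Phi> n \<omega>) \<partial>\<Omega>)"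
    unfolding step_kernel_def 
    by (intro nn_integral_cong nn_integral_distr[OF Pair_measurable_P]) (use h in auto)
  finally show ?thesis .
qed

lemma markov_integral_real:
  fixes h :: "'w \<times> 'x \<Rightarrow> real"
  assumes h: "h \<in> borel_measurable (F n \<Otimes>\<^sub>M M)" and i: "integrable \<Omega> (\<lambda>\<omega>. h (\<omega>, \<Phi> (Suc n) \<omega>))"
  shows "integrable \<Omega> (\<lambda>\<omega>. \<integral>y. h (\<omega>, y) \<partial>P (\<Phi> n \<omega>))"
    "(\<integral>\<omega>. h (\<omega>, \<Phi> (Suc n) \<omega>) \<partial>\<Omega>) = (\<integral>\<omega>. \<integral>y. h (\<omega>, y) \<partial>P (\<Phi> n \<omega>) \<partial>\<Omega>)"
proof -
  have m: "(\<lambda>\<omega>. (\<omega>, \<Phi> (Suc n) \<omega>)) \<in> \<Omega> \<rightarrow>\<^sub>M F n \<Otimes>\<^sub>M M"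
    by (intro measurable_Pair id_measurable_F chain_measurable)
  have ha: "(\<lambda>p. ennreal \<bar>h p\<bar>) \<in> borel_measurable (F n \<Otimes>\<^sub>M M)" using h by measurable
  have "(\<integral>\<^sup>+\<omega>. \<integral>\<^sup>+p. ennreal \<bar>h p\<bar> \<partial>step_kernel n \<omega> \<partial>\<Omega>) = (\<integral>\<^sup>+p. ennreal \<bar>h p\<bar> \<partial>(\<Omega> \<bind> step_kernel n))"
    by (rule nn_integral_bind[OF ha step_kernel_measurable, symmetric])
  also have "\<dots> = (\<integral>\<^sup>+\<omega>. ennreal \<bar>h (\<omega>, \<Phi> (Suc n) \<omega>)\<bar> \<partial>\<Omega>)"
    unfolding markov_distr[symmetric] by (subst nn_integral_distr[OF m]) (use ha in auto)
  also have "\<dots> < \<infinity>" using i by (simp add: integrable_iff_bounded)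
  finally have fin: "(\<integral>\<^sup>+\<omega>. \<integral>\<^sup>+p. ennreal \<bar>h p\<bar> \<partial>step_kernel n \<omega> \<partial>\<Omega>) < \<infinity>" .
  have k: "(\<integral>p. h p \<partial>step_kernel n \<omega>) = (\<integral>y. h (\<omega>, y) \<partial>P (\<Phi> n \<omega>))" if "\<omega> \<in> space \<Omega>" for \<omega>
    unfolding step_kernel_def by (rule integral_distr[OF Pair_measurable_P[OF that] h])
  note b = integral_bind_real(2,3)[OF step_kernel_measurable h \<Omega>.not_empty fin]
  show "integrable \<Omega> (\<lambda>\<omega>. \<integral>y. h (\<omega>, y) \<partial>P (\<Phi> n \<omega>))"
    using b(1) k by (simp cong: Bochner_Integration.integrable_cong)
  have "(\<integral>\<omega>. h (\<omega>, \<Phi> (Suc n) \<omega>) \<partial>\<Omega>) = (\<integral>p. h p \<partial>(\<Omega> \<bind> step_kernel n))"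
    unfolding markov_distr[symmetric] by (rule integral_distr[OF m h, symmetric])
  also have "\<dots> = (\<integral>\<omega>. \<integral>y. h (\<omega>, y) \<partial>P (\<Phi> n \<omega>) \<partial>\<Omega>)"
    unfolding b(2) by (rule Bochner_Integration.integral_cong[OF refl k])
  finally show "(\<integral>\<omega>. h (\<omega>, \<Phi> (Suc n) \<omega>) \<partial>\<Omega>) = (\<integral>\<omega>. \<integral>y. h (\<omega>, y) \<partial>P (\<Phi> n \<omega>) \<partial>\<Omega>)" .
qed

text \<open>
  The hypothesis on the sections guarantees that the complex inner integral is assembled from its real and
  imaginary parts at every \<open>\<omega>\<close>; a Bochner integral that does not exist would be zero as a whole.
\<close>

lemma markov_integral:
  fixes h :: "'w \<times> 'x \<Rightarrow> complex"
  assumes h: "h \<in> borel_measurable (F n \<Otimes>\<^sub>M M)" and i: "integrable \<Omega> (\<lambda>\<omega>. h (\<omega>, \<Phi> (Suc n) \<omega>))"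
    and iy: "\<And>\<omega>. \<omega> \<in> space \<Omega> \<Longrightarrow> integrable (P (\<Phi> n \<omega>)) (\<lambda>y. h (\<omega>, y))"
  shows "integrable \<Omega> (\<lambda>\<omega>. \<integral>y. h (\<omega>, y) \<partial>P (\<Phi> n \<omega>))"
    "(\<integral>\<omega>. h (\<omega>, \<Phi> (Suc n) \<omega>) \<partial>\<Omega>) = (\<integral>\<omega>. \<integral>y. h (\<omega>, y) \<partial>P (\<Phi> n \<omega>) \<partial>\<Omega>)"
proof -
  have m: "(\<lambda>p. Re (h p)) \<in> borel_measurable (F n \<Otimes>\<^sub>M M)" "(\<lambda>p. Im (h p)) \<in> borel_measurable (F n \<Otimes>\<^sub>M M)"
    using h by measurable
  have ii: "integrable \<Omega> (\<lambda>\<omega>. Re (h (\<omega>, \<Phi> (Suc n) \<omega>)))" "integrable \<Omega> (\<lambda>\<omega>. Im (h (\<omega>, \<Phi> (Suc n) \<omega>)))"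
    using i by (auto intro: integrable_Re integrable_Im)
  note R = markov_integral_real[OF m(1) ii(1)] and I = markov_integral_real[OF m(2) ii(2)]
  have e: "(\<integral>y. h (\<omega>, y) \<partial>P (\<Phi> n \<omega>)) = Complex (\<integral>y. Re (h (\<omega>, y)) \<partial>P (\<Phi> n \<omega>)) (\<integral>y. Im (h (\<omega>, y)) \<partial>P (\<Phi> n \<omega>))"
    if "\<omega> \<in> space \<Omega>" for \<omega>
    using iy[OF that] by (simp add: complex_eq_iff)
  have J: "integrable \<Omega> (\<lambda>\<omega>. Complex (\<integral>y. Re (h (\<omega>, y)) \<partial>P (\<Phi> n \<omega>)) (\<integral>y. Im (h (\<omega>, y)) \<partial>P (\<Phi> n \<omega>)))"
    unfolding Complex_eq by (intro Bochner_Integration.integrable_add integrable_mult_right integrable_of_real R(1) I(1))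
  show "integrable \<Omega> (\<lambda>\<omega>. \<integral>y. h (\<omega>, y) \<partial>P (\<Phi> n \<omega>))"
    using J e by (simp cong: Bochner_Integration.integrable_cong)
  have "(\<integral>\<omega>. \<integral>y. h (\<omega>, y) \<partial>P (\<Phi> n \<omega>) \<partial>\<Omega>)
      = (\<integral>\<omega>. Complex (\<integral>y. Re (h (\<omega>, y)) \<partial>P (\<Phi> n \<omega>)) (\<integral>y. Im (h (\<omega>, y)) \<partial>P (\<Phi> n \<omega>)) \<partial>\<Omega>)"
    by (rule Bochner_Integration.integral_cong[OF refl e])
  then show "(\<integral>\<omega>. h (\<omega>, \<Phi> (Suc n) \<omega>) \<partial>\<Omega>) = (\<integral>\<omega>. \<integral>y. h (\<omega>, y) \<partial>P (\<Phi> n \<omega>) \<partial>\<Omega>)"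
    using R(2) I(2) J i by (simp add: complex_eq_iff integral_Re[symmetric] integral_Im[symmetric] del: integral_Re integral_Im)
qed

end

section \<open>A central limit theorem for Markov chains\<close>

text \<open>
  A perturbed linear recursion whose perturbation has a telescoping part. Subtracting \<open>a B\<^sub>n\<close> from \<open>A\<^sub>n\<close> absorbs
  the telescoping terms up to \<open>a (1 - q) \<beta>\<close> in each step, and these increments sum up to at most \<open>a \<beta>\<close>
  because the recursion contracts by the factor \<open>q\<close>.
\<close>

lemma approximate_recursion:
  fixes A B :: "nat \<Rightarrow> complex" and q a \<beta> :: real
  assumes q: "0 \<le> q" "q \<le> 1" and a: "0 \<le> a" and B: "\<And>k. norm (B k) \<le> \<beta>"
    and step: "\<And>k. norm (A (Suc k) - q * A k + a * (B k - B (Suc k))) \<le> d k"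
  shows "norm (A n - q ^ n * A 0) \<le> (\<Sum>k<n. d k) + 2 * a * \<beta>"
proof -
  have b: "norm (a * B k) \<le> a * \<beta>" for k using a B[of k] by (simp add: norm_mult mult_left_mono)
  have d: "0 \<le> d k" for k using step[of k] norm_ge_zero order_trans by blast
  have "norm (A n - q ^ n * A 0 - a * B n) \<le> (\<Sum>k<n. d k) + a * \<beta>"
  proof (induction n)
    case 0 then show ?case using b[of 0] by simp
  next
    case (Suc n)
    let ?X = "A n - q ^ n * A 0 - a * B n"
    have "A (Suc n) - q ^ Suc n * A 0 - a * B (Suc n)
        = (A (Suc n) - q * A n + a * (B n - B (Suc n))) + (q * ?X - (1 - q) * (a * B n))"
      by (simp add: algebra_simps)
    also have "norm \<dots> \<le> d n + (q * ((\<Sum>k<n. d k) + a * \<beta>) + (1 - q) * (a * \<beta>))"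
    proof (rule norm_triangle_mono[OF step], rule order_trans[OF norm_triangle_ineq4], rule add_mono)
      show "norm (q * ?X) \<le> q * ((\<Sum>k<n. d k) + a * \<beta>)"
        using Suc q by (simp add: norm_mult mult_left_mono)
      have "norm ((1 - q) * (a * B n)) = (1 - q) * norm (a * B n)"
        using q norm_of_real[where ?'a=complex, of "1 - q"] by (simp add: norm_mult)
      then show "norm ((1 - q) * (a * B n)) \<le> (1 - q) * (a * \<beta>)"
        using q b[of n] by (simp add: mult_left_mono)
    qed
    also have "\<dots> \<le> d n + (1 * (\<Sum>k<n. d k) + a * \<beta>)"
    proof -
      have "q * (\<Sum>k<n. d k) \<le> 1 * (\<Sum>k<n. d k)" using q d by (intro mult_right_mono sum_nonneg) auto
      then show ?thesis by (simp add: algebra_simps)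
    qed
    finally show ?case by (simp add: algebra_simps)
  qed
  then have "norm (A n - q ^ n * A 0 - a * B n + a * B n) \<le> (\<Sum>k<n. d k) + a * \<beta> + a * \<beta>"
    using b[of n] by (intro norm_triangle_mono)
  then show ?thesis by (simp add: algebra_simps)
qed

lemma iexp_minus_1_le: "norm (iexp t - 1) \<le> min 2 \<bar>t\<bar>"
  using iexp_approx1[of t 0] iexp_approx2[of t 0] by simp

lemma iexp_taylor2_le: "norm (iexp t - (1 + \<i> * t - t\<^sup>2 / 2)) \<le> t\<^sup>2 * min 1 \<bar>t\<bar>"
proof -
  have s: "(\<Sum>k\<le>2. (\<i> * complex_of_real t) ^ k / fact k) = 1 + \<i> * t - t\<^sup>2 / 2"
    by (simp add: numeral_2_eq_2 power2_eq_square algebra_simps)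
  have "norm (iexp t - (1 + \<i> * t - t\<^sup>2 / 2)) \<le> t\<^sup>2"
    using iexp_approx2[of t 2] unfolding s by simp
  moreover have "norm (iexp t - (1 + \<i> * t - t\<^sup>2 / 2)) \<le> t\<^sup>2 * \<bar>t\<bar>"
  proof -
    have "norm (iexp t - (1 + \<i> * t - t\<^sup>2 / 2)) \<le> \<bar>t\<bar> ^ 3 / 6"
      using iexp_approx1[of t 2] unfolding s by (simp add: numeral_3_eq_3 fact_reduce)
    also have "\<dots> \<le> \<bar>t\<bar> ^ 3" by simp
    also have "\<dots> = t\<^sup>2 * \<bar>t\<bar>" by (simp add: power3_eq_cube power2_eq_square abs_mult_self_eq)
    finally show ?thesis .
  qed
  ultimately show ?thesis by (simp add: min_def)
qed

lemma exp_minus_taylor1: "0 \<le> x \<Longrightarrow> \<bar>1 - x - exp (- x)\<bar> \<le> x\<^sup>2" for x :: real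
proof -
  assume x: "0 \<le> x"
  have "1 - x \<le> exp (- x)" using exp_ge_add_one_self[of "-x"] by simp
  moreover have "exp (- x) \<le> 1 - x + x\<^sup>2"
  proof -
    have "1 + x \<le> exp x" by (rule exp_ge_add_one_self)
    then have "exp (- x) \<le> 1 / (1 + x)" using x by (simp add: exp_minus divide_simps)
    also have "\<dots> \<le> 1 - x + x\<^sup>2"
    proof -
      have "1 \<le> 1 + x ^ 3" using x by simp
      also have "\<dots> = (1 - x + x\<^sup>2) * (1 + x)" by (simp add: power2_eq_square power3_eq_cube algebra_simps)
      finally have "1 \<le> (1 - x + x\<^sup>2) * (1 + x)" .
      moreover have "0 < 1 + x" using x by simp
      ultimately show ?thesis by (simp only: pos_divide_le_eq)
    qed
    finally show ?thesis .
  qed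
  ultimately show ?thesis by simp
qed

lemma iexp_diff_le: "norm (iexp s - iexp t) \<le> min 2 \<bar>s - t\<bar>"
proof -
  have "iexp s - iexp t = iexp t * (iexp (s - t) - 1)"
    by (simp add: algebra_simps exp_add[symmetric])
  then have "norm (iexp s - iexp t) = norm (iexp (s - t) - 1)" by (simp only: norm_mult norm_exp_i_times mult_1)
  then show ?thesis using iexp_minus_1_le[of "s - t"] by (simp only:)
qed

text \<open>
  What the central limit theorem needs from the chain: drift, an invariant law that integrates \<open>V\<close>, and
  solvability of Poisson's equation in the weighted space.
\<close>

locale ergodic_chain = weighted_space M V + kernel_chain M P \<mu> \<Omega> \<Phi>
  for M :: "'x measure" and V :: "'x \<Rightarrow> real" and P :: "'x \<Rightarrow> 'x measure" and \<mu> :: "'x measure"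
    and \<Omega> :: "'w measure" and \<Phi> :: "nat \<Rightarrow> 'w \<Rightarrow> 'x" +
  fixes \<pi> :: "'x measure" and lam b :: real
  assumes lam: "0 < lam" "lam < 1" and b: "0 \<le> b"
    and drift: "\<And>x. x \<in> space M \<Longrightarrow> (\<integral>\<^sup>+y. ennreal (V y) \<partial>P x) \<le> ennreal (lam * V x + b)"
    and pi_prob: "\<pi> \<in> space (prob_algebra M)"
    and pi_integrable: "\<And>c g. vbounded c g \<Longrightarrow> integrable \<pi> g"
    and poisson: "\<And>c g. vbounded c g \<Longrightarrow>
      \<exists>C u. vbounded C u \<and> (\<forall>x\<in>space M. u x - kernel_op P u x = g x - (\<integral>y. g y \<partial>\<pi>))"
begin

lemma bounded_kernel_P: "bounded_kernel P (lam + b)"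
  unfolding bounded_kernel_def
proof (intro conjI ballI kernel)
  show "0 \<le> lam + b" using lam b by simp
  fix x assume x: "x \<in> space M"
  have "b * 1 \<le> b * V x" using V_ge_1[OF x] b by (intro mult_left_mono) auto
  then show "(\<integral>\<^sup>+y. ennreal (V y) \<partial>P x) \<le> ennreal ((lam + b) * V x)"
    by (intro order_trans[OF drift[OF x]] ennreal_leI) (simp add: distrib_right)
qed

text \<open>
  The indicator of the event \<open>V (\<Phi> 0) \<le> r\<close>. On this event the chain has moments, whatever its initial law.
\<close>

definition start :: "real \<Rightarrow> 'w \<Rightarrow> real" where
  "start r \<omega> = (if V (\<Phi> 0 \<omega>) \<le> r then 1 else 0)"

lemma start_bounds: "0 \<le> start r \<omega>" "start r \<omega> \<le> 1" "\<bar>start r \<omega>\<bar> = start r \<omega>"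
  by (auto simp: start_def)

lemma start_measurable_F: "start r \<in> borel_measurable (F n)"
proof -
  have "(\<lambda>x. if V x \<le> r then 1 else 0 :: real) \<in> borel_measurable M" by measurable
  from measurable_compose[OF measurable_F_chain[of 0 n] this] show ?thesis by (simp add: start_def[abs_def])
qed

lemma start_measurable [measurable]: "start r \<in> borel_measurable \<Omega>"
  by (rule measurable_from_subalg[OF subalgebra_F start_measurable_F])

lemma start_tendsto: "(\<lambda>m. \<integral>\<omega>. start (real m) \<omega> \<partial>\<Omega>) \<longlonglongrightarrow> 1"
proof -
  have "(\<lambda>m. \<integral>\<omega>. start (real m) \<omega> \<partial>\<Omega>) \<longlonglongrightarrow> (\<integral>\<omega>. 1 \<partial>\<Omega>)"
  proof (rule integral_dominated_convergence[where w="\<lambda>_. 1"])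
    show "AE \<omega> in \<Omega>. (\<lambda>m. start (real m) \<omega>) \<longlonglongrightarrow> 1"
    proof (rule AE_I2)
      fix \<omega>
      have A: "start (real m) \<omega> = 1" if "nat \<lceil>V (\<Phi> 0 \<omega>)\<rceil> \<le> m" for m
        using that unfolding start_def by simp
      show "(\<lambda>m. start (real m) \<omega>) \<longlonglongrightarrow> 1"
        by (rule tendsto_eventually[OF eventually_sequentiallyI[OF A]])
    qed
  qed (auto simp: start_bounds)
  then show ?thesis by (simp add: \<Omega>.prob_space)
qed

text \<open>
  The bound \<open>r + b / (1 - \<lambda>)\<close> is preserved by \<open>t \<mapsto> \<lambda> t + b\<close>, up to a decrease of the first summand.
\<close>

lemma moment_nn:
  assumes r: "0 \<le> r"
  shows "(\<integral>\<^sup>+\<omega>. ennreal (start r \<omega> * V (\<Phi> n \<omega>)) \<partial>\<Omega>) \<le> ennreal (r + b / (1 - lam))"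
proof (induction n)
  case 0
  have B: "0 \<le> b / (1 - lam)" using b lam by simp
  have "(\<integral>\<^sup>+\<omega>. ennreal (start r \<omega> * V (\<Phi> 0 \<omega>)) \<partial>\<Omega>) \<le> (\<integral>\<^sup>+\<omega>. ennreal (r + b / (1 - lam)) \<partial>\<Omega>)"
    using r B by (intro nn_integral_mono ennreal_leI) (auto simp: start_def)
  then show ?case by (simp add: \<Omega>.emeasure_space_1)
next
  case (Suc n)
  have B: "0 \<le> b / (1 - lam)" "lam * (b / (1 - lam)) + b = b / (1 - lam)"
    using b lam by (auto simp: field_simps)
  have [measurable]: "start r \<in> borel_measurable (F n)" by (rule start_measurable_F)
  have "(\<lambda>p. ennreal (start r (fst p) * V (snd p))) \<in> borel_measurable (F n \<Otimes>\<^sub>M M)" by measurable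
  from markov_nn_integral[OF this]
  have "(\<integral>\<^sup>+\<omega>. ennreal (start r \<omega> * V (\<Phi> (Suc n) \<omega>)) \<partial>\<Omega>) = (\<integral>\<^sup>+\<omega>. \<integral>\<^sup>+y. ennreal (start r \<omega> * V y) \<partial>P (\<Phi> n \<omega>) \<partial>\<Omega>)"
    by simp
  also have "\<dots> \<le> (\<integral>\<^sup>+\<omega>. ennreal lam * ennreal (start r \<omega> * V (\<Phi> n \<omega>)) + ennreal b \<partial>\<Omega>)"
  proof (rule nn_integral_mono)
    fix \<omega> assume w: "\<omega> \<in> space \<Omega>"
    note x = chain_space[OF w, of n]
    have [measurable]: "V \<in> borel_measurable (P (\<Phi> n \<omega>))"
      by (simp add: measurable_cong_sets[OF sets_prob_kernel[OF kernel x] refl])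
    have "(\<integral>\<^sup>+y. ennreal (start r \<omega> * V y) \<partial>P (\<Phi> n \<omega>)) = ennreal (start r \<omega>) * (\<integral>\<^sup>+y. ennreal (V y) \<partial>P (\<Phi> n \<omega>))"
      using start_bounds by (simp add: ennreal_mult' nn_integral_cmult)
    also have "\<dots> \<le> ennreal (start r \<omega>) * ennreal (lam * V (\<Phi> n \<omega>) + b)"
      by (intro mult_left_mono drift x) simp
    also have "\<dots> = ennreal (lam * (start r \<omega> * V (\<Phi> n \<omega>)) + start r \<omega> * b)"
      using start_bounds by (simp add: ennreal_mult'[symmetric] algebra_simps)
    also have "\<dots> \<le> ennreal (lam * (start r \<omega> * V (\<Phi> n \<omega>)) + b)"
      using start_bounds[of r \<omega>] b by (intro ennreal_leI add_left_mono) (simp add: mult_left_le_one_le)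
    also have "\<dots> = ennreal lam * ennreal (start r \<omega> * V (\<Phi> n \<omega>)) + ennreal b"
      using start_bounds[of r \<omega>] b lam V_nonneg[OF x] by (simp add: ennreal_mult ennreal_plus)
    finally show "(\<integral>\<^sup>+y. ennreal (start r \<omega> * V y) \<partial>P (\<Phi> n \<omega>)) \<le> ennreal lam * ennreal (start r \<omega> * V (\<Phi> n \<omega>)) + ennreal b" .
  qed
  also have "\<dots> = ennreal lam * (\<integral>\<^sup>+\<omega>. ennreal (start r \<omega> * V (\<Phi> n \<omega>)) \<partial>\<Omega>) + ennreal b"
    by (simp add: nn_integral_add nn_integral_cmult \<Omega>.emeasure_space_1)
  also have "\<dots> \<le> ennreal lam * ennreal (r + b / (1 - lam)) + ennreal b"
    by (intro add_right_mono mult_left_mono Suc) simp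
  also have "\<dots> = ennreal (lam * r + b / (1 - lam))"
  proof -
    have "ennreal lam * ennreal (r + b / (1 - lam)) + ennreal b = ennreal (lam * (r + b / (1 - lam)) + b)"
      using lam b B r by (simp add: ennreal_mult'[symmetric] ennreal_plus[symmetric] del: ennreal_plus)
    also have "lam * (r + b / (1 - lam)) + b = lam * r + b / (1 - lam)" using B(2) by (simp add: distrib_left)
    finally show ?thesis .
  qed
  also have "\<dots> \<le> ennreal (r + b / (1 - lam))"
    using lam r by (intro ennreal_leI) (simp add: mult_left_le_one_le)
  finally show ?case .
qed

lemma moment:
  assumes r: "0 \<le> r" and g: "vbounded c g"
  shows "integrable \<Omega> (\<lambda>\<omega>. start r \<omega> * g (\<Phi> n \<omega>))"
    "(\<integral>\<omega>. start r \<omega> * \<bar>g (\<Phi> n \<omega>)\<bar> \<partial>\<Omega>) \<le> c * (r + b / (1 - lam))"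
    "\<bar>\<integral>\<omega>. start r \<omega> * g (\<Phi> n \<omega>) \<partial>\<Omega>\<bar> \<le> c * (r + b / (1 - lam))"
proof -
  note [measurable] = vbounded_measurable[OF g]
  have c: "0 \<le> c" by (rule vbounded_nonneg[OF g])
  have B: "0 \<le> b / (1 - lam)" using b lam by simp
  have VI: "integrable \<Omega> (\<lambda>\<omega>. start r \<omega> * V (\<Phi> n \<omega>))"
    using le_less_trans[OF moment_nn[OF r, of n] ennreal_less_top] V_nonneg chain_space start_bounds
    by (intro integrableI_nonneg) auto
  have VB: "(\<integral>\<omega>. start r \<omega> * V (\<Phi> n \<omega>) \<partial>\<Omega>) \<le> r + b / (1 - lam)"
  proof -
    have "(\<integral>\<^sup>+\<omega>. ennreal (start r \<omega> * V (\<Phi> n \<omega>)) \<partial>\<Omega>) = ennreal (\<integral>\<omega>. start r \<omega> * V (\<Phi> n \<omega>) \<partial>\<Omega>)"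
      using V_nonneg chain_space start_bounds by (intro nn_integral_eq_integral VI) auto
    then have "ennreal (\<integral>\<omega>. start r \<omega> * V (\<Phi> n \<omega>) \<partial>\<Omega>) \<le> ennreal (r + b / (1 - lam))"
      using moment_nn[OF r, of n] by (simp only:)
    then show ?thesis using r B by (subst (asm) ennreal_le_iff) auto
  qed
  have le: "\<bar>start r \<omega> * g (\<Phi> n \<omega>)\<bar> \<le> c * (start r \<omega> * V (\<Phi> n \<omega>))" if "\<omega> \<in> space \<Omega>" for \<omega>
    using vboundedD[OF g chain_space[OF that, of n]] by (auto simp: start_def)
  show I: "integrable \<Omega> (\<lambda>\<omega>. start r \<omega> * g (\<Phi> n \<omega>))"
  proof (rule Bochner_Integration.integrable_bound)
    show "integrable \<Omega> (\<lambda>\<omega>. c * (start r \<omega> * V (\<Phi> n \<omega>)))" using VI by simp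
    show "AE \<omega> in \<Omega>. norm (start r \<omega> * g (\<Phi> n \<omega>)) \<le> norm (c * (start r \<omega> * V (\<Phi> n \<omega>)))"
    proof (rule AE_I2)
      fix \<omega> assume "\<omega> \<in> space \<Omega>"
      from le[OF this] show "norm (start r \<omega> * g (\<Phi> n \<omega>)) \<le> norm (c * (start r \<omega> * V (\<Phi> n \<omega>)))"
        unfolding real_norm_def by linarith
    qed
  qed simp
  have "(\<integral>\<omega>. \<bar>start r \<omega> * g (\<Phi> n \<omega>)\<bar> \<partial>\<Omega>) \<le> (\<integral>\<omega>. c * (start r \<omega> * V (\<Phi> n \<omega>)) \<partial>\<Omega>)"
    using I VI le by (intro integral_mono) auto
  also have "\<dots> \<le> c * (r + b / (1 - lam))" using VB c by (simp add: mult_left_mono)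
  finally have a: "(\<integral>\<omega>. \<bar>start r \<omega> * g (\<Phi> n \<omega>)\<bar> \<partial>\<Omega>) \<le> c * (r + b / (1 - lam))" .
  then show "(\<integral>\<omega>. start r \<omega> * \<bar>g (\<Phi> n \<omega>)\<bar> \<partial>\<Omega>) \<le> c * (r + b / (1 - lam))"
    by (simp add: abs_mult start_bounds)
  show "\<bar>\<integral>\<omega>. start r \<omega> * g (\<Phi> n \<omega>) \<partial>\<Omega>\<bar> \<le> c * (r + b / (1 - lam))"
    using integral_abs_bound[of \<Omega> "\<lambda>\<omega>. start r \<omega> * g (\<Phi> n \<omega>)"] a by linarith
qed

lemma transition_integral:
  fixes u :: "'x \<Rightarrow> 'x \<Rightarrow> real"
  assumes r: "0 \<le> r" and u: "(\<lambda>(x, y). u x y) \<in> borel_measurable (M \<Otimes>\<^sub>M M)" and pos: "\<And>x y. x \<in> space M \<Longrightarrow> y \<in> space M \<Longrightarrow> 0 \<le> u x y"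
    and int: "\<And>x. x \<in> space M \<Longrightarrow> integrable (P x) (u x)" and U: "vbounded c (\<lambda>x. \<integral>y. u x y \<partial>P x)"
  shows "integrable \<Omega> (\<lambda>\<omega>. start r \<omega> * u (\<Phi> n \<omega>) (\<Phi> (Suc n) \<omega>))"
    "(\<integral>\<omega>. start r \<omega> * u (\<Phi> n \<omega>) (\<Phi> (Suc n) \<omega>) \<partial>\<Omega>) = (\<integral>\<omega>. start r \<omega> * (\<integral>y. u (\<Phi> n \<omega>) y \<partial>P (\<Phi> n \<omega>)) \<partial>\<Omega>)"
proof -
  have [measurable]: "start r \<in> borel_measurable (F n)" "\<Phi> n \<in> F n \<rightarrow>\<^sub>M M" by (auto intro: start_measurable_F measurable_F_chain)
  have um[measurable]: "case_prod u \<in> borel_measurable (M \<Otimes>\<^sub>M M)" using u by simp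
  have hm: "(\<lambda>p. start r (fst p) * u (\<Phi> n (fst p)) (snd p)) \<in> borel_measurable (F n \<Otimes>\<^sub>M M)" by measurable
  have "(\<lambda>p. ennreal (start r (fst p) * u (\<Phi> n (fst p)) (snd p))) \<in> borel_measurable (F n \<Otimes>\<^sub>M M)" using hm by measurable
  from markov_nn_integral[OF this]
  have "(\<integral>\<^sup>+\<omega>. ennreal (start r \<omega> * u (\<Phi> n \<omega>) (\<Phi> (Suc n) \<omega>)) \<partial>\<Omega>)
      = (\<integral>\<^sup>+\<omega>. \<integral>\<^sup>+y. ennreal (start r \<omega> * u (\<Phi> n \<omega>) y) \<partial>P (\<Phi> n \<omega>) \<partial>\<Omega>)" by simp
  also have "\<dots> = (\<integral>\<^sup>+\<omega>. ennreal (start r \<omega> * (\<integral>y. u (\<Phi> n \<omega>) y \<partial>P (\<Phi> n \<omega>))) \<partial>\<Omega>)"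
  proof (rule nn_integral_cong)
    fix \<omega> assume w: "\<omega> \<in> space \<Omega>"
    note x = chain_space[OF w, of n]
    have "(\<integral>\<^sup>+y. ennreal (start r \<omega> * u (\<Phi> n \<omega>) y) \<partial>P (\<Phi> n \<omega>)) = ennreal (\<integral>y. start r \<omega> * u (\<Phi> n \<omega>) y \<partial>P (\<Phi> n \<omega>))"
      using int[OF x] pos[OF x] start_bounds
      by (intro nn_integral_eq_integral) (auto simp: space_prob_kernel[OF kernel x])
    then show "(\<integral>\<^sup>+y. ennreal (start r \<omega> * u (\<Phi> n \<omega>) y) \<partial>P (\<Phi> n \<omega>)) = ennreal (start r \<omega> * (\<integral>y. u (\<Phi> n \<omega>) y \<partial>P (\<Phi> n \<omega>)))"
      by simp
  qed
  also have "\<dots> = ennreal (\<integral>\<omega>. start r \<omega> * (\<integral>y. u (\<Phi> n \<omega>) y \<partial>P (\<Phi> n \<omega>)) \<partial>\<Omega>)"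
  proof (intro nn_integral_eq_integral moment(1)[OF r U] AE_I2)
    fix \<omega> assume w: "\<omega> \<in> space \<Omega>"
    have "0 \<le> (\<integral>y. u (\<Phi> n \<omega>) y \<partial>P (\<Phi> n \<omega>))"
      using pos[OF chain_space[OF w]] by (intro integral_nonneg_AE) (auto simp: space_prob_kernel[OF kernel chain_space[OF w]])
    then show "0 \<le> start r \<omega> * (\<integral>y. u (\<Phi> n \<omega>) y \<partial>P (\<Phi> n \<omega>))" using start_bounds by simp
  qed
  finally have e: "(\<integral>\<^sup>+\<omega>. ennreal (start r \<omega> * u (\<Phi> n \<omega>) (\<Phi> (Suc n) \<omega>)) \<partial>\<Omega>)
      = ennreal (\<integral>\<omega>. start r \<omega> * (\<integral>y. u (\<Phi> n \<omega>) y \<partial>P (\<Phi> n \<omega>)) \<partial>\<Omega>)" .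
  have p: "0 \<le> start r \<omega> * u (\<Phi> n \<omega>) (\<Phi> (Suc n) \<omega>)" if "\<omega> \<in> space \<Omega>" for \<omega>
    using pos[OF chain_space[OF that] chain_space[OF that]] start_bounds by simp
  have m: "(\<lambda>\<omega>. start r \<omega> * u (\<Phi> n \<omega>) (\<Phi> (Suc n) \<omega>)) \<in> borel_measurable \<Omega>" by measurable
  show I: "integrable \<Omega> (\<lambda>\<omega>. start r \<omega> * u (\<Phi> n \<omega>) (\<Phi> (Suc n) \<omega>))"
    using p m e by (intro integrableI_nonneg) auto
  have i: "(\<integral>\<omega>. start r \<omega> * u (\<Phi> n \<omega>) (\<Phi> (Suc n) \<omega>) \<partial>\<Omega>) = enn2real (\<integral>\<^sup>+\<omega>. ennreal (start r \<omega> * u (\<Phi> n \<omega>) (\<Phi> (Suc n) \<omega>)) \<partial>\<Omega>)"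
    using p m by (intro integral_eq_nn_integral) auto
  have nn: "0 \<le> (\<integral>\<omega>. start r \<omega> * (\<integral>y. u (\<Phi> n \<omega>) y \<partial>P (\<Phi> n \<omega>)) \<partial>\<Omega>)"
    using pos start_bounds by (intro integral_nonneg_AE AE_I2 mult_nonneg_nonneg)
      (auto simp: space_prob_kernel[OF kernel chain_space] chain_space intro!: integral_nonneg_AE)
  show "(\<integral>\<omega>. start r \<omega> * u (\<Phi> n \<omega>) (\<Phi> (Suc n) \<omega>) \<partial>\<Omega>) = (\<integral>\<omega>. start r \<omega> * (\<integral>y. u (\<Phi> n \<omega>) y \<partial>P (\<Phi> n \<omega>)) \<partial>\<Omega>)"
    unfolding i e using nn by simp
qed

text \<open>
  If \<open>u - P u = g - \<pi> g\<close>, then the sum of the centred expectations telescopes to the difference of two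
  expectations of \<open>u\<close>, which stay bounded.
\<close>

lemma mean_ergodic:
  assumes r: "0 \<le> r" and g: "vbounded c g"
  shows "(\<lambda>n. (\<Sum>k<n. \<integral>\<omega>. start r \<omega> * g (\<Phi> k \<omega>) \<partial>\<Omega>) / real n) \<longlonglongrightarrow> (\<integral>\<omega>. start r \<omega> \<partial>\<Omega>) * (\<integral>x. g x \<partial>\<pi>)"
proof -
  obtain C u where u: "vbounded C u" and eq: "\<And>x. x \<in> space M \<Longrightarrow> u x - kernel_op P u x = g x - (\<integral>y. g y \<partial>\<pi>)"
    using poisson[OF g] by blast
  note [measurable] = vbounded_measurable[OF u]
  let ?a = "\<integral>y. g y \<partial>\<pi>" and ?J = "\<integral>\<omega>. start r \<omega> \<partial>\<Omega>" and ?B = "C * (r + b / (1 - lam))"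
  define \<beta> where "\<beta> = (\<lambda>k. \<integral>\<omega>. start r \<omega> * u (\<Phi> k \<omega>) \<partial>\<Omega>)"
  have SI: "integrable \<Omega> (start r)" by (rule \<Omega>.integrable_const_bound[where B=1]) (auto simp: start_bounds)
  have step: "(\<integral>\<omega>. start r \<omega> * g (\<Phi> k \<omega>) \<partial>\<Omega>) - ?J * ?a = \<beta> k - \<beta> (Suc k)" for k
  proof -
    have [measurable]: "start r \<in> borel_measurable (F k)" by (rule start_measurable_F)
    have hm: "(\<lambda>p. start r (fst p) * u (snd p)) \<in> borel_measurable (F k \<Otimes>\<^sub>M M)" by measurable
    have "\<beta> (Suc k) = (\<integral>\<omega>. \<integral>y. start r \<omega> * u y \<partial>P (\<Phi> k \<omega>) \<partial>\<Omega>)"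
      using markov_integral_real(2)[OF hm] moment(1)[OF r u] by (simp add: \<beta>_def)
    also have "\<dots> = (\<integral>\<omega>. start r \<omega> * kernel_op P u (\<Phi> k \<omega>) \<partial>\<Omega>)"
      by (simp add: kernel_op_def)
    finally have "\<beta> k - \<beta> (Suc k) = (\<integral>\<omega>. start r \<omega> * u (\<Phi> k \<omega>) - start r \<omega> * kernel_op P u (\<Phi> k \<omega>) \<partial>\<Omega>)"
      using moment(1)[OF r u, of k] moment(1)[OF r kernel_op_vbounded[OF bounded_kernel_P u], of k] by (simp add: \<beta>_def)
    also have "\<dots> = (\<integral>\<omega>. start r \<omega> * g (\<Phi> k \<omega>) - start r \<omega> * ?a \<partial>\<Omega>)"
      using eq[OF chain_space, of _ k]
      by (intro Bochner_Integration.integral_cong refl) (simp add: right_diff_distrib[symmetric])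
    also have "\<dots> = (\<integral>\<omega>. start r \<omega> * g (\<Phi> k \<omega>) \<partial>\<Omega>) - ?J * ?a"
      using moment(1)[OF r g, of k] SI by simp
    finally show ?thesis by simp
  qed
  have bnd: "\<bar>\<beta> k\<bar> \<le> ?B" for k unfolding \<beta>_def by (rule moment(3)[OF r u])
  have tele: "(\<Sum>k<n. \<beta> k - \<beta> (Suc k)) = \<beta> 0 - \<beta> n" for n by (rule sum_lessThan_telescope')
  have "\<bar>(\<Sum>k<n. \<integral>\<omega>. start r \<omega> * g (\<Phi> k \<omega>) \<partial>\<Omega>) / real n - ?J * ?a\<bar> \<le> 2 * ?B / real n" if "0 < n" for n
  proof -
    have "(\<Sum>k<n. \<integral>\<omega>. start r \<omega> * g (\<Phi> k \<omega>) \<partial>\<Omega>) - real n * (?J * ?a) = \<beta> 0 - \<beta> n"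
      using tele[of n] unfolding step[symmetric] by (simp add: sum_subtractf)
    then have "(\<Sum>k<n. \<integral>\<omega>. start r \<omega> * g (\<Phi> k \<omega>) \<partial>\<Omega>) / real n - ?J * ?a = (\<beta> 0 - \<beta> n) / real n"
      using that by (simp add: field_simps)
    then show ?thesis using bnd[of 0] bnd[of n] that by (simp add: divide_right_mono)
  qed
  then have A: "\<forall>\<^sub>F n in sequentially. norm ((\<Sum>k<n. \<integral>\<omega>. start r \<omega> * g (\<Phi> k \<omega>) \<partial>\<Omega>) / real n - ?J * ?a) \<le> 2 * ?B / real n"
    unfolding real_norm_def by (intro eventually_sequentiallyI[of 1]) simp
  have "(\<lambda>n. 2 * ?B / real n) \<longlonglongrightarrow> 0" by (rule lim_const_over_n)
  from Lim_null_comparison[OF A this] show ?thesis by (simp add: LIM_zero_iff)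
qed

text \<open>
  A Dini argument: for \<open>n \<ge> N\<close> the average of \<open>e n\<close> is at most that of \<open>e N\<close>, which converges to a multiple of
  \<open>\<pi> (e N)\<close>, and \<open>\<pi> (e N)\<close> is small for large \<open>N\<close>. In the central limit theorem this plays the role of
  Lindeberg's condition.
\<close>

lemma mean_ergodic_vanishing:
  assumes r: "0 \<le> r" and e: "\<And>n. vbounded c (e n)" and pos: "\<And>n x. x \<in> space M \<Longrightarrow> 0 \<le> e n x"
    and dec: "\<And>m n x. x \<in> space M \<Longrightarrow> m \<le> n \<Longrightarrow> e n x \<le> e m x" and lim: "\<And>x. x \<in> space M \<Longrightarrow> (\<lambda>n. e n x) \<longlonglongrightarrow> 0"
  shows "(\<lambda>n. (\<Sum>k<n. \<integral>\<omega>. start r \<omega> * e n (\<Phi> k \<omega>) \<partial>\<Omega>) / real n) \<longlonglongrightarrow> 0"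
proof (rule LIMSEQ_I)
  fix d :: real assume d: "0 < d"
  have sp: "sets \<pi> = sets M" using pi_prob by (simp add: space_prob_algebra)
  have fin: "(\<integral>\<^sup>+y. ennreal (V y) \<partial>\<pi>) < \<infinity>"
    using pi_integrable[OF vbounded_V] V_nonneg sets_eq_imp_space_eq[OF sp]
    by (subst nn_integral_eq_integral) auto
  have "(\<lambda>n. \<integral>y. e n y \<partial>\<pi>) \<longlonglongrightarrow> (\<integral>y. 0 \<partial>\<pi>)"
    by (rule vbounded_integral_limit[OF sp fin e lim]) simp_all
  then have pe: "(\<lambda>n. \<integral>y. e n y \<partial>\<pi>) \<longlonglongrightarrow> 0" by simp
  obtain N where N: "(\<integral>y. e N y \<partial>\<pi>) < d"
    using order_tendstoD(2)[OF pe d] by (auto simp: eventually_sequentially)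
  have J: "0 \<le> (\<integral>\<omega>. start r \<omega> \<partial>\<Omega>)" "(\<integral>\<omega>. start r \<omega> \<partial>\<Omega>) \<le> 1"
    using start_bounds by (auto intro!: integral_nonneg_AE \<Omega>.integral_le_const \<Omega>.integrable_const_bound[where B=1])
  have e0: "0 \<le> (\<integral>y. e N y \<partial>\<pi>)" using pos sets_eq_imp_space_eq[OF sp] by (intro integral_nonneg_AE) auto
  have "(\<integral>\<omega>. start r \<omega> \<partial>\<Omega>) * (\<integral>x. e N x \<partial>\<pi>) \<le> 1 * (\<integral>x. e N x \<partial>\<pi>)" using J e0 by (intro mult_right_mono)
  then have "\<forall>\<^sub>F n in sequentially. (\<Sum>k<n. \<integral>\<omega>. start r \<omega> * e N (\<Phi> k \<omega>) \<partial>\<Omega>) / real n < d"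
    using N by (intro order_tendstoD(2)[OF mean_ergodic[OF r e]]) simp
  then obtain n0 where n0: "\<And>n. n0 \<le> n \<Longrightarrow> (\<Sum>k<n. \<integral>\<omega>. start r \<omega> * e N (\<Phi> k \<omega>) \<partial>\<Omega>) / real n < d"
    by (auto simp: eventually_sequentially)
  show "\<exists>no. \<forall>n\<ge>no. norm ((\<Sum>k<n. \<integral>\<omega>. start r \<omega> * e n (\<Phi> k \<omega>) \<partial>\<Omega>) / real n - 0) < d"
  proof (intro exI[of _ "max n0 N"] allI impI)
    fix n assume n: "max n0 N \<le> n"
    have "(\<integral>\<omega>. start r \<omega> * e n (\<Phi> k \<omega>) \<partial>\<Omega>) \<le> (\<integral>\<omega>. start r \<omega> * e N (\<Phi> k \<omega>) \<partial>\<Omega>)" for k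
      using dec[OF chain_space] n start_bounds
      by (intro integral_mono moment(1)[OF r e] mult_left_mono) auto
    then have "(\<Sum>k<n. \<integral>\<omega>. start r \<omega> * e n (\<Phi> k \<omega>) \<partial>\<Omega>) / real n \<le> (\<Sum>k<n. \<integral>\<omega>. start r \<omega> * e N (\<Phi> k \<omega>) \<partial>\<Omega>) / real n"
      by (intro divide_right_mono sum_mono) auto
    also have "\<dots> < d" using n0 n by simp
    finally have "(\<Sum>k<n. \<integral>\<omega>. start r \<omega> * e n (\<Phi> k \<omega>) \<partial>\<Omega>) / real n < d" .
    moreover have "0 \<le> (\<integral>\<omega>. start r \<omega> * e n (\<Phi> k \<omega>) \<partial>\<Omega>)" for k
      using pos[OF chain_space] start_bounds by (intro integral_nonneg_AE) auto
    then have "0 \<le> (\<Sum>k<n. \<integral>\<omega>. start r \<omega> * e n (\<Phi> k \<omega>) \<partial>\<Omega>) / real n" by (simp add: sum_nonneg)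
    ultimately show "norm ((\<Sum>k<n. \<integral>\<omega>. start r \<omega> * e n (\<Phi> k \<omega>) \<partial>\<Omega>) / real n - 0) < d" by simp
  qed
qed


text \<open>
  Fix \<open>r\<close> and let \<open>c\<^sub>k\<close> be the indicator \<open>start r\<close> times \<open>exp (i S\<^sub>k / sqrt n)\<close>, with expectation \<open>A\<^sub>k\<close>. Given the
  past, the next factor has mean \<open>q - (v - \<sigma>\<^sup>2) / 2n\<close> up to a Taylor error, where \<open>q = exp (- \<sigma>\<^sup>2 / 2n)\<close>. If
  \<open>u - P u = v - \<sigma>\<^sup>2\<close> and \<open>B\<^sub>k\<close> is the expectation of \<open>c\<^sub>k u (\<Phi> k)\<close>, then the expectation of
  \<open>c\<^sub>k (v - \<sigma>\<^sup>2) (\<Phi> k)\<close> equals \<open>B\<^sub>k - B\<^sub>k\<^sub>+\<^sub>1\<close> up to an error that is caused by replacing \<open>c\<^sub>k\<close> by \<open>c\<^sub>k\<^sub>+\<^sub>1\<close>, which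
  is small because one increment divided by \<open>sqrt n\<close> is small. Now \<open>approximate_recursion\<close> compares \<open>A\<^sub>n\<close>
  with \<open>q\<^sup>n A\<^sub>0\<close>.
\<close>

theorem central_limit:
  fixes \<Psi> :: "'x \<Rightarrow> 'x \<Rightarrow> real"
  assumes \<Psi>_meas: "(\<lambda>(x, y). \<Psi> x y) \<in> borel_measurable (M \<Otimes>\<^sub>M M)"
    and sq: "\<And>x. x \<in> space M \<Longrightarrow> integrable (P x) (\<lambda>y. (\<Psi> x y)\<^sup>2)"
    and mean0: "\<And>x. x \<in> space M \<Longrightarrow> (\<integral>y. \<Psi> x y \<partial>P x) = 0"
    and v: "vbounded c (\<lambda>x. \<integral>y. (\<Psi> x y)\<^sup>2 \<partial>P x)"
  shows "(\<lambda>n. \<integral>\<omega>. iexp ((\<Sum>j<n. \<Psi> (\<Phi> j \<omega>) (\<Phi> (Suc j) \<omega>)) / sqrt (real n)) \<partial>\<Omega>)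
    \<longlonglongrightarrow> exp (- (\<integral>x. (\<integral>y. (\<Psi> x y)\<^sup>2 \<partial>P x) \<partial>\<pi>) / 2)"
proof -
  define vv where "vv = (\<lambda>x. \<integral>y. (\<Psi> x y)\<^sup>2 \<partial>P x)"
  have v: "vbounded c vv" using v by (simp add: vv_def)
  define s2 where "s2 = (\<integral>x. vv x \<partial>\<pi>)"
  have s2: "0 \<le> s2" unfolding s2_def vv_def by (intro integral_nonneg_AE) auto
  obtain C u where u: "vbounded C u" and poi: "\<And>x. x \<in> space M \<Longrightarrow> u x - kernel_op P u x = vv x - s2"
    using poisson[OF v] unfolding s2_def by blast
  have C: "0 \<le> C" by (rule vbounded_nonneg[OF u])
  have [measurable]: "case_prod \<Psi> \<in> borel_measurable (M \<Otimes>\<^sub>M M)" using \<Psi>_meas by simp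
  note [measurable] = vbounded_measurable[OF u] vbounded_measurable[OF v]
  have \<Psi>_P: "\<Psi> x \<in> borel_measurable (P x)" if "x \<in> space M" for x
    using measurable_compose[OF measurable_Pair1'[OF that] \<Psi>_meas]
    by (simp add: measurable_cong_sets[OF sets_prob_kernel[OF kernel that] refl])
  have V_P: "V \<in> borel_measurable (P x)" if "x \<in> space M" for x
    by (simp add: measurable_cong_sets[OF sets_prob_kernel[OF kernel that] refl])
  have P_prob: "prob_space (P x)" if "x \<in> space M" for x by (rule prob_space_prob_kernel[OF kernel that])
  have VI: "integrable (P x) V" if "x \<in> space M" for x by (rule bounded_kernel_integrable[OF bounded_kernel_P vbounded_V that])
  have \<Psi>I: "integrable (P x) (\<Psi> x)" if x: "x \<in> space M" for x
  proof (rule Bochner_Integration.integrable_bound[of _ "\<lambda>y. 1 + (\<Psi> x y)\<^sup>2"])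
    interpret Px: prob_space "P x" by (rule P_prob[OF x])
    show "integrable (P x) (\<lambda>y. 1 + (\<Psi> x y)\<^sup>2)" using sq[OF x] by simp
    show "AE y in P x. norm (\<Psi> x y) \<le> norm (1 + (\<Psi> x y)\<^sup>2)"
    proof (rule AE_I2)
      fix y
      have "2 * \<bar>\<Psi> x y\<bar> * 1 \<le> \<bar>\<Psi> x y\<bar>\<^sup>2 + 1\<^sup>2" by (rule sum_squares_bound)
      then show "norm (\<Psi> x y) \<le> norm (1 + (\<Psi> x y)\<^sup>2)" by simp
    qed
  qed (rule \<Psi>_P[OF x])
  \<comment> \<open>the first summand bounds the Taylor error, the second one the error of replacing \<open>c\<^sub>k\<close> by \<open>c\<^sub>k\<^sub>+\<^sub>1\<close>;
    the maximum with \<open>1\<close> makes the sequence decreasing also at \<open>n = 0\<close>, where \<open>1 / sqrt 0 = 0\<close>\<close>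
  define e where "e = (\<lambda>n x y. (\<Psi> x y)\<^sup>2 * min 1 (\<bar>\<Psi> x y\<bar> / sqrt (max 1 (real n)))
      + C * (V y * min 2 (\<bar>\<Psi> x y\<bar> / sqrt (max 1 (real n)))))"
  define E where "E = (\<lambda>n x. \<integral>y. e n x y \<partial>P x)"
  have e_meas: "(\<lambda>(x, y). e n x y) \<in> borel_measurable (M \<Otimes>\<^sub>M M)" for n
    unfolding e_def by measurable
  have e_P: "e n x \<in> borel_measurable (P x)" if "x \<in> space M" for n x
    using measurable_compose[OF measurable_Pair1'[OF that] e_meas[of n]]
    by (simp add: measurable_cong_sets[OF sets_prob_kernel[OF kernel that] refl])
  have e_pos: "0 \<le> e n x y" if "x \<in> space M" "y \<in> space M" for n x y
    unfolding e_def using C V_nonneg[OF that(2)] by (intro add_nonneg_nonneg mult_nonneg_nonneg) auto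
  have e_le: "e n x y \<le> (\<Psi> x y)\<^sup>2 + C * (2 * V y)" if "x \<in> space M" "y \<in> space M" for n x y
    unfolding e_def using C V_nonneg[OF that(2)]
    by (intro add_mono mult_left_le mult_left_mono) (auto simp: mult.commute intro!: mult_left_mono)
  have domI: "integrable (P x) (\<lambda>y. (\<Psi> x y)\<^sup>2 + C * (2 * V y))" if "x \<in> space M" for x
    using sq[OF that] VI[OF that] by simp
  have e_abs: "AE y in P x. norm (e n x y) \<le> (\<Psi> x y)\<^sup>2 + C * (2 * V y)" if x: "x \<in> space M" for n x
    using e_pos[OF x] e_le[OF x] by (intro AE_I2) (simp add: space_prob_kernel[OF kernel x])
  have eI: "integrable (P x) (e n x)" if x: "x \<in> space M" for n x
    using e_abs[OF x, of n]
    by (intro Bochner_Integration.integrable_bound[OF domI[OF x] e_P[OF x]]) (auto elim!: eventually_mono)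
  have E_nonneg: "0 \<le> E n x" if x: "x \<in> space M" for n x
    unfolding E_def using e_pos[OF x] by (intro integral_nonneg_AE AE_I2) (simp add: space_prob_kernel[OF kernel x])
  have E_v: "vbounded (c + C * 2 * (lam + b)) (E n)" for n
    unfolding vbounded_def
  proof (intro conjI ballI)
    show "E n \<in> borel_measurable M" unfolding E_def
      by (rule measurable_kernel_integral[OF e_meas measurable_prob_algebraD[OF kernel]])
    fix x assume x: "x \<in> space M"
    have "E n x \<le> (\<integral>y. (\<Psi> x y)\<^sup>2 + C * (2 * V y) \<partial>P x)"
      unfolding E_def using e_le[OF x] by (intro integral_mono eI domI x) (simp add: space_prob_kernel[OF kernel x])
    also have "\<dots> = vv x + C * (2 * kernel_op P V x)"
      using sq[OF x] VI[OF x] by (simp add: vv_def kernel_op_def)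
    also have "\<dots> \<le> c * V x + C * (2 * ((lam + b) * V x))"
      using vboundedD[OF v x] vboundedD[OF kernel_op_vbounded[OF bounded_kernel_P vbounded_V] x] C
      by (intro add_mono mult_left_mono) auto
    finally show "\<bar>E n x\<bar> \<le> (c + C * 2 * (lam + b)) * V x"
      using E_nonneg[OF x, of n] by (simp add: algebra_simps)
  qed
  have E_dec: "E n x \<le> E m x" if x: "x \<in> space M" and mn: "m \<le> n" for m n x
    unfolding E_def
  proof (intro integral_mono eI x)
    fix y assume "y \<in> space (P x)"
    then have y: "y \<in> space M" by (simp add: space_prob_kernel[OF kernel x])
    have "\<bar>\<Psi> x y\<bar> / sqrt (max 1 (real n)) \<le> \<bar>\<Psi> x y\<bar> / sqrt (max 1 (real m))"
      using mn by (intro divide_left_mono) auto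
    then show "e n x y \<le> e m x y"
      unfolding e_def using C V_nonneg[OF y]
      by (intro add_mono mult_left_mono min.mono order_refl) auto
  qed
  have E_lim: "(\<lambda>n. E n x) \<longlonglongrightarrow> 0" if x: "x \<in> space M" for x
  proof -
    have "(\<lambda>n. E n x) \<longlonglongrightarrow> (\<integral>y. 0 \<partial>P x)"
      unfolding E_def
    proof (rule integral_dominated_convergence[OF _ e_P[OF x] domI[OF x] _ e_abs[OF x]])
      show "AE y in P x. (\<lambda>n. e n x y) \<longlonglongrightarrow> 0"
      proof (rule AE_I2)
        fix y
        have "filterlim (\<lambda>n. sqrt (max 1 (real n))) at_top sequentially" by real_asymp
        then have z: "(\<lambda>n. \<bar>\<Psi> x y\<bar> / sqrt (max 1 (real n))) \<longlonglongrightarrow> 0"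
          by (intro tendsto_divide_0[OF tendsto_const] filterlim_at_top_imp_at_infinity)
        have "(\<lambda>n. e n x y) \<longlonglongrightarrow> (\<Psi> x y)\<^sup>2 * min 1 0 + C * (V y * min 2 0)"
          unfolding e_def by (intro tendsto_intros z)
        then show "(\<lambda>n. e n x y) \<longlonglongrightarrow> 0" by simp
      qed
    qed simp
    then show ?thesis by simp
  qed
  define S where "S = (\<lambda>k \<omega>. \<Sum>j<k. \<Psi> (\<Phi> j \<omega>) (\<Phi> (Suc j) \<omega>))"
  have S_F: "S k \<in> borel_measurable (F k)" for k
    unfolding S_def
  proof (intro borel_measurable_sum)
    fix j assume "j \<in> {..<k}"
    then have "(\<lambda>\<omega>. (\<Phi> j \<omega>, \<Phi> (Suc j) \<omega>)) \<in> F k \<rightarrow>\<^sub>M M \<Otimes>\<^sub>M M"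
      by (intro measurable_Pair measurable_F_chain) auto
    from measurable_compose[OF this \<Psi>_meas] show "(\<lambda>\<omega>. \<Psi> (\<Phi> j \<omega>) (\<Phi> (Suc j) \<omega>)) \<in> borel_measurable (F k)" by simp
  qed
  have S_m[measurable]: "S k \<in> borel_measurable \<Omega>" for k by (rule measurable_from_subalg[OF subalgebra_F S_F])
  have key: "norm ((\<integral>\<omega>. start r \<omega> * iexp (S n \<omega> / sqrt n) \<partial>\<Omega>) - exp (- s2 / 2) * (\<integral>\<omega>. start r \<omega> \<partial>\<Omega>))
      \<le> (\<Sum>k<n. \<integral>\<omega>. start r \<omega> * E n (\<Phi> k \<omega>) \<partial>\<Omega>) / n + (s2\<^sup>2 / 4 + C * (r + b / (1 - lam))) / n"
    if r: "0 \<le> r" and n: "1 \<le> n" for r :: real and n :: nat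
  proof -
    define sn where "sn = sqrt (real n)"
    have sn: "0 < sn" "sn\<^sup>2 = real n" "sqrt (max 1 (real n)) = sn" using n by (auto simp: sn_def max_def)
    define q where "q = exp (- (s2 / (2 * n)))"
    define cc where "cc = (\<lambda>k \<omega>. start r \<omega> * iexp (S k \<omega> / sn))"
    have cc_F: "cc k \<in> borel_measurable (F k)" for k
    proof -
      note [measurable] = S_F[of k] start_measurable_F[of r k]
      show ?thesis unfolding cc_def by measurable
    qed
    have cc_m[measurable]: "cc k \<in> borel_measurable \<Omega>" for k by (rule measurable_from_subalg[OF subalgebra_F cc_F])
    have cc_norm: "norm (cc k \<omega>) = start r \<omega>" for k \<omega> by (simp add: cc_def norm_mult start_bounds)
    have cc_Suc: "cc (Suc k) \<omega> = cc k \<omega> * iexp (\<Psi> (\<Phi> k \<omega>) (\<Phi> (Suc k) \<omega>) / sn)" for k \<omega>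
      by (simp add: cc_def S_def add_divide_distrib exp_add distrib_left)
    have ccI: "integrable \<Omega> (cc k)" for k
      by (rule \<Omega>.integrable_const_bound[where B=1]) (auto simp: cc_norm start_bounds)
    have cgI: "integrable \<Omega> (\<lambda>\<omega>. cc k \<omega> * complex_of_real (g (\<Phi> j \<omega>)))" if g: "vbounded a g" for k j g a
    proof (rule Bochner_Integration.integrable_bound[OF moment(1)[OF r g, of j]])
      note [measurable] = vbounded_measurable[OF g]
      show "(\<lambda>\<omega>. cc k \<omega> * complex_of_real (g (\<Phi> j \<omega>))) \<in> borel_measurable \<Omega>" by measurable
      show "AE \<omega> in \<Omega>. norm (cc k \<omega> * complex_of_real (g (\<Phi> j \<omega>))) \<le> norm (start r \<omega> * g (\<Phi> j \<omega>))"
        by (simp add: norm_mult cc_norm abs_mult start_bounds)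
    qed
    have cg_le: "norm (\<integral>\<omega>. cc k \<omega> * complex_of_real (g (\<Phi> j \<omega>)) \<partial>\<Omega>) \<le> (\<integral>\<omega>. start r \<omega> * \<bar>g (\<Phi> j \<omega>)\<bar> \<partial>\<Omega>)" for k j g
      using integral_norm_bound[of \<Omega> "\<lambda>\<omega>. cc k \<omega> * complex_of_real (g (\<Phi> j \<omega>))"] by (simp add: norm_mult cc_norm)
    define A where "A = (\<lambda>k. \<integral>\<omega>. cc k \<omega> \<partial>\<Omega>)"
    define B where "B = (\<lambda>k. \<integral>\<omega>. cc k \<omega> * complex_of_real (u (\<Phi> k \<omega>)) \<partial>\<Omega>)"
    define D where "D = (\<lambda>k. \<integral>\<omega>. cc k \<omega> * complex_of_real (u (\<Phi> (Suc k) \<omega>)) \<partial>\<Omega>)"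
    define ch where "ch = (\<lambda>x. \<integral>y. iexp (\<Psi> x y / sn) \<partial>P x)"
    have [measurable]: "\<Phi> k \<in> F k \<rightarrow>\<^sub>M M" for k by (rule measurable_F_chain) simp
    have A_Suc: "A (Suc k) = (\<integral>\<omega>. cc k \<omega> * ch (\<Phi> k \<omega>) \<partial>\<Omega>) \<and> integrable \<Omega> (\<lambda>\<omega>. cc k \<omega> * ch (\<Phi> k \<omega>))" for k
    proof -
      have [measurable]: "cc k \<in> borel_measurable (F k)" by (rule cc_F)
      have hm: "(\<lambda>p. cc k (fst p) * iexp (\<Psi> (\<Phi> k (fst p)) (snd p) / sn)) \<in> borel_measurable (F k \<Otimes>\<^sub>M M)" by measurable
      have iy: "integrable (P (\<Phi> k \<omega>)) (\<lambda>y. cc k \<omega> * iexp (\<Psi> (\<Phi> k \<omega>) y / sn))" if w: "\<omega> \<in> space \<Omega>" for \<omega>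
      proof -
        interpret Px: prob_space "P (\<Phi> k \<omega>)" by (rule P_prob[OF chain_space[OF w]])
        note [measurable] = \<Psi>_P[OF chain_space[OF w]]
        show ?thesis by (intro integrable_mult_right Px.integrable_const_bound[where B=1]) auto
      qed
      have i: "integrable \<Omega> (\<lambda>\<omega>. cc k \<omega> * iexp (\<Psi> (\<Phi> k \<omega>) (\<Phi> (Suc k) \<omega>) / sn))"
        using ccI[of "Suc k"] by (simp add: cc_Suc[abs_def])
      from markov_integral[OF hm] i iy show ?thesis by (simp add: A_def cc_Suc[abs_def] ch_def)
    qed
    have D_eq: "D k = (\<integral>\<omega>. cc k \<omega> * complex_of_real (kernel_op P u (\<Phi> k \<omega>)) \<partial>\<Omega>)" for k
    proof -
      have [measurable]: "cc k \<in> borel_measurable (F k)" by (rule cc_F)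
      have hm: "(\<lambda>p. cc k (fst p) * complex_of_real (u (snd p))) \<in> borel_measurable (F k \<Otimes>\<^sub>M M)" by measurable
      have iy: "integrable (P (\<Phi> k \<omega>)) (\<lambda>y. cc k \<omega> * complex_of_real (u y))" if w: "\<omega> \<in> space \<Omega>" for \<omega>
        using bounded_kernel_integrable[OF bounded_kernel_P u chain_space[OF w]]
        by (intro integrable_mult_right integrable_of_real)
      from markov_integral(2)[OF hm] cgI[OF u] iy show ?thesis by (simp add: D_def kernel_op_def)
    qed
    \<comment> \<open>second-order expansion at zero; the first-order term vanishes as the increments are centred\<close>
    have taylor: "norm (ch x - q + (vv x - s2) / (2 * n)) \<le> (\<integral>y. (\<Psi> x y)\<^sup>2 * min 1 (\<bar>\<Psi> x y\<bar> / sn) \<partial>P x) / n + (s2 / (2 * n))\<^sup>2"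
      if x: "x \<in> space M" for x
    proof -
      interpret Px: prob_space "P x" by (rule P_prob[OF x])
      note [measurable] = \<Psi>_P[OF x]
      let ?t = "\<lambda>y. \<Psi> x y / sn"
      have tI: "integrable (P x) ?t" "integrable (P x) (\<lambda>y. (?t y)\<^sup>2)"
        using \<Psi>I[OF x] sq[OF x] by (auto simp: power_divide)
      have cI: "integrable (P x) (\<lambda>y. iexp (?t y))" by (rule Px.integrable_const_bound[where B=1]) auto
      have pe: "1 + \<i> * ?t y - (?t y)\<^sup>2 / 2 = complex_of_real (1 - (?t y)\<^sup>2 / 2) + \<i> * complex_of_real (?t y)" for y
        by simp
      have rI: "integrable (P x) (\<lambda>y. 1 - (?t y)\<^sup>2 / 2)"
        using tI(2) by (intro Bochner_Integration.integrable_diff integrable_divide) auto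
      note cI1 = integrable_of_real[OF rI, where ?'a=complex]
        and cI2 = integrable_mult_right[OF integrable_of_real[OF tI(1), where ?'a=complex], of \<i>]
      have pI: "integrable (P x) (\<lambda>y. 1 + \<i> * ?t y - (?t y)\<^sup>2 / 2)"
        unfolding pe by (rule Bochner_Integration.integrable_add[OF cI1 cI2])
      have p: "(\<integral>y. 1 + \<i> * ?t y - (?t y)\<^sup>2 / 2 \<partial>P x) = 1 - vv x / (2 * n)"
      proof -
        have "(\<integral>y. 1 + \<i> * ?t y - (?t y)\<^sup>2 / 2 \<partial>P x)
            = complex_of_real (\<integral>y. 1 - (?t y)\<^sup>2 / 2 \<partial>P x) + \<i> * complex_of_real (\<integral>y. ?t y \<partial>P x)"
          unfolding pe Bochner_Integration.integral_add[OF cI1 cI2] integral_mult_right_zero integral_complex_of_real ..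
        also have "(\<integral>y. ?t y \<partial>P x) = 0" using mean0[OF x] by simp
        also have "(\<integral>y. 1 - (?t y)\<^sup>2 / 2 \<partial>P x) = 1 - (\<integral>y. (?t y)\<^sup>2 \<partial>P x) / 2"
          using tI(2) by (subst Bochner_Integration.integral_diff) (auto simp: Px.prob_space)
        also have "(\<integral>y. (?t y)\<^sup>2 \<partial>P x) = vv x / n" by (simp add: vv_def power_divide sn(2))
        finally show ?thesis by simp
      qed
      have "norm (ch x - (1 - vv x / (2 * n))) = norm (\<integral>y. iexp (?t y) - (1 + \<i> * ?t y - (?t y)\<^sup>2 / 2) \<partial>P x)"
        unfolding ch_def p[symmetric] using cI pI by (subst Bochner_Integration.integral_diff) auto
      also have "\<dots> \<le> (\<integral>y. norm (iexp (?t y) - (1 + \<i> * ?t y - (?t y)\<^sup>2 / 2)) \<partial>P x)" by (rule integral_norm_bound)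
      also have "\<dots> \<le> (\<integral>y. (?t y)\<^sup>2 * min 1 \<bar>?t y\<bar> \<partial>P x)"
      proof (intro integral_mono integrable_norm[OF Bochner_Integration.integrable_diff[OF cI pI]] iexp_taylor2_le)
        show "integrable (P x) (\<lambda>y. (?t y)\<^sup>2 * min 1 \<bar>?t y\<bar>)"
        proof (rule Bochner_Integration.integrable_bound[OF tI(2)])
          show "AE y in P x. norm ((?t y)\<^sup>2 * min 1 \<bar>?t y\<bar>) \<le> norm ((?t y)\<^sup>2)"
            by (intro AE_I2) (simp add: abs_mult mult_left_le)
        qed measurable
      qed
      also have "\<dots> = (\<integral>y. ((\<Psi> x y)\<^sup>2 * min 1 (\<bar>\<Psi> x y\<bar> / sn)) / n \<partial>P x)"
        using sn by (intro Bochner_Integration.integral_cong refl) (simp add: power_divide)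
      also have "\<dots> = (\<integral>y. (\<Psi> x y)\<^sup>2 * min 1 (\<bar>\<Psi> x y\<bar> / sn) \<partial>P x) / n" by simp
      finally have 1: "norm (ch x - (1 - vv x / (2 * n))) \<le> (\<integral>y. (\<Psi> x y)\<^sup>2 * min 1 (\<bar>\<Psi> x y\<bar> / sn) \<partial>P x) / n" .
      have "\<bar>1 - s2 / (2 * n) - q\<bar> \<le> (s2 / (2 * n))\<^sup>2" unfolding q_def using s2 by (intro exp_minus_taylor1) simp
      then have 2: "norm (complex_of_real (1 - s2 / (2 * n) - q)) \<le> (s2 / (2 * n))\<^sup>2" by (simp only: norm_of_real)
      have 3: "ch x - q + (vv x - s2) / (2 * n) = (ch x - (1 - vv x / (2 * n))) + complex_of_real (1 - s2 / (2 * n) - q)"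
        by (simp add: diff_divide_distrib)
      show ?thesis unfolding 3 by (rule norm_triangle_mono[OF 1 2])
    qed
    have Ee: "(\<integral>y. (\<Psi> x y)\<^sup>2 * min 1 (\<bar>\<Psi> x y\<bar> / sn) \<partial>P x) + (\<integral>y. C * (V y * min 2 (\<bar>\<Psi> x y\<bar> / sn)) \<partial>P x) = E n x"
      and part1: "integrable (P x) (\<lambda>y. (\<Psi> x y)\<^sup>2 * min 1 (\<bar>\<Psi> x y\<bar> / sn))"
      and part2: "integrable (P x) (\<lambda>y. C * (V y * min 2 (\<bar>\<Psi> x y\<bar> / sn)))" if x: "x \<in> space M" for x
    proof -
      note [measurable] = \<Psi>_P[OF x] V_P[OF x]
      show p1: "integrable (P x) (\<lambda>y. (\<Psi> x y)\<^sup>2 * min 1 (\<bar>\<Psi> x y\<bar> / sn))"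
      proof (rule Bochner_Integration.integrable_bound[OF sq[OF x]])
        show "AE y in P x. norm ((\<Psi> x y)\<^sup>2 * min 1 (\<bar>\<Psi> x y\<bar> / sn)) \<le> norm ((\<Psi> x y)\<^sup>2)"
          using sn by (intro AE_I2) (simp add: abs_mult mult_left_le)
      qed measurable
      have "integrable (P x) (\<lambda>y. V y * min 2 (\<bar>\<Psi> x y\<bar> / sn))"
      proof (rule Bochner_Integration.integrable_bound)
        show "integrable (P x) (\<lambda>y. V y * 2)" using VI[OF x] by simp
        show "AE y in P x. norm (V y * min 2 (\<bar>\<Psi> x y\<bar> / sn)) \<le> norm (V y * 2)"
          using sn by (intro AE_I2) (simp add: abs_mult mult_left_mono)
      qed measurable
      then show p2: "integrable (P x) (\<lambda>y. C * (V y * min 2 (\<bar>\<Psi> x y\<bar> / sn)))" by simp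
      show "(\<integral>y. (\<Psi> x y)\<^sup>2 * min 1 (\<bar>\<Psi> x y\<bar> / sn) \<partial>P x) + (\<integral>y. C * (V y * min 2 (\<bar>\<Psi> x y\<bar> / sn)) \<partial>P x) = E n x"
        unfolding E_def e_def sn(3) by (rule Bochner_Integration.integral_add[OF p1 p2, symmetric])
    qed
    define E1 where "E1 = (\<lambda>x. \<integral>y. (\<Psi> x y)\<^sup>2 * min 1 (\<bar>\<Psi> x y\<bar> / sn) \<partial>P x)"
    define E2 where "E2 = (\<lambda>x. \<integral>y. C * (V y * min 2 (\<bar>\<Psi> x y\<bar> / sn)) \<partial>P x)"
    have E12: "0 \<le> E1 x" "0 \<le> E2 x" "E1 x + E2 x = E n x" if x: "x \<in> space M" for x
      using Ee[OF x] C V_nonneg sn unfolding E1_def E2_def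
      by (auto intro!: integral_nonneg_AE AE_I2 mult_nonneg_nonneg simp: space_prob_kernel[OF kernel x])
    have E1v: "vbounded (c + C * 2 * (lam + b)) E1" and E2v: "vbounded (c + C * 2 * (lam + b)) E2"
    proof -
      have "E1 \<in> borel_measurable M" "E2 \<in> borel_measurable M" unfolding E1_def E2_def
        by (rule measurable_kernel_integral[OF _ measurable_prob_algebraD[OF kernel]], measurable)+
      moreover have "\<bar>E1 x\<bar> \<le> (c + C * 2 * (lam + b)) * V x" "\<bar>E2 x\<bar> \<le> (c + C * 2 * (lam + b)) * V x" if x: "x \<in> space M" for x
        using E12[OF x] vboundedD[OF E_v[of n] x] by auto
      ultimately show "vbounded (c + C * 2 * (lam + b)) E1" "vbounded (c + C * 2 * (lam + b)) E2"
        by (auto simp: vbounded_def)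
    qed
    \<comment> \<open>\<open>D k\<close> is \<open>B (Suc k)\<close> with the weight \<open>c\<^sub>k\<close> in place of \<open>c\<^sub>k\<^sub>+\<^sub>1\<close>\<close>
    have D_B: "norm (D k - B (Suc k)) \<le> (\<integral>\<omega>. start r \<omega> * E2 (\<Phi> k \<omega>) \<partial>\<Omega>)" for k
    proof -
      have um: "(\<lambda>(x, y). C * (V y * min 2 (\<bar>\<Psi> x y\<bar> / sn))) \<in> borel_measurable (M \<Otimes>\<^sub>M M)" by measurable
      note tr = transition_integral[OF r um _ part2 E2v[unfolded E2_def], of k]
      have "D k - B (Suc k) = (\<integral>\<omega>. cc k \<omega> * complex_of_real (u (\<Phi> (Suc k) \<omega>)) - cc (Suc k) \<omega> * complex_of_real (u (\<Phi> (Suc k) \<omega>)) \<partial>\<Omega>)"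
        unfolding D_def B_def using cgI[OF u] by simp
      also have "norm \<dots> \<le> (\<integral>\<omega>. norm (cc k \<omega> * complex_of_real (u (\<Phi> (Suc k) \<omega>)) - cc (Suc k) \<omega> * complex_of_real (u (\<Phi> (Suc k) \<omega>))) \<partial>\<Omega>)"
        by (rule integral_norm_bound)
      also have "\<dots> \<le> (\<integral>\<omega>. start r \<omega> * (C * (V (\<Phi> (Suc k) \<omega>) * min 2 (\<bar>\<Psi> (\<Phi> k \<omega>) (\<Phi> (Suc k) \<omega>)\<bar> / sn))) \<partial>\<Omega>)"
      proof (intro integral_mono integrable_norm Bochner_Integration.integrable_diff cgI[OF u])
        show "integrable \<Omega> (\<lambda>\<omega>. start r \<omega> * (C * (V (\<Phi> (Suc k) \<omega>) * min 2 (\<bar>\<Psi> (\<Phi> k \<omega>) (\<Phi> (Suc k) \<omega>)\<bar> / sn))))"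
          using tr(1) C V_nonneg sn by simp
        fix \<omega> assume w: "\<omega> \<in> space \<Omega>"
        let ?t = "\<Psi> (\<Phi> k \<omega>) (\<Phi> (Suc k) \<omega>) / sn" and ?u = "u (\<Phi> (Suc k) \<omega>)"
        have "cc k \<omega> * complex_of_real ?u - cc (Suc k) \<omega> * complex_of_real ?u = - (cc k \<omega> * complex_of_real ?u * (iexp ?t - 1))"
          unfolding cc_Suc by (simp add: algebra_simps)
        then have "norm (cc k \<omega> * complex_of_real ?u - cc (Suc k) \<omega> * complex_of_real ?u) = start r \<omega> * (\<bar>?u\<bar> * norm (iexp ?t - 1))"
          by (simp only: norm_minus_cancel norm_mult cc_norm norm_of_real mult.assoc)
        also have "\<dots> \<le> start r \<omega> * ((C * V (\<Phi> (Suc k) \<omega>)) * min 2 \<bar>?t\<bar>)"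
          using vboundedD[OF u chain_space[OF w, of "Suc k"]] C V_nonneg[OF chain_space[OF w, of "Suc k"]] start_bounds
          by (intro mult_left_mono mult_mono iexp_minus_1_le) auto
        finally show "norm (cc k \<omega> * complex_of_real ?u - cc (Suc k) \<omega> * complex_of_real ?u)
          \<le> start r \<omega> * (C * (V (\<Phi> (Suc k) \<omega>) * min 2 (\<bar>\<Psi> (\<Phi> k \<omega>) (\<Phi> (Suc k) \<omega>)\<bar> / sn)))"
          using sn by (simp add: mult.assoc)
      qed
      also have "\<dots> = (\<integral>\<omega>. start r \<omega> * E2 (\<Phi> k \<omega>) \<partial>\<Omega>)"
        unfolding E2_def using tr(2) C V_nonneg sn by simp
      finally show ?thesis .
    qed
    have step: "norm (A (Suc k) - q * A k + (1 / (2 * real n)) * (B k - B (Suc k)))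
        \<le> (\<integral>\<omega>. start r \<omega> * E n (\<Phi> k \<omega>) \<partial>\<Omega>) / n + (s2 / (2 * n))\<^sup>2" for k
    proof -
      have BD: "B k - D k = (\<integral>\<omega>. cc k \<omega> * complex_of_real (vv (\<Phi> k \<omega>) - s2) \<partial>\<Omega>)"
        and vI: "integrable \<Omega> (\<lambda>\<omega>. cc k \<omega> * complex_of_real (vv (\<Phi> k \<omega>) - s2))"
      proof -
        have "B k - D k = (\<integral>\<omega>. cc k \<omega> * complex_of_real (u (\<Phi> k \<omega>)) - cc k \<omega> * complex_of_real (kernel_op P u (\<Phi> k \<omega>)) \<partial>\<Omega>)"
          unfolding D_eq B_def using cgI[OF u] cgI[OF kernel_op_vbounded[OF bounded_kernel_P u]] by simp
        also have "\<dots> = (\<integral>\<omega>. cc k \<omega> * complex_of_real (vv (\<Phi> k \<omega>) - s2) \<partial>\<Omega>)"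
          using poi[OF chain_space, symmetric]
          by (intro Bochner_Integration.integral_cong refl) (simp add: right_diff_distrib)
        finally show "B k - D k = (\<integral>\<omega>. cc k \<omega> * complex_of_real (vv (\<Phi> k \<omega>) - s2) \<partial>\<Omega>)" .
        show "integrable \<Omega> (\<lambda>\<omega>. cc k \<omega> * complex_of_real (vv (\<Phi> k \<omega>) - s2))"
          by (rule cgI[OF vbounded_diff[OF v vbounded_const]])
      qed
      have "A (Suc k) - q * A k + (1 / (2 * real n)) * (B k - D k)
          = (\<integral>\<omega>. cc k \<omega> * ch (\<Phi> k \<omega>) - q * cc k \<omega> + (1 / (2 * real n)) * (cc k \<omega> * complex_of_real (vv (\<Phi> k \<omega>) - s2)) \<partial>\<Omega>)"
        unfolding BD using A_Suc[of k] ccI[of k] vI by (simp add: A_def)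
      also have "\<dots> = (\<integral>\<omega>. cc k \<omega> * (ch (\<Phi> k \<omega>) - q + (vv (\<Phi> k \<omega>) - s2) / (2 * n)) \<partial>\<Omega>)"
        by (intro Bochner_Integration.integral_cong refl) (simp add: algebra_simps diff_divide_distrib)
      also have "norm \<dots> \<le> (\<integral>\<omega>. norm (cc k \<omega> * (ch (\<Phi> k \<omega>) - q + (vv (\<Phi> k \<omega>) - s2) / (2 * n))) \<partial>\<Omega>)"
        by (rule integral_norm_bound)
      also have "\<dots> \<le> (\<integral>\<omega>. start r \<omega> * E1 (\<Phi> k \<omega>) / n + (s2 / (2 * n))\<^sup>2 \<partial>\<Omega>)"
      proof (intro integral_mono integrable_norm)
        have "integrable \<Omega> (\<lambda>\<omega>. cc k \<omega> * ch (\<Phi> k \<omega>) - q * cc k \<omega> + (1 / (2 * real n)) * (cc k \<omega> * complex_of_real (vv (\<Phi> k \<omega>) - s2)))"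
          using A_Suc[of k] ccI[of k] vI by (intro Bochner_Integration.integrable_add Bochner_Integration.integrable_diff integrable_mult_right) auto
        moreover have "cc k \<omega> * ch (\<Phi> k \<omega>) - q * cc k \<omega> + (1 / (2 * real n)) * (cc k \<omega> * complex_of_real (vv (\<Phi> k \<omega>) - s2))
          = cc k \<omega> * (ch (\<Phi> k \<omega>) - q + (vv (\<Phi> k \<omega>) - s2) / (2 * n))" for \<omega> by (simp add: algebra_simps diff_divide_distrib)
        ultimately show "integrable \<Omega> (\<lambda>\<omega>. cc k \<omega> * (ch (\<Phi> k \<omega>) - q + (vv (\<Phi> k \<omega>) - s2) / (2 * n)))" by simp
        show "integrable \<Omega> (\<lambda>\<omega>. start r \<omega> * E1 (\<Phi> k \<omega>) / n + (s2 / (2 * n))\<^sup>2)"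
          using moment(1)[OF r E1v, of k] by (intro Bochner_Integration.integrable_add integrable_divide) auto
        fix \<omega> assume w: "\<omega> \<in> space \<Omega>"
        have "norm (cc k \<omega> * (ch (\<Phi> k \<omega>) - q + (vv (\<Phi> k \<omega>) - s2) / (2 * n))) \<le> start r \<omega> * (E1 (\<Phi> k \<omega>) / n + (s2 / (2 * n))\<^sup>2)"
          unfolding norm_mult cc_norm E1_def by (intro mult_left_mono taylor chain_space[OF w] start_bounds)
        also have "\<dots> \<le> start r \<omega> * E1 (\<Phi> k \<omega>) / n + (s2 / (2 * n))\<^sup>2"
          using start_bounds[of r \<omega>] by (simp add: distrib_left mult_left_le_one_le)
        finally show "norm (cc k \<omega> * (ch (\<Phi> k \<omega>) - q + (vv (\<Phi> k \<omega>) - s2) / (2 * n))) \<le> start r \<omega> * E1 (\<Phi> k \<omega>) / n + (s2 / (2 * n))\<^sup>2" .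
      qed
      also have "\<dots> = (\<integral>\<omega>. start r \<omega> * E1 (\<Phi> k \<omega>) \<partial>\<Omega>) / n + (s2 / (2 * n))\<^sup>2"
        using moment(1)[OF r E1v, of k] by (simp add: \<Omega>.prob_space)
      finally have 1: "norm (A (Suc k) - q * A k + (1 / (2 * real n)) * (B k - D k)) \<le> (\<integral>\<omega>. start r \<omega> * E1 (\<Phi> k \<omega>) \<partial>\<Omega>) / n + (s2 / (2 * n))\<^sup>2" .
      have J2: "0 \<le> (\<integral>\<omega>. start r \<omega> * E2 (\<Phi> k \<omega>) \<partial>\<Omega>)"
        using E12(2)[OF chain_space] start_bounds by (intro integral_nonneg_AE) auto
      have "norm ((1 / (2 * real n)) * (D k - B (Suc k))) = (1 / (2 * real n)) * norm (D k - B (Suc k))"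
        using n by (simp add: norm_mult norm_divide)
      also have "\<dots> \<le> (1 / (2 * real n)) * (\<integral>\<omega>. start r \<omega> * E2 (\<Phi> k \<omega>) \<partial>\<Omega>)" by (intro mult_left_mono D_B) simp
      also have "\<dots> \<le> (1 / real n) * (\<integral>\<omega>. start r \<omega> * E2 (\<Phi> k \<omega>) \<partial>\<Omega>)"
        using J2 n by (intro mult_right_mono divide_left_mono) auto
      finally have 2: "norm ((1 / (2 * real n)) * (D k - B (Suc k))) \<le> (\<integral>\<omega>. start r \<omega> * E2 (\<Phi> k \<omega>) \<partial>\<Omega>) / n" by simp
      have 3: "A (Suc k) - q * A k + (1 / (2 * real n)) * (B k - B (Suc k))
          = (A (Suc k) - q * A k + (1 / (2 * real n)) * (B k - D k)) + (1 / (2 * real n)) * (D k - B (Suc k))"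
        by (simp add: algebra_simps diff_divide_distrib)
      have "norm (A (Suc k) - q * A k + (1 / (2 * real n)) * (B k - B (Suc k)))
          \<le> ((\<integral>\<omega>. start r \<omega> * E1 (\<Phi> k \<omega>) \<partial>\<Omega>) / n + (s2 / (2 * n))\<^sup>2) + (\<integral>\<omega>. start r \<omega> * E2 (\<Phi> k \<omega>) \<partial>\<Omega>) / n"
        unfolding 3 by (rule norm_triangle_mono[OF 1 2])
      also have "\<dots> = ((\<integral>\<omega>. start r \<omega> * E1 (\<Phi> k \<omega>) \<partial>\<Omega>) + (\<integral>\<omega>. start r \<omega> * E2 (\<Phi> k \<omega>) \<partial>\<Omega>)) / n + (s2 / (2 * n))\<^sup>2"
        by (simp add: add_divide_distrib)
      also have "(\<integral>\<omega>. start r \<omega> * E1 (\<Phi> k \<omega>) \<partial>\<Omega>) + (\<integral>\<omega>. start r \<omega> * E2 (\<Phi> k \<omega>) \<partial>\<Omega>) = (\<integral>\<omega>. start r \<omega> * E n (\<Phi> k \<omega>) \<partial>\<Omega>)"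
        unfolding Bochner_Integration.integral_add[OF moment(1)[OF r E1v, of k] moment(1)[OF r E2v, of k], symmetric]
        by (intro Bochner_Integration.integral_cong refl) (simp add: E12(3)[OF chain_space, symmetric] distrib_left)
      finally show ?thesis .
    qed
    have Bb: "norm (B k) \<le> C * (r + b / (1 - lam))" for k
      unfolding B_def by (rule order_trans[OF cg_le moment(2)[OF r u]])
    have q01: "0 \<le> q" "q \<le> 1" using s2 by (auto simp: q_def)
    have "norm (A n - q ^ n * A 0) \<le> (\<Sum>k<n. (\<integral>\<omega>. start r \<omega> * E n (\<Phi> k \<omega>) \<partial>\<Omega>) / n + (s2 / (2 * n))\<^sup>2) + 2 * (1 / (2 * real n)) * (C * (r + b / (1 - lam)))"
      using step Bb by (intro approximate_recursion q01) auto
    also have "\<dots> = (\<Sum>k<n. \<integral>\<omega>. start r \<omega> * E n (\<Phi> k \<omega>) \<partial>\<Omega>) / n + n * (s2 / (2 * n))\<^sup>2 + C * (r + b / (1 - lam)) / n"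
      by (simp add: sum.distrib sum_divide_distrib)
    also have "n * (s2 / (2 * n))\<^sup>2 = s2\<^sup>2 / 4 / n" using n by (simp add: power2_eq_square field_simps)
    also have "(\<Sum>k<n. \<integral>\<omega>. start r \<omega> * E n (\<Phi> k \<omega>) \<partial>\<Omega>) / n + s2\<^sup>2 / 4 / n + C * (r + b / (1 - lam)) / n
       = (\<Sum>k<n. \<integral>\<omega>. start r \<omega> * E n (\<Phi> k \<omega>) \<partial>\<Omega>) / n + (s2\<^sup>2 / 4 + C * (r + b / (1 - lam))) / n"
      by (simp add: add_divide_distrib)
    finally have "norm (A n - q ^ n * A 0) \<le> (\<Sum>k<n. \<integral>\<omega>. start r \<omega> * E n (\<Phi> k \<omega>) \<partial>\<Omega>) / n + (s2\<^sup>2 / 4 + C * (r + b / (1 - lam))) / n" .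
    moreover have "q ^ n = exp (- s2 / 2)" using n by (simp add: q_def exp_of_nat_mult[symmetric])
    moreover have "A 0 = complex_of_real (\<integral>\<omega>. start r \<omega> \<partial>\<Omega>)" by (simp add: A_def cc_def S_def)
    ultimately show ?thesis by (simp add: A_def cc_def sn_def)
  qed
  \<comment> \<open>all terms on the right of \<open>key\<close> vanish in the limit\<close>
  have trunc: "(\<lambda>n. \<integral>\<omega>. start r \<omega> * iexp (S n \<omega> / sqrt n) \<partial>\<Omega>) \<longlonglongrightarrow> exp (- s2 / 2) * (\<integral>\<omega>. start r \<omega> \<partial>\<Omega>)" if r: "0 \<le> r" for r
  proof -
    have "(\<lambda>n. (\<Sum>k<n. \<integral>\<omega>. start r \<omega> * E n (\<Phi> k \<omega>) \<partial>\<Omega>) / n + (s2\<^sup>2 / 4 + C * (r + b / (1 - lam))) / n) \<longlonglongrightarrow> 0 + 0"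
      by (intro tendsto_add mean_ergodic_vanishing[OF r E_v E_nonneg E_dec E_lim] lim_const_over_n)
    then have Z: "(\<lambda>n. (\<Sum>k<n. \<integral>\<omega>. start r \<omega> * E n (\<Phi> k \<omega>) \<partial>\<Omega>) / n + (s2\<^sup>2 / 4 + C * (r + b / (1 - lam))) / n) \<longlonglongrightarrow> 0" by simp
    have "\<forall>\<^sub>F n in sequentially. norm ((\<integral>\<omega>. start r \<omega> * iexp (S n \<omega> / sqrt n) \<partial>\<Omega>) - exp (- s2 / 2) * (\<integral>\<omega>. start r \<omega> \<partial>\<Omega>))
      \<le> (\<Sum>k<n. \<integral>\<omega>. start r \<omega> * E n (\<Phi> k \<omega>) \<partial>\<Omega>) / n + (s2\<^sup>2 / 4 + C * (r + b / (1 - lam))) / n"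
      by (rule eventually_sequentiallyI[of 1]) (rule key[OF r])
    from Lim_null_comparison[OF this Z] show ?thesis by (simp add: LIM_zero_iff)
  qed
  have "(\<lambda>n. \<integral>\<omega>. iexp (S n \<omega> / sqrt n) \<partial>\<Omega>) \<longlonglongrightarrow> exp (- s2 / 2)"
  proof (rule LIMSEQ_I)
    fix d :: real assume d: "0 < d"
    have "\<forall>\<^sub>F m in sequentially. 1 - d / 3 < (\<integral>\<omega>. start (real m) \<omega> \<partial>\<Omega>)"
      using d by (intro order_tendstoD(1)[OF start_tendsto]) simp
    then obtain m where "1 - d / 3 < (\<integral>\<omega>. start (real m) \<omega> \<partial>\<Omega>)" by (auto simp: eventually_sequentially)
    \<comment> \<open>removing the restriction to the event \<open>start r\<close> costs at most its complementary probability, twice\<close>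
    then obtain r where r: "0 \<le> r" "1 - d / 3 < (\<integral>\<omega>. start r \<omega> \<partial>\<Omega>)" using of_nat_0_le_iff by blast
    let ?J = "\<integral>\<omega>. start r \<omega> \<partial>\<Omega>"
    have SI: "integrable \<Omega> (start r)" by (rule \<Omega>.integrable_const_bound[where B=1]) (auto simp: start_bounds)
    have J1: "?J \<le> 1" using start_bounds by (auto intro!: \<Omega>.integral_le_const SI)
    obtain n0 where n0: "\<And>n. n0 \<le> n \<Longrightarrow> norm ((\<integral>\<omega>. start r \<omega> * iexp (S n \<omega> / sqrt n) \<partial>\<Omega>) - exp (- s2 / 2) * ?J) < d / 3"
      using LIMSEQ_D[OF trunc[OF r(1)], of "d / 3"] d by auto
    have close: "norm ((\<integral>\<omega>. iexp (S n \<omega> / sqrt n) \<partial>\<Omega>) - (\<integral>\<omega>. start r \<omega> * iexp (S n \<omega> / sqrt n) \<partial>\<Omega>)) \<le> 1 - ?J" for n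
    proof -
      have I1: "integrable \<Omega> (\<lambda>\<omega>. iexp (S n \<omega> / sqrt n))" by (rule \<Omega>.integrable_const_bound[where B=1]) auto
      have I2: "integrable \<Omega> (\<lambda>\<omega>. start r \<omega> * iexp (S n \<omega> / sqrt n))"
        by (rule \<Omega>.integrable_const_bound[where B=1]) (auto simp: norm_mult start_bounds)
      have "norm ((\<integral>\<omega>. iexp (S n \<omega> / sqrt n) \<partial>\<Omega>) - (\<integral>\<omega>. start r \<omega> * iexp (S n \<omega> / sqrt n) \<partial>\<Omega>))
          = norm (\<integral>\<omega>. iexp (S n \<omega> / sqrt n) - start r \<omega> * iexp (S n \<omega> / sqrt n) \<partial>\<Omega>)"
        using I1 I2 by simp
      also have "\<dots> \<le> (\<integral>\<omega>. norm (iexp (S n \<omega> / sqrt n) - start r \<omega> * iexp (S n \<omega> / sqrt n)) \<partial>\<Omega>)" by (rule integral_norm_bound)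
      also have "\<dots> = (\<integral>\<omega>. 1 - start r \<omega> \<partial>\<Omega>)"
        by (intro Bochner_Integration.integral_cong refl) (simp add: start_def)
      also have "\<dots> = 1 - ?J" using SI by (simp add: \<Omega>.prob_space)
      finally show ?thesis .
    qed
    show "\<exists>no. \<forall>n\<ge>no. norm ((\<integral>\<omega>. iexp (S n \<omega> / sqrt n) \<partial>\<Omega>) - exp (- s2 / 2)) < d"
    proof (intro exI[of _ n0] allI impI)
      fix n assume "n0 \<le> n"
      have 3: "norm (exp (- s2 / 2) * ?J - complex_of_real (exp (- s2 / 2))) \<le> 1 - ?J"
      proof -
        have "exp (- s2 / 2) * ?J - complex_of_real (exp (- s2 / 2)) = complex_of_real (- (exp (- s2 / 2) * (1 - ?J)))"
          by (simp add: algebra_simps)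
        then have "norm (exp (- s2 / 2) * ?J - complex_of_real (exp (- s2 / 2))) = exp (- s2 / 2) * (1 - ?J)"
          using J1 by (simp only: norm_of_real) simp
        also have "\<dots> \<le> 1 * (1 - ?J)" using J1 s2 by (intro mult_right_mono) auto
        finally show ?thesis by simp
      qed
      have "norm ((\<integral>\<omega>. iexp (S n \<omega> / sqrt n) \<partial>\<Omega>) - complex_of_real (exp (- s2 / 2)))
          = norm (((\<integral>\<omega>. iexp (S n \<omega> / sqrt n) \<partial>\<Omega>) - (\<integral>\<omega>. start r \<omega> * iexp (S n \<omega> / sqrt n) \<partial>\<Omega>))
            + (((\<integral>\<omega>. start r \<omega> * iexp (S n \<omega> / sqrt n) \<partial>\<Omega>) - exp (- s2 / 2) * ?J)
            + (exp (- s2 / 2) * ?J - complex_of_real (exp (- s2 / 2)))))" by simp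
      also have "\<dots> \<le> (1 - ?J) + (d / 3 + (1 - ?J))"
        using n0[OF \<open>n0 \<le> n\<close>] by (intro norm_triangle_mono close 3 less_imp_le)
      also have "\<dots> < d" using r(2) by simp
      finally show "norm ((\<integral>\<omega>. iexp (S n \<omega> / sqrt n) \<partial>\<Omega>) - exp (- s2 / 2)) < d" by simp
    qed
  qed
  then show ?thesis by (simp add: S_def s2_def vv_def)
qed

lemma section_measurable:
  assumes x: "x \<in> space M" and f: "(\<lambda>(x, y). f x y) \<in> borel_measurable (M \<Otimes>\<^sub>M M)"
  shows "f x \<in> borel_measurable (P x)"
  using measurable_compose[OF measurable_Pair1'[OF x] f]
  by (simp add: measurable_cong_sets[OF sets_prob_kernel[OF kernel x] refl])

text \<open>
  The index type is finite and arbitrary; the covariance is that of the increments of the chain under its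
  stationary law.
\<close>

definition increment_covariance :: "('k::finite \<Rightarrow> 'x \<Rightarrow> 'x \<Rightarrow> real) \<Rightarrow> real^'k^'k" where
  "increment_covariance \<xi> = (\<chi> i j. \<integral>x. (\<integral>y. \<xi> i x y * \<xi> j x y \<partial>P x) \<partial>\<pi>)"

lemma increment_covariance_sym: "increment_covariance \<xi> $ i $ j = increment_covariance \<xi> $ j $ i"
  by (simp add: increment_covariance_def mult.commute)

context
  fixes \<xi> :: "'k::finite \<Rightarrow> 'x \<Rightarrow> 'x \<Rightarrow> real" and c :: "'k \<Rightarrow> real"
  assumes meas: "\<And>i. (\<lambda>(x, y). \<xi> i x y) \<in> borel_measurable (M \<Otimes>\<^sub>M M)"
    and sq: "\<And>i x. x \<in> space M \<Longrightarrow> integrable (P x) (\<lambda>y. (\<xi> i x y)\<^sup>2)"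
    and mean0: "\<And>i x. x \<in> space M \<Longrightarrow> (\<integral>y. \<xi> i x y \<partial>P x) = 0"
    and var: "\<And>i. vbounded (c i) (\<lambda>x. \<integral>y. (\<xi> i x y)\<^sup>2 \<partial>P x)"
begin

lemma product_integrable: "x \<in> space M \<Longrightarrow> integrable (P x) (\<lambda>y. \<xi> i x y * \<xi> j x y)"
  by (rule integrable_mult_square(1)[OF section_measurable[OF _ meas] section_measurable[OF _ meas] sq sq])

lemma increment_integrable: "x \<in> space M \<Longrightarrow> integrable (P x) (\<xi> i x)"
proof -
  assume x: "x \<in> space M"
  interpret Px: prob_space "P x" by (rule prob_space_prob_kernel[OF kernel x])
  show ?thesis using integrable_mult_square(1)[OF section_measurable[OF x meas] _ sq[OF x], of "\<lambda>_. 1" i] by simp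
qed

lemma product_vbounded: "vbounded (c i + c j) (\<lambda>x. \<integral>y. \<xi> i x y * \<xi> j x y \<partial>P x)"
  unfolding vbounded_def
proof (intro conjI ballI)
  have [measurable]: "case_prod (\<xi> i) \<in> borel_measurable (M \<Otimes>\<^sub>M M)" for i using meas[of i] by simp
  show "(\<lambda>x. \<integral>y. \<xi> i x y * \<xi> j x y \<partial>P x) \<in> borel_measurable M"
    by (rule measurable_kernel_integral[OF _ measurable_prob_algebraD[OF kernel]]) measurable
  fix x assume x: "x \<in> space M"
  show "\<bar>\<integral>y. \<xi> i x y * \<xi> j x y \<partial>P x\<bar> \<le> (c i + c j) * V x"
    using integrable_mult_square(2)[OF section_measurable[OF x meas] section_measurable[OF x meas] sq[OF x] sq[OF x], of i j]
      vboundedD[OF var x, of i] vboundedD[OF var x, of j]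
    by (simp add: distrib_right)
qed

lemma combination_square: "(\<Sum>i\<in>UNIV. a $ i * \<xi> i x y)\<^sup>2 = (\<Sum>i\<in>UNIV. \<Sum>j\<in>UNIV. (a $ i * a $ j) * (\<xi> i x y * \<xi> j x y))"
  by (simp add: power2_eq_square sum_product ac_simps)

lemma combination_variance:
  assumes x: "x \<in> space M"
  shows "integrable (P x) (\<lambda>y. (\<Sum>i\<in>UNIV. a $ i * \<xi> i x y)\<^sup>2)"
    "(\<integral>y. (\<Sum>i\<in>UNIV. a $ i * \<xi> i x y)\<^sup>2 \<partial>P x) = (\<Sum>i\<in>UNIV. \<Sum>j\<in>UNIV. (a $ i * a $ j) * (\<integral>y. \<xi> i x y * \<xi> j x y \<partial>P x))"
  unfolding combination_square using product_integrable[OF x] by simp_all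

lemma combination_vbounded:
  "vbounded (\<Sum>i\<in>UNIV. \<Sum>j\<in>UNIV. \<bar>a $ i * a $ j\<bar> * (c i + c j)) (\<lambda>x. \<integral>y. (\<Sum>i\<in>UNIV. a $ i * \<xi> i x y)\<^sup>2 \<partial>P x)"
proof -
  have "vbounded (\<Sum>i\<in>UNIV. \<Sum>j\<in>UNIV. \<bar>a $ i * a $ j\<bar> * (c i + c j))
      (\<lambda>x. \<Sum>i\<in>UNIV. \<Sum>j\<in>UNIV. (a $ i * a $ j) * (\<integral>y. \<xi> i x y * \<xi> j x y \<partial>P x))"
    by (intro vbounded_sum vbounded_scale product_vbounded finite)
  then show ?thesis
    using combination_variance(2)[of _ a] unfolding vbounded_def by (auto cong: measurable_cong)
qed

lemma combination_limit_variance: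
  "(\<integral>x. (\<integral>y. (\<Sum>i\<in>UNIV. a $ i * \<xi> i x y)\<^sup>2 \<partial>P x) \<partial>\<pi>) = a \<bullet> (increment_covariance \<xi> *v a)"
proof -
  have sp: "space \<pi> = space M" using pi_prob sets_eq_imp_space_eq[of \<pi> M] by (simp add: space_prob_algebra)
  have "(\<integral>x. (\<integral>y. (\<Sum>i\<in>UNIV. a $ i * \<xi> i x y)\<^sup>2 \<partial>P x) \<partial>\<pi>)
      = (\<integral>x. (\<Sum>i\<in>UNIV. \<Sum>j\<in>UNIV. (a $ i * a $ j) * (\<integral>y. \<xi> i x y * \<xi> j x y \<partial>P x)) \<partial>\<pi>)"
    by (rule Bochner_Integration.integral_cong[OF refl]) (simp add: combination_variance(2) sp)
  also have "\<dots> = (\<Sum>i\<in>UNIV. \<Sum>j\<in>UNIV. (a $ i * a $ j) * increment_covariance \<xi> $ i $ j)"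
    using pi_integrable[OF product_vbounded] by (simp add: increment_covariance_def)
  also have "\<dots> = a \<bullet> (increment_covariance \<xi> *v a)"
    by (simp add: inner_vec_def matrix_vector_mult_def sum_distrib_left ac_simps)
  finally show ?thesis .
qed

lemma increment_covariance_psd: "0 \<le> a \<bullet> (increment_covariance \<xi> *v a)"
  unfolding combination_limit_variance[symmetric] by (intro integral_nonneg_AE AE_I2) simp

text \<open>
  The theorem for real increments, applied to linear combinations (the device of Cramer and Wold).
\<close>

theorem central_limit_vector:
  "(\<lambda>n. \<integral>\<omega>. iexp (a \<bullet> (\<chi> i. (\<Sum>j<n. \<xi> i (\<Phi> j \<omega>) (\<Phi> (Suc j) \<omega>)) / sqrt (real n))) \<partial>\<Omega>)
    \<longlonglongrightarrow> exp (- (a \<bullet> (increment_covariance \<xi> *v a)) / 2)"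
proof -
  have [measurable]: "case_prod (\<xi> i) \<in> borel_measurable (M \<Otimes>\<^sub>M M)" for i using meas[of i] by simp
  have m: "(\<lambda>(x, y). \<Sum>i\<in>UNIV. a $ i * \<xi> i x y) \<in> borel_measurable (M \<Otimes>\<^sub>M M)" by measurable
  have z: "(\<integral>y. (\<Sum>i\<in>UNIV. a $ i * \<xi> i x y) \<partial>P x) = 0" if "x \<in> space M" for x
    using increment_integrable[OF that] mean0[OF that] by simp
  have e: "a \<bullet> (\<chi> i. (\<Sum>j<n. \<xi> i (\<Phi> j \<omega>) (\<Phi> (Suc j) \<omega>)) / sqrt (real n))
      = (\<Sum>j<n. \<Sum>i\<in>UNIV. a $ i * \<xi> i (\<Phi> j \<omega>) (\<Phi> (Suc j) \<omega>)) / sqrt (real n)" for n \<omega>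
    by (simp add: inner_vec_def sum_distrib_left sum_divide_distrib) (rule sum.swap)
  show ?thesis
    using central_limit[OF m combination_variance(1) z combination_vbounded]
    unfolding e combination_limit_variance .
qed

end

text \<open>
  Truncation at \<open>2\<close> corresponds to the bound \<open>|exp (i s) - exp (i t)| \<le> 2\<close>: outside the event \<open>start r\<close> only this
  bound is available, and on it the moments of \<open>g\<close> are bounded in \<open>n\<close>.
\<close>

lemma negligible_endpoints:
  fixes t :: real
  assumes g: "vbounded c g" and t: "0 \<le> t"
  shows "(\<lambda>n. \<integral>\<omega>. min 2 (t * (\<bar>g (\<Phi> 0 \<omega>)\<bar> + \<bar>g (\<Phi> n \<omega>)\<bar>) / sqrt (real n)) \<partial>\<Omega>) \<longlonglongrightarrow> 0"
proof (rule LIMSEQ_I)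
  fix d :: real assume d: "0 < d"
  have [measurable]: "g \<in> borel_measurable M" by (rule vbounded_measurable[OF g])
  let ?f = "\<lambda>n \<omega>. min 2 (t * (\<bar>g (\<Phi> 0 \<omega>)\<bar> + \<bar>g (\<Phi> n \<omega>)\<bar>) / sqrt (real n))"
  have f0: "0 \<le> ?f n \<omega>" for n \<omega> using t by simp
  have "\<forall>\<^sub>F m in sequentially. 1 - d / 4 < (\<integral>\<omega>. start (real m) \<omega> \<partial>\<Omega>)"
    using d by (intro order_tendstoD(1)[OF start_tendsto]) simp
  then obtain m where "1 - d / 4 < (\<integral>\<omega>. start (real m) \<omega> \<partial>\<Omega>)" by (auto simp: eventually_sequentially)
  then obtain r where r: "0 \<le> r" "1 - d / 4 < (\<integral>\<omega>. start r \<omega> \<partial>\<Omega>)" using of_nat_0_le_iff by blast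
  have SI: "integrable \<Omega> (start r)" by (rule \<Omega>.integrable_const_bound[where B=1]) (auto simp: start_bounds)
  let ?K = "t * (2 * (c * (r + b / (1 - lam))))"
  have va: "vbounded c (\<lambda>x. \<bar>g x\<bar>)" using g by (auto simp: vbounded_def)
  have bound: "(\<integral>\<omega>. ?f n \<omega> \<partial>\<Omega>) \<le> 2 * (1 - (\<integral>\<omega>. start r \<omega> \<partial>\<Omega>)) + ?K / sqrt (real n)" for n
  proof -
    let ?w = "\<lambda>\<omega>. 2 * (1 - start r \<omega>) + t / sqrt (real n) * (start r \<omega> * \<bar>g (\<Phi> 0 \<omega>)\<bar> + start r \<omega> * \<bar>g (\<Phi> n \<omega>)\<bar>)"
    have wI: "integrable \<Omega> ?w"
      using SI moment(1)[OF r(1) va, of 0] moment(1)[OF r(1) va, of n]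
      by (intro Bochner_Integration.integrable_add integrable_mult_right Bochner_Integration.integrable_diff) auto
    have "(\<integral>\<omega>. ?f n \<omega> \<partial>\<Omega>) \<le> (\<integral>\<omega>. ?w \<omega> \<partial>\<Omega>)"
    proof (rule integral_mono[OF _ wI])
      show "integrable \<Omega> (?f n)" using f0 by (intro \<Omega>.integrable_const_bound[where B=2]) auto
      show "?f n \<omega> \<le> ?w \<omega>" for \<omega> using t by (auto simp: start_def)
    qed
    also have "\<dots> = 2 * (1 - (\<integral>\<omega>. start r \<omega> \<partial>\<Omega>)) + t / sqrt (real n) * ((\<integral>\<omega>. start r \<omega> * \<bar>g (\<Phi> 0 \<omega>)\<bar> \<partial>\<Omega>) + (\<integral>\<omega>. start r \<omega> * \<bar>g (\<Phi> n \<omega>)\<bar> \<partial>\<Omega>))"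
      using SI moment(1)[OF r(1) va, of 0] moment(1)[OF r(1) va, of n] by (simp add: \<Omega>.prob_space)
    also have "\<dots> \<le> 2 * (1 - (\<integral>\<omega>. start r \<omega> \<partial>\<Omega>)) + t / sqrt (real n) * (c * (r + b / (1 - lam)) + c * (r + b / (1 - lam)))"
      using t by (intro add_left_mono mult_left_mono add_mono moment(2)[OF r(1) g]) auto
    finally show ?thesis by simp
  qed
  have "(\<lambda>n. ?K / sqrt (real n)) \<longlonglongrightarrow> 0" by real_asymp
  then have "\<forall>\<^sub>F n in sequentially. ?K / sqrt (real n) < d / 2" using d by (intro order_tendstoD(2)) auto
  then obtain n0 where n0: "\<And>n. n0 \<le> n \<Longrightarrow> ?K / sqrt (real n) < d / 2" by (auto simp: eventually_sequentially)
  show "\<exists>no. \<forall>n\<ge>no. norm ((\<integral>\<omega>. ?f n \<omega> \<partial>\<Omega>) - 0) < d"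
  proof (intro exI[of _ n0] allI impI)
    fix n assume "n0 \<le> n"
    have "0 \<le> (\<integral>\<omega>. ?f n \<omega> \<partial>\<Omega>)" using f0 by (intro integral_nonneg_AE AE_I2)
    then show "norm ((\<integral>\<omega>. ?f n \<omega> \<partial>\<Omega>) - 0) < d"
      using bound[of n] n0[OF \<open>n0 \<le> n\<close>] r(2) by simp
  qed
qed

end

section \<open>Weak convergence from characteristic functions\<close>

text \<open>
  Trigonometric polynomials on a finite-dimensional space; their integrals are combinations of values of the
  characteristic function.
\<close>

inductive_set trigonometric :: "(real^'k \<Rightarrow> complex) set" where
  base: "(\<lambda>z. c * iexp (a \<bullet> z)) \<in> trigonometric"
| add: "f \<in> trigonometric \<Longrightarrow> g \<in> trigonometric \<Longrightarrow> (\<lambda>z. f z + g z) \<in> trigonometric"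

lemma trigonometric_mult:
  assumes "f \<in> trigonometric" "g \<in> trigonometric"
  shows "(\<lambda>z. f z * g z) \<in> trigonometric"
  using assms(1)
proof induction
  case (base c a)
  show ?case using assms(2)
  proof induction
    case (base c' a')
    have "(\<lambda>z. c * iexp (a \<bullet> z) * (c' * iexp (a' \<bullet> z))) = (\<lambda>z. (c * c') * iexp ((a + a') \<bullet> z))"
      by (simp add: inner_add_left distrib_left exp_add ac_simps)
    then show ?case by (simp only: trigonometric.base)
  next
    case (add f g)
    then show ?case using trigonometric.add by (simp add: distrib_left)
  qed
next
  case (add f h)
  then show ?case using trigonometric.add by (simp add: distrib_right)
qed

lemma trigonometric_const: "(\<lambda>z. c) \<in> trigonometric"
  using trigonometric.base[of c 0] by simp

lemma trigonometric_sin: "(\<lambda>z::real^'k. complex_of_real (sin (z $ j / R))) \<in> trigonometric"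
proof -
  have "complex_of_real (sin (z $ j / R))
      = (- \<i> / 2) * iexp (((1 / R) *\<^sub>R axis j 1) \<bullet> z) + (\<i> / 2) * iexp ((- (1 / R) *\<^sub>R axis j 1) \<bullet> z)" for z :: "real^'k"
    by (simp add: inner_axis' sin_of_real[symmetric] sin_exp_eq exp_minus field_simps del: sin_of_real)
  then show ?thesis by (simp only: trigonometric.intros)
qed

lemma trigonometric_sum: "finite A \<Longrightarrow> (\<And>j. j \<in> A \<Longrightarrow> f j \<in> trigonometric) \<Longrightarrow> (\<lambda>z. \<Sum>j\<in>A. f j z) \<in> trigonometric"
  by (induction A rule: finite_induct) (auto intro: trigonometric_const trigonometric.add)

text \<open>
  A polynomial in the numbers \<open>sin (z\<^sub>j / R)\<close> is a trigonometric polynomial in \<open>z\<close>.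
\<close>

lemma trigonometric_polynomial:
  fixes p :: "real^'k \<Rightarrow> real"
  assumes "real_polynomial_function p"
  shows "(\<lambda>z. complex_of_real (p (\<chi> j. sin (z $ j / R)))) \<in> trigonometric"
  using assms
proof induction
  case (linear f)
  have "f (\<chi> j. sin (z $ j / R)) = (\<Sum>j\<in>UNIV. f (axis j 1) * sin (z $ j / R))" for z :: "real^'k"
  proof -
    interpret bounded_linear f by fact
    have "(\<chi> j. sin (z $ j / R)) = (\<Sum>j\<in>UNIV. sin (z $ j / R) *\<^sub>R axis j 1)"
      by (simp add: vec_eq_iff axis_def if_distrib[of "\<lambda>x. _ * x"] cong: if_cong)
    then show ?thesis by (simp add: sum scaleR mult.commute)
  qed
  then have "(\<lambda>z. complex_of_real (f (\<chi> j. sin (z $ j / R))))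
      = (\<lambda>z. \<Sum>j\<in>UNIV. complex_of_real (f (axis j 1)) * complex_of_real (sin (z $ j / R)))"
    by (simp add: fun_eq_iff)
  then show ?case
    by (simp only:) (intro trigonometric_sum finite trigonometric_mult trigonometric_const trigonometric_sin)
next
  case (const c) show ?case by (rule trigonometric_const)
next
  case (add f g) then show ?case using trigonometric.add by fastforce
next
  case (mult f g) then show ?case using trigonometric_mult by fastforce
qed

lemma trigonometric_integral_tendsto:
  fixes Q :: "nat \<Rightarrow> (real^'k) measure"
  assumes Q: "\<And>n. prob_space (Q n)" "\<And>n. sets (Q n) = sets borel"
    and R: "prob_space R" "sets R = sets borel"
    and char: "\<And>a. (\<lambda>n. \<integral>z. iexp (a \<bullet> z) \<partial>Q n) \<longlonglongrightarrow> (\<integral>z. iexp (a \<bullet> z) \<partial>R)"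
    and f: "f \<in> trigonometric"
  shows "(\<forall>n. integrable (Q n) f) \<and> integrable R f \<and> (\<lambda>n. \<integral>z. f z \<partial>Q n) \<longlonglongrightarrow> (\<integral>z. f z \<partial>R)"
  using f
proof induction
  case (base c a)
  have i: "integrable N (\<lambda>z. iexp (a \<bullet> z))" if "prob_space N" "sets N = sets borel" for N :: "(real^'k) measure"
  proof -
    interpret prob_space N by fact
    note [measurable_cong] = that(2)
    show ?thesis by (rule integrable_const_bound[where B=1]) auto
  qed
  from i[OF Q] i[OF R] char[of a] show ?case
    by (auto intro!: tendsto_mult_left)
next
  case (add f g)
  then show ?case by (auto intro!: tendsto_add)
qed

lemma abs_sin_diff_le: "\<bar>sin t - t\<bar> \<le> t\<^sup>2 / 2" for t :: real
proof -
  have "\<bar>Im (iexp t - (1 + \<i> * t))\<bar> \<le> cmod (iexp t - (1 + \<i> * t))" by (rule abs_Im_le_cmod)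
  also have "\<dots> \<le> t\<^sup>2 / 2" using iexp_approx1[of t 1] by (simp add: numeral_2_eq_2)
  finally show ?thesis by (simp add: Im_exp)
qed

text \<open>
  Replace a test function \<open>\<phi>\<close> by \<open>\<phi> (R sin (z / R))\<close>, componentwise. The new function factors through a compact cube,
  so by the theorem of Stone and Weierstrass it is a uniform limit, on the whole space, of trigonometric
  polynomials, and its integrals converge. For large \<open>R\<close> it is uniformly close to \<open>\<phi>\<close> on any given bounded set.
  Outside such a set the mass is uniformly small: each coordinate converges weakly by the one-dimensional
  continuity theorem.
\<close>

theorem weakly_converges_char:
  fixes Q :: "nat \<Rightarrow> (real^'k) measure"
  assumes Q: "\<And>n. prob_space (Q n)" "\<And>n. sets (Q n) = sets borel"
    and R: "prob_space R" "sets R = sets borel"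
    and char: "\<And>a. (\<lambda>n. \<integral>z. iexp (a \<bullet> z) \<partial>Q n) \<longlonglongrightarrow> (\<integral>z. iexp (a \<bullet> z) \<partial>R)"
  shows "weakly_converges Q R"
  unfolding weakly_converges_def
proof (intro allI impI)
  fix \<phi> :: "real^'k \<Rightarrow> real"
  assume "continuous_on UNIV \<phi> \<and> bounded (range \<phi>)"
  then have \<phi>: "continuous_on UNIV \<phi>" and "bounded (range \<phi>)" by auto
  then obtain B0 where B0: "\<And>z. \<bar>\<phi> z\<bar> \<le> B0" by (auto simp: bounded_iff)
  define B where "B = max B0 1"
  have B: "\<bar>\<phi> z\<bar> \<le> B" "0 < B" for z using B0[of z] by (auto simp: B_def)
  interpret Q: prob_space "Q n" for n by fact
  interpret R: prob_space R by fact
  note [measurable_cong] = Q(2) R(2)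
  have [measurable]: "\<phi> \<in> borel_measurable borel" using \<phi> by (rule borel_measurable_continuous_onI)
  have sin_c: "continuous_on UNIV (\<lambda>z::real^'k. r *\<^sub>R (\<chi> j. sin (z $ j / r)))" for r
    by (cases "r = 0") (auto intro!: continuous_intros)
  have [measurable]: "(\<lambda>z::real^'k. r *\<^sub>R (\<chi> j. sin (z $ j / r))) \<in> borel_measurable borel" for r
    using sin_c by (rule borel_measurable_continuous_onI)
  have bint: "integrable (Q n) h" "integrable R h"
    if "h \<in> borel_measurable borel" "\<And>z. \<bar>h z\<bar> \<le> c" for h :: "real^'k \<Rightarrow> real" and c n
    using that by (auto intro!: Q.integrable_const_bound[where B=c] R.integrable_const_bound[where B=c])
  have lip: "\<bar>(\<integral>z. h z \<partial>N) - (\<integral>z. g z \<partial>N)\<bar> \<le> (\<integral>z. w z \<partial>N)"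
    if "integrable N h" "integrable N g" "integrable N w" "\<And>z. \<bar>h z - g z\<bar> \<le> w z" for h g w :: "real^'k \<Rightarrow> real" and N :: "(real^'k) measure"
    using that integral_abs_bound[of N "\<lambda>z. h z - g z"] integral_mono[of N "\<lambda>z. \<bar>h z - g z\<bar>" w] by auto
  \<comment> \<open>the modified test functions: uniform approximation by trigonometric polynomials\<close>
  have periodic: "(\<lambda>n. \<integral>z. \<phi> (r *\<^sub>R (\<chi> j. sin (z $ j / r))) \<partial>Q n) \<longlonglongrightarrow> (\<integral>z. \<phi> (r *\<^sub>R (\<chi> j. sin (z $ j / r))) \<partial>R)" for r
  proof (rule LIMSEQ_I)
    fix e :: real assume e: "0 < e"
    let ?C = "{s::real^'k. \<forall>j. \<bar>s $ j\<bar> \<le> 1}"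
    have "?C = cbox (\<chi> j. -1) (\<chi> j. 1)"
      by (auto simp: mem_box_cart abs_le_iff)
    then have "compact ?C" by simp
    moreover have "continuous_on ?C (\<lambda>s. \<phi> (r *\<^sub>R s))"
      by (intro continuous_on_compose2[OF \<phi>] continuous_intros) auto
    ultimately obtain p where p: "real_polynomial_function p" "\<And>s. s \<in> ?C \<Longrightarrow> \<bar>\<phi> (r *\<^sub>R s) - p s\<bar> < e / 3"
      using Stone_Weierstrass_real_polynomial_function[of ?C "\<lambda>s. \<phi> (r *\<^sub>R s)" "e / 3"] e by auto
    define q where "q = (\<lambda>z::real^'k. p (\<chi> j. sin (z $ j / r)))"
    let ?\<phi> = "\<lambda>z. \<phi> (r *\<^sub>R (\<chi> j. sin (z $ j / r)))"
    have q: "(\<lambda>z. complex_of_real (q z)) \<in> trigonometric"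
      unfolding q_def by (rule trigonometric_polynomial[OF p(1)])
    note t = trigonometric_integral_tendsto[OF Q R char q]
    have qi: "integrable (Q n) q" "integrable R q" for n
      using t by (auto simp: complex_of_real_integrable_eq)
    have "(\<lambda>n. complex_of_real (\<integral>z. q z \<partial>Q n)) \<longlonglongrightarrow> complex_of_real (\<integral>z. q z \<partial>R)"
      using t by simp
    then have "(\<lambda>n. \<integral>z. q z \<partial>Q n) \<longlonglongrightarrow> (\<integral>z. q z \<partial>R)" by (simp only: tendsto_of_real_iff)
    then obtain n0 where n0: "\<And>n. n \<ge> n0 \<Longrightarrow> norm ((\<integral>z. q z \<partial>Q n) - (\<integral>z. q z \<partial>R)) < e / 3"
      using e by (meson LIMSEQ_D divide_pos_pos zero_less_numeral)
    have d: "\<bar>?\<phi> z - q z\<bar> \<le> e / 3" for z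
      using p(2)[of "\<chi> j. sin (z $ j / r)"] unfolding q_def by (simp add: less_imp_le)
    have 1: "\<bar>(\<integral>z. ?\<phi> z \<partial>Q n) - (\<integral>z. q z \<partial>Q n)\<bar> \<le> e / 3" for n
      using lip[OF bint(1)[of ?\<phi> B n] qi(1)[of n] _ d] B by (simp add: Q.prob_space)
    have 2: "\<bar>(\<integral>z. ?\<phi> z \<partial>R) - (\<integral>z. q z \<partial>R)\<bar> \<le> e / 3"
      using lip[OF bint(2)[of ?\<phi> B] qi(2) _ d] B by (simp add: R.prob_space)
    show "\<exists>no. \<forall>n\<ge>no. norm ((\<integral>z. ?\<phi> z \<partial>Q n) - (\<integral>z. ?\<phi> z \<partial>R)) < e"
    proof (intro exI[of _ n0] allI impI)
      fix n assume "n0 \<le> n"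
      from n0[OF this] 1[of n] 2 show "norm ((\<integral>z. ?\<phi> z \<partial>Q n) - (\<integral>z. ?\<phi> z \<partial>R)) < e"
        unfolding real_norm_def by linarith
    qed
  qed
  define \<psi> where "\<psi> = (\<lambda>r x::real. min 1 (max 0 (\<bar>x\<bar> - r)))"
  have \<psi>c: "continuous_on UNIV (\<psi> r)" for r unfolding \<psi>_def by (intro continuous_intros)
  have \<psi>b: "0 \<le> \<psi> r x" "\<psi> r x \<le> 1" for r x by (auto simp: \<psi>_def)
  have [measurable]: "\<psi> r \<in> borel_measurable borel" for r using \<psi>c by (rule borel_measurable_continuous_onI)
  have tail: "(\<lambda>n. \<integral>z. \<psi> r (z $ j) \<partial>Q n) \<longlonglongrightarrow> (\<integral>z. \<psi> r (z $ j) \<partial>R)" for r j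
  proof -
    let ?D = "\<lambda>N. distr N borel (\<lambda>z::real^'k. z $ j)"
    have rd: "real_distribution (?D (Q n))" "real_distribution (?D R)" for n
      unfolding real_distribution_def real_distribution_axioms_def
      by (auto intro!: Q.prob_space_distr R.prob_space_distr)
    have "weak_conv_m (\<lambda>n. ?D (Q n)) (?D R)"
    proof (rule levy_continuity[OF rd])
      fix t
      have "(\<lambda>n. \<integral>z. iexp ((t *\<^sub>R axis j 1) \<bullet> z) \<partial>Q n) \<longlonglongrightarrow> (\<integral>z. iexp ((t *\<^sub>R axis j 1) \<bullet> z) \<partial>R)" by (rule char)
      then show "(\<lambda>n. Characteristic_Functions.char (?D (Q n)) t) \<longlonglongrightarrow> Characteristic_Functions.char (?D R) t"
        by (simp add: char_def integral_distr inner_axis')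
    qed
    then have "(\<lambda>n. \<integral>x. \<psi> r x \<partial>?D (Q n)) \<longlonglongrightarrow> (\<integral>x. \<psi> r x \<partial>?D R)"
      using \<psi>b by (intro weak_conv_imp_integral_bdd_continuous_conv[OF rd, where B=1])
        (auto simp: continuous_on_eq_continuous_at[symmetric] intro!: continuous_on_interior[OF \<psi>c])
    then show ?thesis by (simp add: integral_distr)
  qed
  define tails where "tails = (\<lambda>r (z::real^'k). \<Sum>j\<in>UNIV. \<psi> r (z $ j))"
  have [measurable]: "tails r \<in> borel_measurable borel" for r unfolding tails_def by measurable
  have tails_b: "0 \<le> tails r z" "\<bar>tails r z\<bar> \<le> CARD('k)" for r z
    using \<psi>b sum_mono[of UNIV "\<lambda>j. \<psi> r (z $ j)" "\<lambda>_. 1"] by (auto simp: tails_def sum_nonneg abs_of_nonneg)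
  have tails_lim: "(\<lambda>n. \<integral>z. tails r z \<partial>Q n) \<longlonglongrightarrow> (\<integral>z. tails r z \<partial>R)" for r
  proof -
    have i: "integrable (Q n) (\<lambda>z. \<psi> r (z $ j))" "integrable R (\<lambda>z. \<psi> r (z $ j))" for n j
      using \<psi>b by (intro bint[of "\<lambda>z. \<psi> r (z $ j)" 1]; simp)+
    have "(\<integral>z. tails r z \<partial>Q n) = (\<Sum>j\<in>UNIV. \<integral>z. \<psi> r (z $ j) \<partial>Q n)"
      "(\<integral>z. tails r z \<partial>R) = (\<Sum>j\<in>UNIV. \<integral>z. \<psi> r (z $ j) \<partial>R)" for n
      unfolding tails_def by (rule Bochner_Integration.integral_sum, rule i)+
    then show ?thesis using tendsto_sum[of UNIV, OF tail] by simp
  qed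
  have tails_0: "(\<lambda>m. \<integral>z. tails (real m) z \<partial>R) \<longlonglongrightarrow> (\<integral>z. 0 \<partial>R)"
  proof (rule integral_dominated_convergence[where w="\<lambda>_. CARD('k)"])
    show "AE z in R. (\<lambda>m. tails (real m) z) \<longlonglongrightarrow> 0"
    proof (rule AE_I2)
      fix z :: "real^'k"
      have A: "tails (real m) z = 0" if "m \<ge> nat \<lceil>norm z\<rceil>" for m
      proof -
        have "\<bar>z $ j\<bar> \<le> real m" for j using component_le_norm_cart[of z j] that by linarith
        then show ?thesis by (simp add: tails_def \<psi>_def)
      qed
      show "(\<lambda>m. tails (real m) z) \<longlonglongrightarrow> 0"
        by (rule tendsto_eventually[OF eventually_sequentiallyI[OF A]])
    qed
  qed (use tails_b in auto)
  show "(\<lambda>n. \<integral>z. \<phi> z \<partial>Q n) \<longlonglongrightarrow> (\<integral>z. \<phi> z \<partial>R)"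
  proof (rule LIMSEQ_I)
    fix e :: real assume e: "0 < e"
    define e' where "e' = e / (10 * B)"
    have e': "0 < e'" using e B by (simp add: e'_def)
    have "\<forall>\<^sub>F m in sequentially. (\<integral>z. tails (real m) z \<partial>R) < e'"
      using tails_0 e' by (intro order_tendstoD(2)[OF tails_0]) simp
    then obtain m where m: "(\<integral>z. tails (real m) z \<partial>R) < e'" by (auto simp: eventually_sequentially)
    define r where "r = real m"
    let ?C = "{z::real^'k. \<forall>j. \<bar>z $ j\<bar> \<le> r + 1}"
    have "?C = cbox (\<chi> j. -(r+1)) (\<chi> j. r+1)"
      by (auto simp: mem_box_cart abs_le_iff) (smt (verit))+
    then have "compact ?C" by simp
    then have "uniformly_continuous_on ?C \<phi>"
      by (intro compact_uniformly_continuous continuous_on_subset[OF \<phi>]) auto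
    then obtain d where d: "0 < d" "\<And>z z'. z \<in> ?C \<Longrightarrow> z' \<in> ?C \<Longrightarrow> dist z' z < d \<Longrightarrow> dist (\<phi> z') (\<phi> z) < e / 10"
      using \<open>uniformly_continuous_on ?C \<phi>\<close>[unfolded uniformly_continuous_on_def, rule_format, of "e / 10"] e by auto
    \<comment> \<open>\<open>|S sin (t / S) - t| \<le> t\<^sup>2 / 2S\<close>, so this \<open>S\<close> moves no point of the cube by \<open>d\<close> or more\<close>
    define S where "S = real CARD('k) * (r + 1)\<^sup>2 / d + 1"
    have S: "0 < S" "real CARD('k) * (r + 1)\<^sup>2 / (2 * S) < d"
    proof -
      have A: "0 \<le> real CARD('k) * (r + 1)\<^sup>2 / d" using d(1) by simp
      then show "0 < S" by (simp add: S_def)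
      have "real CARD('k) * (r + 1)\<^sup>2 = (S - 1) * d" using d(1) by (simp add: S_def)
      also have "\<dots> < d * (2 * S)" using d(1) \<open>0 < S\<close> by (simp add: algebra_simps add_pos_pos)
      finally show "real CARD('k) * (r + 1)\<^sup>2 / (2 * S) < d" using \<open>0 < S\<close> by (simp add: pos_divide_less_eq)
    qed
    let ?\<phi> = "\<lambda>z. \<phi> (S *\<^sub>R (\<chi> j. sin (z $ j / S)))"
    have close: "\<bar>\<phi> z - ?\<phi> z\<bar> \<le> e / 10 + 2 * B * tails r z" for z
    proof (cases "z \<in> ?C")
      case True
      have sj: "\<bar>S * sin (z $ j / S)\<bar> \<le> \<bar>z $ j\<bar>" for j
        using abs_sin_x_le_abs_x[of "z $ j / S"] S by (simp add: abs_mult field_simps)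
      then have "S *\<^sub>R (\<chi> j. sin (z $ j / S)) \<in> ?C" using True order_trans[OF sj] by auto
      moreover have "dist (S *\<^sub>R (\<chi> j. sin (z $ j / S))) z < d"
      proof -
        have "\<bar>S * sin (z $ j / S) - z $ j\<bar> \<le> (r + 1)\<^sup>2 / (2 * S)" for j
        proof -
          have "\<bar>S * sin (z $ j / S) - z $ j\<bar> = S * \<bar>sin (z $ j / S) - z $ j / S\<bar>"
          proof -
            have "S * sin (z $ j / S) - z $ j = S * (sin (z $ j / S) - z $ j / S)"
              using S by (simp add: right_diff_distrib)
            then show ?thesis using S by (simp add: abs_mult)
          qed
          also have "\<dots> \<le> S * ((z $ j / S)\<^sup>2 / 2)" using S abs_sin_diff_le by (intro mult_left_mono) auto
          also have "\<dots> = (z $ j)\<^sup>2 / (2 * S)" using S by (simp add: power2_eq_square field_simps)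
          also have "\<dots> \<le> (r + 1)\<^sup>2 / (2 * S)"
            using True S by (intro divide_right_mono) (auto simp: abs_le_square_iff[symmetric] r_def)
          finally show ?thesis .
        qed
        then have "(\<Sum>j\<in>UNIV. \<bar>(S *\<^sub>R (\<chi> j. sin (z $ j / S)) - z) $ j\<bar>) \<le> (\<Sum>j\<in>(UNIV::'k set). (r + 1)\<^sup>2 / (2 * S))"
          by (intro sum_mono) simp
        also have "\<dots> < d" using S(2) by simp
        finally show ?thesis
          using norm_le_l1_cart[of "S *\<^sub>R (\<chi> j. sin (z $ j / S)) - z"] by (simp add: dist_norm)
      qed
      ultimately have "dist (?\<phi> z) (\<phi> z) < e / 10" by (rule d(2)[OF True])
      then have "\<bar>\<phi> z - ?\<phi> z\<bar> < e / 10" unfolding dist_real_def by linarith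
      moreover have "0 \<le> 2 * B * tails r z" using B tails_b by simp
      ultimately show ?thesis by linarith
    next
      case False
      then obtain j where "r + 1 < \<bar>z $ j\<bar>" by (auto simp: not_le)
      then have "1 \<le> \<psi> r (z $ j)" by (simp add: \<psi>_def)
      also have "\<dots> \<le> tails r z" unfolding tails_def using \<psi>b by (intro member_le_sum) auto
      finally have "2 * B * 1 \<le> 2 * B * tails r z" using B(2) by (intro mult_left_mono) auto
      then show ?thesis using B(1)[of z] B(1)[of "S *\<^sub>R (\<chi> j. sin (z $ j / S))"] e by linarith
    qed
    have i: "integrable (Q n) \<phi>" "integrable (Q n) ?\<phi>" "integrable (Q n) (tails r)"
       "integrable R \<phi>" "integrable R ?\<phi>" "integrable R (tails r)" for n
      using B tails_b by (auto intro!: bint)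
    have 1: "\<bar>(\<integral>z. \<phi> z \<partial>Q n) - (\<integral>z. ?\<phi> z \<partial>Q n)\<bar> \<le> e / 10 + 2 * B * (\<integral>z. tails r z \<partial>Q n)" for n
      using lip[OF i(1)[of n] i(2)[of n] _ close] i(3)[of n] by (simp add: Q.prob_space)
    have 2: "\<bar>(\<integral>z. \<phi> z \<partial>R) - (\<integral>z. ?\<phi> z \<partial>R)\<bar> \<le> e / 10 + 2 * B * (\<integral>z. tails r z \<partial>R)"
      using lip[OF i(4,5) _ close] i(6) by (simp add: R.prob_space)
    have "\<forall>\<^sub>F n in sequentially. (\<integral>z. tails r z \<partial>Q n) < e'"
      using m by (intro order_tendstoD(2)[OF tails_lim]) (simp add: r_def)
    moreover have "\<forall>\<^sub>F n in sequentially. dist (\<integral>z. ?\<phi> z \<partial>Q n) (\<integral>z. ?\<phi> z \<partial>R) < e / 10"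
      using e by (intro tendstoD[OF periodic]) simp
    ultimately have "\<forall>\<^sub>F n in sequentially. norm ((\<integral>z. \<phi> z \<partial>Q n) - (\<integral>z. \<phi> z \<partial>R)) < e"
    proof eventually_elim
      case (elim n)
      have "2 * B * (\<integral>z. tails r z \<partial>Q n) \<le> 2 * B * e'" "2 * B * (\<integral>z. tails r z \<partial>R) \<le> 2 * B * e'"
        using elim(1) m B(2) by (auto simp: r_def)
      moreover have "2 * B * e' = e / 5" using B(2) by (simp add: e'_def)
      ultimately show ?case using 1[of n] 2 elim(2) e unfolding real_norm_def dist_real_def by linarith
    qed
    then show "\<exists>no. \<forall>n\<ge>no. norm ((\<integral>z. \<phi> z \<partial>Q n) - (\<integral>z. \<phi> z \<partial>R)) < e"
      by (simp add: eventually_sequentially)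
  qed
qed

section \<open>Multivariate normal laws\<close>

lemma symmetric_inner_matrix:
  fixes S :: "real^'n^'n"
  assumes "\<And>i j. S $ i $ j = S $ j $ i"
  shows "x \<bullet> (S *v y) = y \<bullet> (S *v x)"
proof -
  have "x \<bullet> (S *v y) = (\<Sum>i\<in>UNIV. \<Sum>j\<in>UNIV. x $ i * (S $ i $ j * y $ j))"
    by (simp add: inner_vec_def matrix_vector_mult_def sum_distrib_left)
  also have "\<dots> = (\<Sum>j\<in>UNIV. \<Sum>i\<in>UNIV. x $ i * (S $ i $ j * y $ j))" by (rule sum.swap)
  also have "\<dots> = (\<Sum>j\<in>UNIV. \<Sum>i\<in>UNIV. y $ j * (S $ j $ i * x $ i))"
  proof (intro sum.cong refl)
    fix i j show "x $ i * (S $ i $ j * y $ j) = y $ j * (S $ j $ i * x $ i)" using assms[of i j] by simp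
  qed
  also have "\<dots> = y \<bullet> (S *v x)"
    by (simp add: inner_vec_def matrix_vector_mult_def sum_distrib_left)
  finally show ?thesis .
qed

lemma axis_matrix: "axis i 1 \<bullet> (S *v axis j 1) = S $ i $ j" for S :: "real^'n^'n"
  by (simp add: matrix_vector_mult_basis column_def inner_axis')

text \<open>
  Symmetric Gaussian elimination: subtracting \<open>w w\<^sup>T\<close> with \<open>w = S e / sqrt (e\<^sup>T S e)\<close> for a basis vector \<open>e\<close> with nonzero
  diagonal entry clears that entry and keeps the matrix positive semidefinite, so the number of nonzero
  diagonal entries decreases. A positive semidefinite matrix with zero diagonal vanishes.
\<close>

lemma psd_sum_of_squares:
  fixes S :: "real^'n^'n"
  assumes sym: "\<And>i j. S $ i $ j = S $ j $ i" and psd: "\<And>a. 0 \<le> a \<bullet> (S *v a)"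
  shows "\<exists>(m::nat) v. \<forall>i j. S $ i $ j = (\<Sum>k<m. v k $ i * v k $ j)"
  using assms
proof (induction "card {i. S $ i $ i \<noteq> 0}" arbitrary: S rule: less_induct)
  case less
  note sym = less.prems(1) and psd = less.prems(2)
  have diag: "0 \<le> S $ i $ i" for i using psd[of "axis i 1"] by (simp add: axis_matrix)
  show ?case
  proof (cases "\<exists>i. S $ i $ i \<noteq> 0")
    case False
    have "S $ i $ j = 0" for i j
    proof -
      have "0 \<le> (axis i 1 + t *\<^sub>R axis j 1) \<bullet> (S *v (axis i 1 + t *\<^sub>R axis j 1))" for t by (rule psd)
      then have "0 \<le> 2 * t * S $ i $ j" for t
        using False sym[of j i]
        by (simp add: matrix_vector_right_distrib matrix_vector_mult_scaleR inner_add_left inner_add_right axis_matrix)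
      from this[of 1] this[of "-1"] show ?thesis by simp
    qed
    then show ?thesis by (intro exI[of _ 0]) auto
  next
    case True
    then obtain i0 where "S $ i0 $ i0 \<noteq> 0" by blast
    define d where "d = S $ i0 $ i0"
    have d: "0 < d" using diag[of i0] \<open>S $ i0 $ i0 \<noteq> 0\<close> by (simp add: d_def)
    define w :: "real^'n" where "w = (1 / sqrt d) *\<^sub>R (S *v axis i0 1)"
    have wi: "w $ i = S $ i $ i0 / sqrt d" for i
      by (simp add: w_def matrix_vector_mult_basis column_def)
    define S' :: "real^'n^'n" where "S' = (\<chi> i j. S $ i $ j - w $ i * w $ j)"
    have S'v: "S' *v a = S *v a - (w \<bullet> a) *\<^sub>R w" for a
      by (simp add: vec_eq_iff S'_def matrix_vector_mult_def inner_vec_def sum_subtractf left_diff_distrib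
          right_diff_distrib sum_distrib_left ac_simps)
    have sym': "S' $ i $ j = S' $ j $ i" for i j using sym[of i j] by (simp add: S'_def)
    have psd': "0 \<le> a \<bullet> (S' *v a)" for a
    proof -
      define q where "q = a \<bullet> (S *v axis i0 1)"
      have q': "axis i0 1 \<bullet> (S *v a) = q" unfolding q_def by (rule symmetric_inner_matrix[OF sym])
      have "0 \<le> (a - (q / d) *\<^sub>R axis i0 1) \<bullet> (S *v (a - (q / d) *\<^sub>R axis i0 1))" by (rule psd)
      also have "\<dots> = a \<bullet> (S *v a) - (q / d) * q - (q / d) * q + (q / d) * (q / d) * d"
        by (simp add: matrix_vector_mult_diff_distrib matrix_vector_mult_scaleR inner_diff_left inner_diff_right
            axis_matrix q' q_def[symmetric] d_def[symmetric] algebra_simps)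
      also have "\<dots> = a \<bullet> (S *v a) - q\<^sup>2 / d" using d by (simp add: power2_eq_square field_simps)
      also have "\<dots> = a \<bullet> (S' *v a)"
      proof -
        have "w \<bullet> a = q / sqrt d" "a \<bullet> w = q / sqrt d" by (simp_all add: w_def q_def inner_commute)
        then show ?thesis using d by (simp add: S'v inner_diff_right power2_eq_square)
      qed
      finally show ?thesis .
    qed
    have "{i. S' $ i $ i \<noteq> 0} \<subset> {i. S $ i $ i \<noteq> 0}"
    proof
      show "{i. S' $ i $ i \<noteq> 0} \<subseteq> {i. S $ i $ i \<noteq> 0}"
      proof safe
        fix i assume i: "S' $ i $ i \<noteq> 0" "S $ i $ i = 0"
        have "0 \<le> S' $ i $ i" using psd'[of "axis i 1"] by (simp add: axis_matrix)
        moreover have "S' $ i $ i = - (w $ i)\<^sup>2" using i(2) by (simp add: S'_def power2_eq_square)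
        ultimately show False using i(1) zero_le_power2[of "w $ i"] by linarith
      qed
      have "S' $ i0 $ i0 = 0" using d by (simp add: S'_def wi d_def[symmetric] real_div_sqrt)
      then have "i0 \<notin> {i. S' $ i $ i \<noteq> 0}" "i0 \<in> {i. S $ i $ i \<noteq> 0}"
        using \<open>S $ i0 $ i0 \<noteq> 0\<close> by simp_all
      then show "{i. S' $ i $ i \<noteq> 0} \<noteq> {i. S $ i $ i \<noteq> 0}" by metis
    qed
    then have "card {i. S' $ i $ i \<noteq> 0} < card {i. S $ i $ i \<noteq> 0}" by (intro psubset_card_mono) auto
    from less.hyps[OF this sym' psd'] obtain m :: nat and v
      where mv: "\<forall>i j. S' $ i $ j = (\<Sum>k<m. v k $ i * v k $ j)" by blast
    have "S $ i $ j = (\<Sum>k<Suc m. (v(m := w)) k $ i * (v(m := w)) k $ j)" for i j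
      using mv[rule_format, of i j] by (simp add: S'_def)
    then show ?thesis by blast
  qed
qed

lemma normal_law_distr:
  assumes "0 \<le> s"
  shows "normal_law c s = distr std_normal_distribution borel (\<lambda>x. c + s * x)"
proof (cases "s = 0")
  case True
  interpret real_distribution std_normal_distribution by (rule real_dist_normal_dist)
  show ?thesis using True
    by (intro measure_eqI) (auto simp: normal_law_def emeasure_distr emeasure_space_1[simplified] indicator_def)
next
  case False
  interpret real_distribution std_normal_distribution by (rule real_dist_normal_dist)
  have "distributed std_normal_distribution lborel (\<lambda>x. x) (normal_density 0 1)"
    unfolding distributed_def by (auto simp: distr_id2)
  from normal_density_affine[OF this _ False, of c]
  have "distributed std_normal_distribution lborel (\<lambda>x. c + s * x) (normal_density c s)" using assms by simp
  then show ?thesis using False by (simp add: distributed_def normal_law_def) (metis distr_cong sets_lborel)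
qed

lemma std_normal_moments:
  "integrable std_normal_distribution (\<lambda>x. x)" "(\<integral>x. x \<partial>std_normal_distribution) = 0"
  "integrable std_normal_distribution (\<lambda>x. x\<^sup>2)" "(\<integral>x. x\<^sup>2 \<partial>std_normal_distribution) = 1"
proof -
  show "integrable std_normal_distribution (\<lambda>x. x)"
    using integrable_std_normal_distribution_moment[of 1] by simp
  show "(\<integral>x. x \<partial>std_normal_distribution) = 0"
    using integral_std_normal_distribution_moment_odd[of 1] by simp
  show "integrable std_normal_distribution (\<lambda>x. x\<^sup>2)"
    by (rule integrable_std_normal_distribution_moment)
  show "(\<integral>x. x\<^sup>2 \<partial>std_normal_distribution) = 1"
    using std_normal_distribution_even_moments(1)[of 1] by simp
qed

lemma normal_law:
  assumes "0 \<le> s"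
  shows "integrable (normal_law c s) (\<lambda>x. x)" "(\<integral>x. x \<partial>normal_law c s) = c"
    and "integrable (normal_law c s) (\<lambda>x. x\<^sup>2)" "(\<integral>x. x\<^sup>2 \<partial>normal_law c s) = c\<^sup>2 + s\<^sup>2"
    and "(\<integral>x. iexp (t * x) \<partial>normal_law c s) = iexp (t * c) * exp (- (s * t)\<^sup>2 / 2)"
    and "real_distribution (normal_law c s)"
proof -
  interpret real_distribution std_normal_distribution by (rule real_dist_normal_dist)
  note m = std_normal_moments
  have sq: "(c + s * x)\<^sup>2 = c\<^sup>2 + 2 * c * s * x + s\<^sup>2 * x\<^sup>2" for x
    by (simp add: power2_eq_square algebra_simps)
  have i: "integrable std_normal_distribution (\<lambda>x. c + s * x)"
    using m(1) by (intro Bochner_Integration.integrable_add) auto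
  have i2: "integrable std_normal_distribution (\<lambda>x. c\<^sup>2 + 2 * c * s * x + s\<^sup>2 * x\<^sup>2)"
    using m(1,3) by (intro Bochner_Integration.integrable_add) auto
  show "integrable (normal_law c s) (\<lambda>x. x)"
    unfolding normal_law_distr[OF assms] using i by (subst integrable_distr_eq) auto
  show "integrable (normal_law c s) (\<lambda>x. x\<^sup>2)"
    unfolding normal_law_distr[OF assms] using i2 by (subst integrable_distr_eq) (auto simp: sq)
  have "(\<integral>x. x \<partial>normal_law c s) = (\<integral>x. c + s * x \<partial>std_normal_distribution)"
    unfolding normal_law_distr[OF assms] by (subst integral_distr) auto
  also have "\<dots> = (\<integral>x. c \<partial>std_normal_distribution) + s * (\<integral>x. x \<partial>std_normal_distribution)"
    using m(1) by (subst Bochner_Integration.integral_add) auto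
  finally show "(\<integral>x. x \<partial>normal_law c s) = c" unfolding m(2) using prob_space by simp
  have "(\<integral>x. x\<^sup>2 \<partial>normal_law c s) = (\<integral>x. (c\<^sup>2 + 2 * c * s * x) + s\<^sup>2 * x\<^sup>2 \<partial>std_normal_distribution)"
    unfolding normal_law_distr[OF assms] by (subst integral_distr) (auto simp: sq)
  also have "\<dots> = (\<integral>x. c\<^sup>2 + 2 * c * s * x \<partial>std_normal_distribution) + (\<integral>x. s\<^sup>2 * x\<^sup>2 \<partial>std_normal_distribution)"
    using m(1,3) by (intro Bochner_Integration.integral_add) auto
  also have "(\<integral>x. c\<^sup>2 + 2 * c * s * x \<partial>std_normal_distribution)
      = (\<integral>x. c\<^sup>2 \<partial>std_normal_distribution) + (\<integral>x. 2 * c * s * x \<partial>std_normal_distribution)"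
    using m(1) by (intro Bochner_Integration.integral_add) auto
  finally show "(\<integral>x. x\<^sup>2 \<partial>normal_law c s) = c\<^sup>2 + s\<^sup>2"
    unfolding integral_mult_right_zero m(2,4) using prob_space by simp
  have "(\<integral>x. iexp (t * x) \<partial>normal_law c s) = (\<integral>x. iexp (t * c) * iexp ((s * t) * x) \<partial>std_normal_distribution)"
    unfolding normal_law_distr[OF assms] by (subst integral_distr) (auto simp: exp_add[symmetric] algebra_simps)
  also have "\<dots> = iexp (t * c) * char std_normal_distribution (s * t)"
    by (simp add: char_def)
  finally show "(\<integral>x. iexp (t * x) \<partial>normal_law c s) = iexp (t * c) * exp (- (s * t)\<^sup>2 / 2)"
    by (simp add: char_std_normal_distribution exp_of_real)
  show "real_distribution (normal_law c s)"
    unfolding normal_law_distr[OF assms] by (rule real_distribution_distr) simp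
qed

text \<open>
  A linear functional of the vector is normal by definition; its mean and variance are determined by those of the vector.
\<close>

lemma multivariate_normal_char:
  assumes N: "multivariate_normal 0 \<Sigma> N"
  shows "(\<integral>z. iexp (a \<bullet> z) \<partial>N) = exp (- (a \<bullet> (\<Sigma> *v a)) / 2)"
proof -
  have ps: "prob_space N" and s[measurable_cong]: "sets N = sets borel"
    and law: "\<And>a. \<exists>c. \<exists>s\<ge>0. distr N borel (\<lambda>z. a \<bullet> z) = normal_law c s"
    and mean: "\<And>i. (\<integral>z. z $ i \<partial>N) = 0" and cov: "\<And>i j. (\<integral>z. z $ i * z $ j \<partial>N) = \<Sigma> $ i $ j"
    using N by (auto simp: multivariate_normal_def)
  interpret prob_space N by fact
  have lin: "integrable N (\<lambda>z. a \<bullet> z)" "integrable N (\<lambda>z. (a \<bullet> z)\<^sup>2)" for a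
  proof -
    obtain c s where cs: "0 \<le> s" "distr N borel (\<lambda>z. a \<bullet> z) = normal_law c s" using law by blast
    show "integrable N (\<lambda>z. a \<bullet> z)" "integrable N (\<lambda>z. (a \<bullet> z)\<^sup>2)"
      using normal_law(1,3)[OF cs(1), of c] unfolding cs(2)[symmetric] by (simp_all add: integrable_distr_eq)
  qed
  have I: "integrable N (\<lambda>z. z $ i)" "integrable N (\<lambda>z. (z $ i)\<^sup>2)" for i
    using lin[of "axis i 1"] by (simp_all add: inner_axis')
  have IJ: "integrable N (\<lambda>z. z $ i * z $ j)" for i j
  proof (rule Bochner_Integration.integrable_bound[of _ "\<lambda>z. (z $ i)\<^sup>2 + (z $ j)\<^sup>2"])
    show "AE z in N. norm (z $ i * z $ j) \<le> norm ((z $ i)\<^sup>2 + (z $ j)\<^sup>2)"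
    proof (rule AE_I2)
      fix z :: "real^'a"
      have "2 * (\<bar>z $ i\<bar> * \<bar>z $ j\<bar>) \<le> (z $ i)\<^sup>2 + (z $ j)\<^sup>2"
        using sum_squares_bound[of "\<bar>z $ i\<bar>" "\<bar>z $ j\<bar>"] by (simp add: mult.assoc)
      then show "norm (z $ i * z $ j) \<le> norm ((z $ i)\<^sup>2 + (z $ j)\<^sup>2)"
        using mult_nonneg_nonneg[OF abs_ge_zero[of "z $ i"] abs_ge_zero[of "z $ j"]] by (simp add: abs_mult del: mult_nonneg_nonneg zero_le_mult_iff) 
    qed
  qed (use I in auto)
  obtain c s where cs: "0 \<le> s" "distr N borel (\<lambda>z. a \<bullet> z) = normal_law c s" using law by blast
  have "c = (\<integral>z. a \<bullet> z \<partial>N)"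
    using normal_law(2)[OF cs(1), of c] unfolding cs(2)[symmetric] by (simp add: integral_distr)
  also have "\<dots> = 0" using I by (simp add: inner_vec_def mean)
  finally have c: "c = 0" .
  have "s\<^sup>2 = (\<integral>z. (a \<bullet> z)\<^sup>2 \<partial>N)"
    using normal_law(4)[OF cs(1), of c] unfolding cs(2)[symmetric] by (simp add: integral_distr c)
  also have "\<dots> = (\<integral>z. (\<Sum>i\<in>UNIV. \<Sum>j\<in>UNIV. a $ i * a $ j * (z $ i * z $ j)) \<partial>N)"
    by (intro Bochner_Integration.integral_cong refl) (simp add: inner_vec_def power2_eq_square sum_product ac_simps)
  also have "\<dots> = (\<Sum>i\<in>UNIV. \<Sum>j\<in>UNIV. a $ i * a $ j * \<Sigma> $ i $ j)"
    using IJ by (simp add: cov)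
  also have "\<dots> = a \<bullet> (\<Sigma> *v a)"
    by (simp add: inner_vec_def matrix_vector_mult_def sum_distrib_left ac_simps)
  finally have s2: "s\<^sup>2 = a \<bullet> (\<Sigma> *v a)" .
  have "(\<integral>z. iexp (a \<bullet> z) \<partial>N) = (\<integral>x. iexp (1 * x) \<partial>distr N borel (\<lambda>z. a \<bullet> z))"
    by (simp add: integral_distr)
  also have "\<dots> = exp (- (a \<bullet> (\<Sigma> *v a)) / 2)"
    unfolding cs(2) normal_law(5)[OF cs(1)] by (simp add: c s2)
  finally show ?thesis .
qed

text \<open>
  If \<open>\<Sigma>\<close> is the sum of the \<open>v\<^sub>k v\<^sub>k\<^sup>T\<close>, then the sum of the \<open>\<omega>\<^sub>k v\<^sub>k\<close> with independent standard normal
  \<open>\<omega>\<^sub>k\<close> has covariance \<open>\<Sigma>\<close>. All properties are read off from the characteristic function.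
\<close>

lemma multivariate_normal_exists:
  fixes \<Sigma> :: "real^'n^'n"
  assumes sym: "\<And>i j. \<Sigma> $ i $ j = \<Sigma> $ j $ i" and psd: "\<And>a. 0 \<le> a \<bullet> (\<Sigma> *v a)"
  shows "\<exists>N. multivariate_normal 0 \<Sigma> N"
proof -
  obtain m v where mv: "\<And>i j. \<Sigma> $ i $ j = (\<Sum>k<(m::nat). v k $ i * v k $ j)"
    using psd_sum_of_squares[OF assms] by blast
  interpret std: real_distribution std_normal_distribution by (rule real_dist_normal_dist)
  interpret P: product_prob_space "\<lambda>_. std_normal_distribution" "{..<m}" ..
  let ?P = "Pi\<^sub>M {..<m} (\<lambda>_. std_normal_distribution)"
  define X :: "(nat \<Rightarrow> real) \<Rightarrow> real^'n" where "X = (\<lambda>\<omega>. \<Sum>k<m. \<omega> k *\<^sub>R v k)"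
  have [measurable]: "X \<in> borel_measurable ?P" unfolding X_def
    by (intro borel_measurable_sum borel_measurable_scaleR) (auto intro!: measurable_component_singleton[THEN measurable_compose])
  define N where "N = distr ?P borel X"
  have ps: "prob_space N" unfolding N_def by (rule P.prob_space_distr) simp
  interpret N: prob_space N by fact
  have s[measurable_cong]: "sets N = sets borel" by (simp add: N_def)
  have quad: "(\<Sum>k<m. (a \<bullet> v k)\<^sup>2) = a \<bullet> (\<Sigma> *v a)" for a
  proof -
    have "(\<Sum>k<m. (a \<bullet> v k)\<^sup>2) = (\<Sum>k<m. \<Sum>i\<in>UNIV. \<Sum>j\<in>UNIV. a $ i * (v k $ i * v k $ j) * a $ j)"
      by (simp add: inner_vec_def power2_eq_square sum_product ac_simps)
    also have "\<dots> = (\<Sum>i\<in>UNIV. \<Sum>j\<in>UNIV. \<Sum>k<m. a $ i * (v k $ i * v k $ j) * a $ j)"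
      by (simp only: sum.swap[of _ "{..<m}"])
    also have "\<dots> = a \<bullet> (\<Sigma> *v a)"
      by (simp add: inner_vec_def matrix_vector_mult_def mv sum_distrib_left sum_distrib_right ac_simps)
    finally show ?thesis .
  qed
  have char: "(\<integral>z. iexp (a \<bullet> z) \<partial>N) = exp (- (a \<bullet> (\<Sigma> *v a)) / 2)" for a
  proof -
    have "(\<integral>z. iexp (a \<bullet> z) \<partial>N) = (\<integral>\<omega>. iexp (a \<bullet> X \<omega>) \<partial>?P)"
      unfolding N_def by (simp add: integral_distr)
    also have "\<dots> = (\<integral>\<omega>. (\<Prod>k<m. iexp ((a \<bullet> v k) * \<omega> k)) \<partial>?P)"
      by (simp add: X_def inner_sum_right sum_distrib_left exp_sum mult.commute)
    also have "\<dots> = (\<Prod>k<m. \<integral>x. iexp ((a \<bullet> v k) * x) \<partial>std_normal_distribution)"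
      by (intro P.product_integral_prod std.integrable_iexp) auto
    also have "\<dots> = (\<Prod>k<m. complex_of_real (exp (- (a \<bullet> v k)\<^sup>2 / 2)))"
      using char_std_normal_distribution by (simp add: char_def fun_eq_iff)
    also have "\<dots> = complex_of_real (exp (\<Sum>k<m. - (a \<bullet> v k)\<^sup>2 / 2))"
      by (simp add: exp_sum)
    also have "(\<Sum>k<m. - (a \<bullet> v k)\<^sup>2 / 2) = - (a \<bullet> (\<Sigma> *v a)) / 2"
      by (simp add: quad[symmetric] sum_negf sum_divide_distrib)
    finally show ?thesis .
  qed
  have law: "distr N borel (\<lambda>z. a \<bullet> z) = normal_law 0 (sqrt (a \<bullet> (\<Sigma> *v a)))" for a
  proof (rule Levy_uniqueness)
    show "real_distribution (distr N borel (\<lambda>z. a \<bullet> z))" by (rule N.real_distribution_distr) simp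
    show "real_distribution (normal_law 0 (sqrt (a \<bullet> (\<Sigma> *v a))))" using psd by (intro normal_law(6)) simp
    show "Characteristic_Functions.char (distr N borel (\<lambda>z. a \<bullet> z)) = Characteristic_Functions.char (normal_law 0 (sqrt (a \<bullet> (\<Sigma> *v a))))"
    proof
      fix t
      have "Characteristic_Functions.char (distr N borel (\<lambda>z. a \<bullet> z)) t = (\<integral>z. iexp ((t *\<^sub>R a) \<bullet> z) \<partial>N)"
        by (simp add: char_def integral_distr)
      also have "\<dots> = exp (- ((t *\<^sub>R a) \<bullet> (\<Sigma> *v (t *\<^sub>R a))) / 2)" by (rule char)
      also have "\<dots> = Characteristic_Functions.char (normal_law 0 (sqrt (a \<bullet> (\<Sigma> *v a)))) t"
        unfolding char_def using psd[of a]
        by (subst normal_law(5)) (auto simp: matrix_vector_mult_scaleR power_mult_distrib power2_eq_square ac_simps)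
      finally show "Characteristic_Functions.char (distr N borel (\<lambda>z. a \<bullet> z)) t
        = Characteristic_Functions.char (normal_law 0 (sqrt (a \<bullet> (\<Sigma> *v a)))) t" .
    qed
  qed
  have sq: "0 \<le> sqrt (a \<bullet> (\<Sigma> *v a))" for a using psd by simp
  have mean: "(\<integral>z. a \<bullet> z \<partial>N) = 0" for a
    using normal_law(2)[OF sq, of 0 a] unfolding law[symmetric] by (simp add: integral_distr)
  have second: "integrable N (\<lambda>z. (a \<bullet> z)\<^sup>2)" "(\<integral>z. (a \<bullet> z)\<^sup>2 \<partial>N) = a \<bullet> (\<Sigma> *v a)" for a
    using normal_law(3,4)[OF sq, of 0 a] psd[of a] unfolding law[symmetric]
    by (simp_all add: integral_distr integrable_distr_eq)
  have cov: "(\<integral>z. z $ i * z $ j \<partial>N) = \<Sigma> $ i $ j" for i j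
  proof -
    let ?p = "axis i 1 + axis j 1 :: real^'n" and ?q = "axis i 1 - axis j 1 :: real^'n"
    have "(\<integral>z. z $ i * z $ j \<partial>N) = (\<integral>z. ((?p \<bullet> z)\<^sup>2 - (?q \<bullet> z)\<^sup>2) / 4 \<partial>N)"
      by (intro Bochner_Integration.integral_cong refl)
        (simp add: inner_add_left inner_diff_left inner_axis' power2_eq_square algebra_simps)
    also have "\<dots> = (?p \<bullet> (\<Sigma> *v ?p) - ?q \<bullet> (\<Sigma> *v ?q)) / 4"
      using second[of ?p] second[of ?q] by simp
    also have "\<dots> = \<Sigma> $ i $ j"
      using sym[of j i]
      by (simp add: matrix_vector_right_distrib matrix_vector_mult_diff_distrib inner_add_left inner_add_right
          inner_diff_left inner_diff_right axis_matrix)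
    finally show ?thesis .
  qed
  have "\<exists>c. \<exists>s\<ge>0. distr N borel (\<lambda>z. a \<bullet> z) = normal_law c s" for a using law sq by blast
  then have "multivariate_normal 0 \<Sigma> N"
    unfolding multivariate_normal_def
    using ps s mean[of "axis _ 1"] cov by (simp add: inner_axis')
  then show ?thesis ..
qed

section \<open>The product of the time average and the likelihood gradient\<close>

lemma pderivative_prod:
  assumes "\<And>j. j \<in> A \<Longrightarrow> (q j) differentiable (at \<theta>)"
  shows "pderivative i (\<lambda>\<theta>. \<Prod>j\<in>A. q j \<theta>) \<theta> = (\<Sum>j\<in>A. pderivative i (q j) \<theta> * (\<Prod>k\<in>A - {j}. q k \<theta>))"
proof -
  have "((\<lambda>h. q j (\<theta> + h *\<^sub>R axis i 1)) has_field_derivative pderivative i (q j) \<theta>) (at 0)" if "j \<in> A" for j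
  proof -
    have "q j differentiable (at (\<theta> + 0 *\<^sub>R axis i 1))" using assms[OF that] by simp
    then have "(\<lambda>h. q j (\<theta> + h *\<^sub>R axis i 1)) differentiable (at 0)"
      by (rule differentiable_compose) (auto intro!: derivative_intros differentiable_add differentiable_scaleR)
    then show ?thesis unfolding pderivative_def by (simp add: DERIV_deriv_iff_real_differentiable)
  qed
  from has_field_derivative_prod[OF this]
  have "((\<lambda>h. \<Prod>j\<in>A. q j (\<theta> + h *\<^sub>R axis i 1)) has_field_derivative
      (\<Sum>j\<in>A. pderivative i (q j) \<theta> * (\<Prod>k\<in>A - {j}. q k (\<theta> + 0 *\<^sub>R axis i 1)))) (at 0)" .
  then show ?thesis unfolding pderivative_def[of i "\<lambda>\<theta>. \<Prod>j\<in>A. q j \<theta>"] by (intro DERIV_imp_deriv) simp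
qed

theorem proposition3p3:
  fixes M :: "'x measure"
    and \<Theta> :: "(real^'d) set" and \<theta>\<^sub>0 :: "real^'d" and \<epsilon> :: real
    and P :: "real^'d \<Rightarrow> 'x \<Rightarrow> 'x measure"
    and f fh :: "'x \<Rightarrow> real"
    and p :: "real^'d \<Rightarrow> 'x \<Rightarrow> 'x \<Rightarrow> real"
    and K :: "'x set" and \<delta> :: real and m :: nat and \<nu> :: "'x measure"
    and V :: "'x \<Rightarrow> real" and lam b c\<^sub>1 :: real
    and \<mu> :: "'x measure" and \<Omega> :: "'w measure" and \<Phi> :: "nat \<Rightarrow> 'w \<Rightarrow> 'x"
  defines "B \<equiv> param_ball \<Theta> \<theta>\<^sub>0 \<epsilon>"
    and "\<pi>\<^sub>0 \<equiv> the_invariant_prob M (P \<theta>\<^sub>0)"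
  assumes cg: "countably_generated_space M"
    and interior: "\<theta>\<^sub>0 \<in> interior \<Theta>"
    and kernel: "\<And>\<theta>. \<theta> \<in> \<Theta> \<Longrightarrow> P \<theta> \<in> M \<rightarrow>\<^sub>M prob_algebra M"
    and f_meas: "f \<in> borel_measurable M"
    and eps: "\<epsilon> > 0"
    \<comment> \<open>(i)\<close>
    and irred: "\<And>\<theta>. \<theta> \<in> B \<Longrightarrow> psi_irreducible M (P \<theta>)"
    \<comment> \<open>(ii)\<close>
    and p_meas: "\<And>\<theta>. \<theta> \<in> B \<Longrightarrow> (\<lambda>(x, y). p \<theta> x y) \<in> borel_measurable (M \<Otimes>\<^sub>M M)"
    and p_nonneg: "\<And>\<theta> x y. \<theta> \<in> B \<Longrightarrow> x \<in> space M \<Longrightarrow> y \<in> space M \<Longrightarrow> p \<theta> x y \<ge> 0"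
    and p_diff: "\<And>x y. x \<in> space M \<Longrightarrow> y \<in> space M \<Longrightarrow> (\<lambda>\<theta>. p \<theta> x y) differentiable (at \<theta>\<^sub>0)"
    and p_dens: "\<And>\<theta> x. \<theta> \<in> B \<Longrightarrow> x \<in> space M \<Longrightarrow>
                   P \<theta> x = density (P \<theta>\<^sub>0 x) (\<lambda>y. ennreal (p \<theta> x y))"
    \<comment> \<open>(iii)\<close>
    and small: "K \<in> sets M" "\<delta> > 0" "m \<ge> 1" "\<nu> \<in> space (prob_algebra M)"
      "\<And>\<theta> x A. \<theta> \<in> B \<Longrightarrow> x \<in> K \<Longrightarrow> A \<in> sets M \<Longrightarrow>
         emeasure (kernel_pow M (P \<theta>) m x) A \<ge> ennreal \<delta> * emeasure \<nu> A"
    \<comment> \<open>(iv)\<close>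
    and V: "V \<in> borel_measurable M" "\<And>x. x \<in> space M \<Longrightarrow> V x \<ge> 1"
    and drift: "0 < lam" "lam < 1"
      "\<And>\<theta> x. \<theta> \<in> B \<Longrightarrow> x \<in> space M \<Longrightarrow>
         (\<integral>\<^sup>+y. ennreal (V y) \<partial>P \<theta> x) \<le> ennreal (lam * V x + b * indicator K x)"
    \<comment> \<open>(v); the first condition says that the signed kernel acts on \<open>Linf M V\<close>\<close>
    and deriv_kernel:
      "\<And>i x. x \<in> space M \<Longrightarrow> integrable (P \<theta>\<^sub>0 x) (\<lambda>y. V y * dens_deriv p \<theta>\<^sub>0 i x y)"
      "\<And>i. kernel_norm M V (deriv_kernel_op (P \<theta>\<^sub>0) p \<theta>\<^sub>0 i) < \<infinity>"
      "\<And>i. ((\<lambda>h. kernel_norm M V (\<lambda>g x.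
                (kernel_op (P (\<theta>\<^sub>0 + h *\<^sub>R axis i 1)) g x - kernel_op (P \<theta>\<^sub>0) g x) / h
                - deriv_kernel_op (P \<theta>\<^sub>0) p \<theta>\<^sub>0 i g x)) \<longlongrightarrow> 0) (at 0)"
    \<comment> \<open>(vi); integrability means that the integral of the nonnegative function defining \<open>g\<^sub>i\<^sub>i\<close> is finite\<close>
    and g_diag:
      "\<And>i x. x \<in> space M \<Longrightarrow> integrable (P \<theta>\<^sub>0 x) (\<lambda>y. (dens_deriv p \<theta>\<^sub>0 i x y)\<^sup>2)"
      "\<And>i. wnorm M V (\<lambda>x. \<integral>y. (dens_deriv p \<theta>\<^sub>0 i x y)\<^sup>2 \<partial>P \<theta>\<^sub>0 x) < \<infinity>"
    \<comment> \<open>(vii)\<close>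
    and f_norm: "wnorm M (\<lambda>x. sqrt (V x)) f < \<infinity>"
    \<comment> \<open>the chain and the solution of Poisson's equation\<close>
    and chain: "markov_chain M (P \<theta>\<^sub>0) \<mu> \<Omega> \<Phi>"
    and fh_meas: "fh \<in> borel_measurable M"
    and poisson: "\<And>x. x \<in> space M \<Longrightarrow> fh x - kernel_op (P \<theta>\<^sub>0) fh x = f x - (\<integral>y. f y \<partial>\<pi>\<^sub>0)"
    and fh_bound: "\<And>x. x \<in> space M \<Longrightarrow> \<bar>fh x\<bar> \<le> c\<^sub>1 * sqrt (V x)"
  defines "\<Sigma> \<equiv> (\<chi> i j. \<integral>x. gfun (P \<theta>\<^sub>0) p \<theta>\<^sub>0 fh i j x \<partial>\<pi>\<^sub>0) :: real^('d option)^('d option)"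
  shows "(\<exists>N. multivariate_normal 0 \<Sigma> N) \<and>
    (\<forall>N. multivariate_normal 0 \<Sigma> N \<longrightarrow>
       weakly_converges
         (\<lambda>n. distr \<Omega> borel (\<lambda>\<omega>. (time_average f \<Phi> n \<omega> - (\<integral>y. f y \<partial>\<pi>\<^sub>0)) *\<^sub>R
                                     gradient (likelihood_ratio p \<Phi> n \<omega>) \<theta>\<^sub>0))
         (distr N borel (\<lambda>z. z $ None *\<^sub>R (\<chi> i. z $ Some i))))"
proof -
  let ?P = "P \<theta>\<^sub>0"
  define b' where "b' = max b 0"
  define d where "d = (\<lambda>i x y. dens_deriv p \<theta>\<^sub>0 i x y)"
  interpret \<Omega>: prob_space \<Omega> using chain by (simp add: markov_chain_def)
  have \<Phi>m: "\<Phi> n \<in> \<Omega> \<rightarrow>\<^sub>M M" for n using chain by (simp add: markov_chain_def)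
  have ne: "space M \<noteq> {}"
    using measurable_space[OF \<Phi>m] \<Omega>.not_empty by blast
  interpret W: weighted_space M V by unfold_locales (rule ne V)+
  \<comment> \<open>\<open>\<theta>\<^sub>0\<close> is an interior point, so short displacements along the axes stay in \<open>B\<close>\<close>
  obtain \<rho> where \<rho>: "0 < \<rho>" and near: "\<And>i h. \<bar>h\<bar> < \<rho> \<Longrightarrow> \<theta>\<^sub>0 + h *\<^sub>R axis i 1 \<in> B"
  proof -
    obtain e where e: "0 < e" "ball \<theta>\<^sub>0 e \<subseteq> \<Theta>" using interior by (auto simp: mem_interior)
    have "\<theta>\<^sub>0 + h *\<^sub>R axis i 1 \<in> B" if h: "\<bar>h\<bar> < min e \<epsilon>" for h i
    proof -
      have "\<theta>\<^sub>0 + h *\<^sub>R axis i 1 \<in> ball \<theta>\<^sub>0 e" using h by (simp add: dist_norm norm_axis_1)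
      moreover have "(MAX j. \<bar>(\<theta>\<^sub>0 + h *\<^sub>R axis i 1) $ j - \<theta>\<^sub>0 $ j\<bar>) < \<epsilon>"
        using h eps by (subst Max_less_iff) (auto simp: axis_def)
      ultimately show ?thesis using e(2) by (auto simp: B_def param_ball_def)
    qed
    then show ?thesis using e(1) eps by (intro that[of "min e \<epsilon>"]) auto
  qed
  have \<theta>B: "\<theta>\<^sub>0 \<in> B" using near[of 0] \<rho> by simp
  have B\<Theta>: "\<theta> \<in> B \<Longrightarrow> \<theta> \<in> \<Theta>" for \<theta> by (simp add: B_def param_ball_def)
  note kP = kernel[OF B\<Theta>[OF \<theta>B]]
  \<comment> \<open>a negative \<open>b\<close> is compatible with the drift condition if \<open>K\<close> carries large values of \<open>V\<close>;
    \<open>b'\<close> is its positive part\<close>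
  interpret D: drift_minorization M V ?P K \<delta> m \<nu> lam b'
  proof (unfold_locales)
    show "?P \<in> M \<rightarrow>\<^sub>M prob_algebra M" by (rule kP)
    show "K \<in> sets M" "\<delta> > 0" "\<nu> \<in> space (prob_algebra M)" by (rule small)+
    show "ennreal \<delta> * emeasure \<nu> A \<le> emeasure (kernel_pow M ?P m x) A" if "x \<in> K" "A \<in> sets M" for x A
      using small(5)[OF \<theta>B that] .
    show "0 < lam" "lam < 1" by (rule drift)+
    show "0 \<le> b'" by (simp add: b'_def)
    show "(\<integral>\<^sup>+y. ennreal (V y) \<partial>?P x) \<le> ennreal (lam * V x + b' * indicator K x)" if "x \<in> space M" for x
      by (rule order_trans[OF drift(3)[OF \<theta>B that]]) (auto intro!: ennreal_leI simp: b'_def indicator_def)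
  qed
  obtain \<pi> where inv: "invariant_prob M ?P \<pi>" and uniq: "\<And>\<pi>'. invariant_prob M ?P \<pi>' \<Longrightarrow> \<pi>' = \<pi>"
    and pint: "\<And>k g. W.vbounded k g \<Longrightarrow> integrable \<pi> g"
    and ppois: "\<And>k g. W.vbounded k g \<Longrightarrow> \<exists>C u. W.vbounded C u \<and> (\<forall>x\<in>space M. u x - kernel_op ?P u x = g x - (\<integral>y. g y \<partial>\<pi>))"
    using D.invariant_prob_exists_unique by blast
  have \<pi>: "\<pi>\<^sub>0 = \<pi>" unfolding \<pi>\<^sub>0_def the_invariant_prob_def using inv uniq by (rule the_equality)
  interpret E: ergodic_chain M V ?P \<mu> \<Omega> \<Phi> \<pi> lam b'
  proof (unfold_locales)
    show "?P \<in> M \<rightarrow>\<^sub>M prob_algebra M" by (rule kP)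
    show "markov_chain M ?P \<mu> \<Omega> \<Phi>" by (rule chain)
    show "0 < lam" "lam < 1" by (rule drift)+
    show "0 \<le> b'" by (simp add: b'_def)
    show "(\<integral>\<^sup>+y. ennreal (V y) \<partial>?P x) \<le> ennreal (lam * V x + b')" if "x \<in> space M" for x
      by (rule order_trans[OF drift(3)[OF \<theta>B that]]) (auto intro!: ennreal_leI simp: b'_def indicator_def)
    show "\<pi> \<in> space (prob_algebra M)" using inv by (simp add: invariant_prob_def)
    show "integrable \<pi> g" if "W.vbounded c g" for c g by (rule pint[OF that])
    show "\<exists>C u. W.vbounded C u \<and> (\<forall>x\<in>space M. u x - kernel_op ?P u x = g x - (\<integral>y. g y \<partial>\<pi>))"
      if "W.vbounded c g" for c g by (rule ppois[OF that])
  qed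
  have dd: "((\<lambda>h. p (\<theta>\<^sub>0 + h *\<^sub>R axis i 1) x y) has_field_derivative d i x y) (at 0)"
    if "x \<in> space M" "y \<in> space M" for i x y
  proof -
    have "(\<lambda>\<theta>. p \<theta> x y) differentiable (at (\<theta>\<^sub>0 + 0 *\<^sub>R axis i 1))" using p_diff[OF that] by simp
    then have "(\<lambda>h. p (\<theta>\<^sub>0 + h *\<^sub>R axis i 1) x y) differentiable (at 0)"
      by (rule differentiable_compose) (auto intro!: derivative_intros differentiable_add differentiable_scaleR)
    then show ?thesis unfolding d_def dens_deriv_def pderivative_def by (simp add: DERIV_deriv_iff_real_differentiable)
  qed
  have dm: "(\<lambda>(x, y). d i x y) \<in> borel_measurable (M \<Otimes>\<^sub>M M)" for i
  proof -
    obtain N where N: "1 / real (Suc N) < \<rho>" using \<rho> reals_Archimedean by (auto simp: inverse_eq_divide)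
    define h where "h = (\<lambda>n. 1 / real (Suc (n + N)))"
    have hB: "\<theta>\<^sub>0 + h n *\<^sub>R axis i 1 \<in> B" for n
    proof (rule near)
      have "1 / real (Suc (n + N)) \<le> 1 / real (Suc N)" by (simp add: frac_le)
      then show "\<bar>h n\<bar> < \<rho>" using N by (simp add: h_def)
    qed
    have h0: "filterlim h (at 0) sequentially"
    proof (rule filterlim_atI)
      show "h \<longlonglongrightarrow> 0" unfolding h_def by real_asymp
      show "\<forall>\<^sub>F n in sequentially. h n \<noteq> 0" by (simp add: h_def)
    qed
    \<comment> \<open>only the densities for parameters in \<open>B\<close> are measurable, so the difference quotients use small steps\<close>
    show ?thesis
    proof (rule borel_measurable_LIMSEQ_metric)
      show "(\<lambda>z. ((\<lambda>(x, y). p (\<theta>\<^sub>0 + h n *\<^sub>R axis i 1) x y) z - (\<lambda>(x, y). p \<theta>\<^sub>0 x y) z) / h n) \<in> borel_measurable (M \<Otimes>\<^sub>M M)" for n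
        by (intro borel_measurable_divide borel_measurable_diff p_meas hB \<theta>B borel_measurable_const)
      fix z assume "z \<in> space (M \<Otimes>\<^sub>M M)"
      then obtain x y where z: "z = (x, y)" "x \<in> space M" "y \<in> space M" by (auto simp: space_pair_measure)
      have "(\<lambda>k. (p (\<theta>\<^sub>0 + (0 + k) *\<^sub>R axis i 1) x y - p (\<theta>\<^sub>0 + 0 *\<^sub>R axis i 1) x y) / k) \<midarrow>0\<rightarrow> d i x y"
        using dd[OF z(2,3)] unfolding DERIV_def .
      from filterlim_compose[OF this h0]
      show "(\<lambda>n. ((\<lambda>(x, y). p (\<theta>\<^sub>0 + h n *\<^sub>R axis i 1) x y) z - (\<lambda>(x, y). p \<theta>\<^sub>0 x y) z) / h n) \<longlonglongrightarrow> (\<lambda>(x, y). d i x y) z"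
        by (simp add: z)
    qed
  qed
  have d_sq: "integrable (?P x) (\<lambda>y. (d i x y)\<^sup>2)" if "x \<in> space M" for i x
    using g_diag(1)[OF that] by (simp add: d_def)
  have d_int: "integrable (?P x) (d i x)" if x: "x \<in> space M" for i x
  proof -
    interpret Px: prob_space "?P x" by (rule prob_space_prob_kernel[OF kP x])
    show ?thesis
      using integrable_mult_square(1)[OF E.section_measurable[OF x dm] _ d_sq[OF x], of "\<lambda>_. 1" i] by simp
  qed
  have d_mean: "(\<integral>y. d i x y \<partial>?P x) = 0" if x: "x \<in> space M" for i x
  proof -
    \<comment> \<open>test the difference quotients of the kernels with a constant function: they vanish, as all \<open>P \<theta>\<close> are
      probability kernels, so the derivative kernel must vanish there too\<close>
    let ?a = "\<integral>y. d i x y \<partial>?P x" and ?v = "INF x\<in>space M. V x"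
    let ?Q = "\<lambda>h g x. (kernel_op (P (\<theta>\<^sub>0 + h *\<^sub>R axis i 1)) g x - kernel_op (P \<theta>\<^sub>0) g x) / h
                - deriv_kernel_op (P \<theta>\<^sub>0) p \<theta>\<^sub>0 i g x"
    have "ennreal (?v * \<bar>?a\<bar> / V x) \<le> kernel_norm M V (?Q h)" if h: "\<bar>h\<bar> < \<rho>" for h
    proof -
      have "?Q h (\<lambda>_. ?v) x = - (?v * ?a)"
        unfolding W.kernel_op_const[OF kernel[OF B\<Theta>[OF near[OF h]]] x] W.kernel_op_const[OF kP x]
        by (simp add: deriv_kernel_op_def d_def)
      then have "\<bar>?Q h (\<lambda>_. ?v) x\<bar> = ?v * \<bar>?a\<bar>" using W.INF_V_ge_1 by (simp add: abs_mult)
      then show ?thesis using W.kernel_norm_const[OF x, of "?Q h"] by simp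
    qed
    moreover have "\<forall>\<^sub>F h in at 0. \<bar>h\<bar> < \<rho>"
      using \<rho> by (auto simp: eventually_at intro!: exI[of _ \<rho>])
    ultimately have "\<forall>\<^sub>F h in at 0. ennreal (?v * \<bar>?a\<bar> / V x) \<le> kernel_norm M V (?Q h)"
      by (auto elim: eventually_mono)
    from tendsto_lowerbound[OF deriv_kernel(3) this] have "ennreal (?v * \<bar>?a\<bar> / V x) \<le> ennreal 0" by simp
    then have "?v * \<bar>?a\<bar> / V x \<le> 0" by (subst (asm) ennreal_le_iff) simp_all
    then show ?thesis using W.INF_V_ge_1 V(2)[OF x] by (auto simp: divide_le_0_iff mult_le_0_iff)
  qed
  have c1: "0 \<le> c\<^sub>1"
  proof -
    obtain x where x: "x \<in> space M" using ne by blast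
    have "0 \<le> c\<^sub>1 * sqrt (V x)" using fh_bound[OF x] by linarith
    then show ?thesis using V(2)[OF x] by (simp add: zero_le_mult_iff)
  qed
  have fh_sq_le: "(fh x)\<^sup>2 \<le> c\<^sub>1\<^sup>2 * V x" if x: "x \<in> space M" for x
  proof -
    have "\<bar>fh x\<bar>\<^sup>2 \<le> (c\<^sub>1 * sqrt (V x))\<^sup>2" using fh_bound[OF x] by (intro power_mono) auto
    then show ?thesis using V(2)[OF x] by (simp add: power_mult_distrib)
  qed
  have fhv: "W.vbounded c\<^sub>1 fh"
    unfolding W.vbounded_def
  proof (intro conjI ballI fh_meas)
    fix x assume x: "x \<in> space M"
    have "V x \<le> (V x)\<^sup>2" using self_le_power[OF V(2)[OF x], of 2] by simp
    then have "sqrt (V x) \<le> V x" using V(2)[OF x] by (intro real_le_lsqrt) auto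
    then have "c\<^sub>1 * sqrt (V x) \<le> c\<^sub>1 * V x" using c1 by (rule mult_left_mono)
    then show "\<bar>fh x\<bar> \<le> c\<^sub>1 * V x" using fh_bound[OF x] by linarith
  qed
  have fh2v: "W.vbounded (c\<^sub>1\<^sup>2) (\<lambda>x. (fh x)\<^sup>2)"
    using fh_sq_le fh_meas by (auto simp: W.vbounded_def)
  define \<xi> where "\<xi> = (\<lambda>k x y. case k of None \<Rightarrow> fh y - kernel_op ?P fh x | Some i \<Rightarrow> d i x y)"
  have \<xi>_simps: "\<xi> None x y = fh y - kernel_op ?P fh x" "\<xi> (Some i) x y = d i x y" for x y i by (simp_all add: \<xi>_def)
  have fhI: "integrable (?P x) fh" "integrable (?P x) (\<lambda>y. (fh y)\<^sup>2)" if "x \<in> space M" for x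
    using W.bounded_kernel_integrable[OF E.bounded_kernel_P fhv that] W.bounded_kernel_integrable[OF E.bounded_kernel_P fh2v that] by auto
  have \<xi>_meas: "(\<lambda>(x, y). \<xi> k x y) \<in> borel_measurable (M \<Otimes>\<^sub>M M)" for k
  proof (cases k)
    case None
    note [measurable] = fh_meas W.vbounded_measurable[OF W.kernel_op_vbounded[OF E.bounded_kernel_P fhv]]
    show ?thesis unfolding None \<xi>_simps by measurable
  next
    case (Some i) show ?thesis unfolding Some \<xi>_simps by (rule dm)
  qed
  have exp_sq: "(fh y - kernel_op ?P fh x)\<^sup>2 = (fh y)\<^sup>2 - 2 * kernel_op ?P fh x * fh y + (kernel_op ?P fh x)\<^sup>2" for x y
    by (simp add: power2_eq_square algebra_simps)
  have \<xi>_sq: "integrable (?P x) (\<lambda>y. (\<xi> k x y)\<^sup>2)" if x: "x \<in> space M" for k x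
  proof (cases k)
    case None
    interpret Px: prob_space "?P x" by (rule prob_space_prob_kernel[OF kP x])
    show ?thesis unfolding None \<xi>_simps exp_sq
      using fhI[OF x] by (intro Bochner_Integration.integrable_add Bochner_Integration.integrable_diff) auto
  next
    case (Some i) show ?thesis unfolding Some \<xi>_simps by (rule d_sq[OF x])
  qed
  have \<xi>_mean: "(\<integral>y. \<xi> k x y \<partial>?P x) = 0" if x: "x \<in> space M" for k x
  proof (cases k)
    case None
    interpret Px: prob_space "?P x" by (rule prob_space_prob_kernel[OF kP x])
    show ?thesis unfolding None \<xi>_simps
      using fhI[OF x] by (simp add: Px.prob_space kernel_op_def)
  next
    case (Some i) show ?thesis unfolding Some \<xi>_simps by (rule d_mean[OF x])
  qed
  have \<xi>_var: "\<exists>c. W.vbounded c (\<lambda>x. \<integral>y. (\<xi> k x y)\<^sup>2 \<partial>?P x)" for k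
  proof -
    have [measurable]: "case_prod (\<xi> k) \<in> borel_measurable (M \<Otimes>\<^sub>M M)" using \<xi>_meas[of k] by simp
    have m: "(\<lambda>x. \<integral>y. (\<xi> k x y)\<^sup>2 \<partial>?P x) \<in> borel_measurable M"
      by (rule measurable_kernel_integral[OF _ measurable_prob_algebraD[OF kP]]) measurable
    show ?thesis
    proof (cases k)
      case None
      have "\<bar>\<integral>y. (\<xi> k x y)\<^sup>2 \<partial>?P x\<bar> \<le> c\<^sub>1\<^sup>2 * (lam + b') * V x" if x: "x \<in> space M" for x
      proof -
        interpret Px: prob_space "?P x" by (rule prob_space_prob_kernel[OF kP x])
        have "(\<integral>y. (\<xi> k x y)\<^sup>2 \<partial>?P x) = kernel_op ?P (\<lambda>y. (fh y)\<^sup>2) x - (kernel_op ?P fh x)\<^sup>2"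
          unfolding None \<xi>_simps exp_sq
          using fhI[OF x] by (simp add: Px.prob_space kernel_op_def power2_eq_square)
        moreover have "0 \<le> (\<integral>y. (\<xi> k x y)\<^sup>2 \<partial>?P x)" by (intro integral_nonneg_AE) auto
        moreover have "\<bar>kernel_op ?P (\<lambda>y. (fh y)\<^sup>2) x\<bar> \<le> c\<^sub>1\<^sup>2 * (lam + b') * V x"
          by (rule W.vboundedD[OF W.kernel_op_vbounded[OF E.bounded_kernel_P fh2v] x])
        ultimately show ?thesis using zero_le_power2[of "kernel_op ?P fh x"] by linarith
      qed
      with m show ?thesis by (auto simp: W.vbounded_def)
    next
      case (Some i)
      have "(\<lambda>x. \<integral>y. (\<xi> k x y)\<^sup>2 \<partial>?P x) = (\<lambda>x. \<integral>y. (dens_deriv p \<theta>\<^sub>0 i x y)\<^sup>2 \<partial>?P x)"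
        by (simp add: Some \<xi>_simps d_def)
      then show ?thesis using W.wnorm_boundD[OF m] g_diag(2)[of i] by auto
    qed
  qed
  obtain c where c: "\<And>k. W.vbounded (c k) (\<lambda>x. \<integral>y. (\<xi> k x y)\<^sup>2 \<partial>?P x)" using \<xi>_var by metis
  note hyps = \<xi>_meas \<xi>_sq \<xi>_mean c
  have gfun: "(\<integral>y. \<xi> k x y * \<xi> l x y \<partial>?P x) = gfun ?P p \<theta>\<^sub>0 fh k l x" if x: "x \<in> space M" for k l x
  proof -
    \<comment> \<open>the centring of \<open>fh\<close> drops out because \<open>d i x\<close> has integral zero\<close>
    have mixed: "(\<integral>y. (fh y - kernel_op ?P fh x) * d i x y \<partial>?P x) = (\<integral>y. fh y * d i x y \<partial>?P x)" for i
    proof -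
      have fP: "fh \<in> borel_measurable (?P x)" using fhI(1)[OF x] by simp
      have i: "integrable (?P x) (\<lambda>y. fh y * d i x y)"
        by (rule integrable_mult_square(1)[OF fP E.section_measurable[OF x dm] fhI(2)[OF x] d_sq[OF x]])
      have "(\<integral>y. (fh y - kernel_op ?P fh x) * d i x y \<partial>?P x) = (\<integral>y. fh y * d i x y - kernel_op ?P fh x * d i x y \<partial>?P x)"
        by (simp add: left_diff_distrib)
      also have "\<dots> = (\<integral>y. fh y * d i x y \<partial>?P x)" using i d_int[OF x, of i] d_mean[OF x, of i] by simp
      finally show ?thesis .
    qed
    show ?thesis
      using mixed by (cases k; cases l) (simp_all add: \<xi>_simps power2_eq_square d_def mult.commute)
  qed
  have s\<pi>: "space \<pi> = space M"
    using inv sets_eq_imp_space_eq[of \<pi> M] by (simp add: invariant_prob_def space_prob_algebra)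
  have \<Sigma>: "\<Sigma> = E.increment_covariance \<xi>"
    unfolding \<Sigma>_def E.increment_covariance_def \<pi>
    by (simp add: vec_eq_iff, intro allI Bochner_Integration.integral_cong refl) (simp add: gfun s\<pi>)
  have exN: "\<exists>N. multivariate_normal 0 \<Sigma> N"
    unfolding \<Sigma>
    by (rule multivariate_normal_exists[OF E.increment_covariance_sym E.increment_covariance_psd[OF hyps]])
  \<comment> \<open>the density of \<open>P \<theta>\<^sub>0\<close> with respect to itself, hence equal to \<open>1\<close> only almost everywhere\<close>
  have p1: "AE \<omega> in \<Omega>. \<forall>k. p \<theta>\<^sub>0 (\<Phi> k \<omega>) (\<Phi> (Suc k) \<omega>) = 1"
  proof (rule AE_all_countable[THEN iffD2], rule allI)
    fix k
    have one: "AE y in ?P x. p \<theta>\<^sub>0 x y = 1" if x: "x \<in> space M" for x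
    proof -
      interpret Px: prob_space "?P x" by (rule prob_space_prob_kernel[OF kP x])
      have [measurable]: "p \<theta>\<^sub>0 x \<in> borel_measurable (?P x)" by (rule E.section_measurable[OF x p_meas[OF \<theta>B]])
      have "density (?P x) (\<lambda>y. ennreal (p \<theta>\<^sub>0 x y)) = density (?P x) (\<lambda>_. 1)"
        using p_dens[OF \<theta>B x] by (simp add: density_1)
      from Px.density_unique[OF _ _ this] have "AE y in ?P x. ennreal (p \<theta>\<^sub>0 x y) = 1" by simp
      then show ?thesis
      proof (rule AE_mp, intro AE_I2 impI)
        fix y assume "y \<in> space (?P x)" "ennreal (p \<theta>\<^sub>0 x y) = 1"
        then show "p \<theta>\<^sub>0 x y = 1"
          using p_nonneg[OF \<theta>B x] space_prob_kernel[OF kP x] by (simp add: ennreal_eq_1)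
      qed
    qed
    have [measurable]: "case_prod (p \<theta>\<^sub>0) \<in> borel_measurable (M \<Otimes>\<^sub>M M)" using p_meas[OF \<theta>B] by simp
    have [measurable]: "\<Phi> k \<in> E.F k \<rightarrow>\<^sub>M M" by (rule E.measurable_F_chain) simp
    define h :: "'w \<times> 'x \<Rightarrow> ennreal" where "h = (\<lambda>z. if p \<theta>\<^sub>0 (\<Phi> k (fst z)) (snd z) = 1 then 0 else 1)"
    have hm: "h \<in> borel_measurable (E.F k \<Otimes>\<^sub>M M)" unfolding h_def by measurable
    have "(\<integral>\<^sup>+\<omega>. h (\<omega>, \<Phi> (Suc k) \<omega>) \<partial>\<Omega>) = (\<integral>\<^sup>+\<omega>. \<integral>\<^sup>+y. h (\<omega>, y) \<partial>?P (\<Phi> k \<omega>) \<partial>\<Omega>)"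
      by (rule E.markov_nn_integral[OF hm])
    also have "\<dots> = (\<integral>\<^sup>+\<omega>. 0 \<partial>\<Omega>)"
    proof (rule nn_integral_cong)
      fix \<omega> assume w: "\<omega> \<in> space \<Omega>"
      have "(\<integral>\<^sup>+y. h (\<omega>, y) \<partial>?P (\<Phi> k \<omega>)) = (\<integral>\<^sup>+y. 0 \<partial>?P (\<Phi> k \<omega>))"
        using one[OF E.chain_space[OF w, of k]] by (intro nn_integral_cong_AE) (auto simp: h_def)
      then show "(\<integral>\<^sup>+y. h (\<omega>, y) \<partial>?P (\<Phi> k \<omega>)) = 0" by simp
    qed
    finally have "(\<integral>\<^sup>+\<omega>. h (\<omega>, \<Phi> (Suc k) \<omega>) \<partial>\<Omega>) = 0" by simp
    moreover have "(\<lambda>\<omega>. h (\<omega>, \<Phi> (Suc k) \<omega>)) \<in> borel_measurable \<Omega>"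
      unfolding h_def using \<Phi>m by measurable
    ultimately have "AE \<omega> in \<Omega>. h (\<omega>, \<Phi> (Suc k) \<omega>) = 0" by (simp add: nn_integral_0_iff_AE)
    then show "AE \<omega> in \<Omega>. p \<theta>\<^sub>0 (\<Phi> k \<omega>) (\<Phi> (Suc k) \<omega>) = 1"
      by (rule AE_mp) (auto simp: h_def split: if_splits intro!: AE_I2)
  qed
  have grad: "gradient (likelihood_ratio p \<Phi> n \<omega>) \<theta>\<^sub>0 $ i
      = (\<Sum>j\<in>{..<n}. d i (\<Phi> j \<omega>) (\<Phi> (Suc j) \<omega>) * (\<Prod>k\<in>{..<n} - {j}. p \<theta>\<^sub>0 (\<Phi> k \<omega>) (\<Phi> (Suc k) \<omega>)))"
    if w: "\<omega> \<in> space \<Omega>" for n \<omega> i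
  proof -
    have "likelihood_ratio p \<Phi> n \<omega> = (\<lambda>\<theta>. \<Prod>j\<in>{..<n}. p \<theta> (\<Phi> j \<omega>) (\<Phi> (Suc j) \<omega>))"
    proof
      fix \<theta>
      have "(\<Prod>j=1..n. p \<theta> (\<Phi> (j - 1) \<omega>) (\<Phi> j \<omega>)) = (\<Prod>j\<in>{..<n}. p \<theta> (\<Phi> j \<omega>) (\<Phi> (Suc j) \<omega>))"
        by (rule prod.reindex_bij_witness[of _ Suc "\<lambda>j. j - 1"]) auto
      then show "likelihood_ratio p \<Phi> n \<omega> \<theta> = (\<Prod>j\<in>{..<n}. p \<theta> (\<Phi> j \<omega>) (\<Phi> (Suc j) \<omega>))"
        by (simp add: likelihood_ratio_def)
    qed
    then show ?thesis
      using pderivative_prod[of "{..<n}" "\<lambda>j \<theta>. p \<theta> (\<Phi> j \<omega>) (\<Phi> (Suc j) \<omega>)" \<theta>\<^sub>0 i]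
        p_diff[OF E.chain_space[OF w] E.chain_space[OF w]]
      by (simp add: gradient_def d_def dens_deriv_def)
  qed
  let ?\<alpha> = "\<integral>y. f y \<partial>\<pi>\<^sub>0"
  define X :: "nat \<Rightarrow> 'w \<Rightarrow> real^('d option)" where
    "X = (\<lambda>n \<omega>. \<chi> k. case k of None \<Rightarrow> sqrt (real n) * (time_average f \<Phi> n \<omega> - ?\<alpha>)
        | Some i \<Rightarrow> gradient (likelihood_ratio p \<Phi> n \<omega>) \<theta>\<^sub>0 $ i / sqrt (real n))"
  define Y :: "nat \<Rightarrow> 'w \<Rightarrow> real^('d option)" where
    "Y = (\<lambda>n \<omega>. \<chi> k. (\<Sum>j<n. \<xi> k (\<Phi> j \<omega>) (\<Phi> (Suc j) \<omega>)) / sqrt (real n))"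
  note [measurable] = \<Phi>m f_meas fh_meas
  have comp_meas: "(\<lambda>\<omega>. case_prod u (\<Phi> j \<omega>, \<Phi> (Suc j) \<omega>)) \<in> borel_measurable \<Omega>"
    if "case_prod u \<in> borel_measurable (M \<Otimes>\<^sub>M M)" for u :: "'x \<Rightarrow> 'x \<Rightarrow> real" and j
    by (rule measurable_compose[OF _ that]) measurable
  have vec_meas: "Z \<in> borel_measurable \<Omega>" if "\<And>k. (\<lambda>\<omega>. Z \<omega> $ k) \<in> borel_measurable \<Omega>" for Z :: "'w \<Rightarrow> real^('d option)"
  proof (rule borel_measurable_euclidean_space[THEN iffD2], rule ballI)
    fix e :: "real^('d option)" assume "e \<in> Basis"
    then obtain k where "e = axis k 1" by (auto simp: Basis_vec_def)
    then show "(\<lambda>\<omega>. Z \<omega> \<bullet> e) \<in> borel_measurable \<Omega>" using that[of k] by (simp add: inner_axis)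
  qed
  have Xm: "X n \<in> borel_measurable \<Omega>" for n
  proof (rule vec_meas)
    fix k show "(\<lambda>\<omega>. X n \<omega> $ k) \<in> borel_measurable \<Omega>"
    proof (cases k)
      case None
      then show ?thesis by (simp add: X_def time_average_def)
    next
      case (Some i)
      have "(\<lambda>\<omega>. (\<Sum>j\<in>{..<n}. d i (\<Phi> j \<omega>) (\<Phi> (Suc j) \<omega>) * (\<Prod>k\<in>{..<n} - {j}. p \<theta>\<^sub>0 (\<Phi> k \<omega>) (\<Phi> (Suc k) \<omega>))) / sqrt (real n)) \<in> borel_measurable \<Omega>"
        using comp_meas[of "d i"] comp_meas[of "p \<theta>\<^sub>0"] dm[of i] p_meas[OF \<theta>B]
        by (intro borel_measurable_divide borel_measurable_sum borel_measurable_times borel_measurable_prod) auto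
      then show ?thesis using grad Some by (simp add: X_def cong: measurable_cong)
    qed
  qed
  have Ym: "Y n \<in> borel_measurable \<Omega>" for n
  proof (rule vec_meas)
    fix k show "(\<lambda>\<omega>. Y n \<omega> $ k) \<in> borel_measurable \<Omega>"
      using comp_meas[of "\<xi> k"] \<xi>_meas[of k] by (simp add: Y_def)
  qed
  \<comment> \<open>\<open>X n\<close> and \<open>Y n\<close> differ only by the boundary term of Poisson's equation\<close>
  have XY: "AE \<omega> in \<Omega>. \<bar>a \<bullet> X n \<omega> - a \<bullet> Y n \<omega>\<bar> \<le> \<bar>a $ None\<bar> * (\<bar>fh (\<Phi> 0 \<omega>)\<bar> + \<bar>fh (\<Phi> n \<omega>)\<bar>) / sqrt (real n)" for a n
    using p1 AE_space
  proof eventually_elim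
    case (elim \<omega>)
    note w = elim(2)
    have N: "X n \<omega> $ None - Y n \<omega> $ None = (fh (\<Phi> 0 \<omega>) - fh (\<Phi> n \<omega>)) / sqrt (real n)"
    proof -
      have "(\<Sum>j<n. f (\<Phi> j \<omega>)) - real n * ?\<alpha> = (\<Sum>j<n. fh (\<Phi> j \<omega>) - kernel_op ?P fh (\<Phi> j \<omega>))"
        using poisson[OF E.chain_space[OF w]] by (simp add: sum_subtractf)
      also have "\<dots> = (\<Sum>j<n. \<xi> None (\<Phi> j \<omega>) (\<Phi> (Suc j) \<omega>)) + (\<Sum>j<n. fh (\<Phi> j \<omega>) - fh (\<Phi> (Suc j) \<omega>))"
        by (simp add: \<xi>_simps sum.distrib[symmetric])
      also have "(\<Sum>j<n. fh (\<Phi> j \<omega>) - fh (\<Phi> (Suc j) \<omega>)) = fh (\<Phi> 0 \<omega>) - fh (\<Phi> n \<omega>)"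
        by (rule sum_lessThan_telescope')
      finally have e: "(\<Sum>j<n. f (\<Phi> j \<omega>)) - real n * ?\<alpha> = (\<Sum>j<n. \<xi> None (\<Phi> j \<omega>) (\<Phi> (Suc j) \<omega>)) + (fh (\<Phi> 0 \<omega>) - fh (\<Phi> n \<omega>))" .
      have "X n \<omega> $ None = ((\<Sum>j<n. f (\<Phi> j \<omega>)) - real n * ?\<alpha>) / sqrt (real n)"
      proof (cases "n = 0")
        case False
        have "X n \<omega> $ None = real n / sqrt (real n) * ((\<Sum>j<n. f (\<Phi> j \<omega>)) / real n - ?\<alpha>)"
          by (simp add: X_def time_average_def real_div_sqrt)
        also have "\<dots> = real n * ((\<Sum>j<n. f (\<Phi> j \<omega>)) / real n - ?\<alpha>) / sqrt (real n)" by simp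
        also have "real n * ((\<Sum>j<n. f (\<Phi> j \<omega>)) / real n - ?\<alpha>) = (\<Sum>j<n. f (\<Phi> j \<omega>)) - real n * ?\<alpha>"
          using False by (simp add: right_diff_distrib)
        finally show ?thesis .
      qed (simp add: X_def)
      then show ?thesis unfolding e by (simp add: Y_def add_divide_distrib)
    qed
    have S: "X n \<omega> $ Some i = Y n \<omega> $ Some i" for i
      using elim(1) by (simp add: X_def Y_def grad[OF w] \<xi>_simps)
    have "X n \<omega> - Y n \<omega> = axis None ((fh (\<Phi> 0 \<omega>) - fh (\<Phi> n \<omega>)) / sqrt (real n))"
    proof (rule vec_eq_iff[THEN iffD2], rule allI)
      fix k show "(X n \<omega> - Y n \<omega>) $ k = axis None ((fh (\<Phi> 0 \<omega>) - fh (\<Phi> n \<omega>)) / sqrt (real n)) $ k"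
        using N S by (cases k) (simp_all add: axis_def)
    qed
    then have "a \<bullet> X n \<omega> - a \<bullet> Y n \<omega> = a $ None * ((fh (\<Phi> 0 \<omega>) - fh (\<Phi> n \<omega>)) / sqrt (real n))"
      by (simp add: inner_diff_right[symmetric] inner_axis)
    then have "\<bar>a \<bullet> X n \<omega> - a \<bullet> Y n \<omega>\<bar> = \<bar>a $ None\<bar> * \<bar>fh (\<Phi> 0 \<omega>) - fh (\<Phi> n \<omega>)\<bar> / sqrt (real n)"
      by (simp add: abs_mult)
    also have "\<dots> \<le> \<bar>a $ None\<bar> * (\<bar>fh (\<Phi> 0 \<omega>)\<bar> + \<bar>fh (\<Phi> n \<omega>)\<bar>) / sqrt (real n)"
      by (intro divide_right_mono mult_left_mono) auto
    finally show ?case .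
  qed
  have charX: "(\<lambda>n. \<integral>\<omega>. iexp (a \<bullet> X n \<omega>) \<partial>\<Omega>) \<longlonglongrightarrow> exp (- (a \<bullet> (\<Sigma> *v a)) / 2)" for a
  proof -
    let ?f = "\<lambda>n \<omega>. min 2 (\<bar>a $ None\<bar> * (\<bar>fh (\<Phi> 0 \<omega>)\<bar> + \<bar>fh (\<Phi> n \<omega>)\<bar>) / sqrt (real n))"
    have lim: "(\<lambda>n. \<integral>\<omega>. iexp (a \<bullet> Y n \<omega>) \<partial>\<Omega>) \<longlonglongrightarrow> exp (- (a \<bullet> (\<Sigma> *v a)) / 2)"
      unfolding \<Sigma> Y_def by (rule E.central_limit_vector[OF hyps])
    have I: "integrable \<Omega> (\<lambda>\<omega>. iexp (a \<bullet> Z \<omega>))" if [measurable]: "Z \<in> borel_measurable \<Omega>" for Z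
      by (rule \<Omega>.integrable_const_bound[where B=1]) auto
    have fI: "integrable \<Omega> (?f n)" for n
      by (intro \<Omega>.integrable_const_bound[where B=2] AE_I2) auto
    have "norm ((\<integral>\<omega>. iexp (a \<bullet> X n \<omega>) \<partial>\<Omega>) - (\<integral>\<omega>. iexp (a \<bullet> Y n \<omega>) \<partial>\<Omega>)) \<le> (\<integral>\<omega>. ?f n \<omega> \<partial>\<Omega>)" for n
    proof -
      have "norm ((\<integral>\<omega>. iexp (a \<bullet> X n \<omega>) \<partial>\<Omega>) - (\<integral>\<omega>. iexp (a \<bullet> Y n \<omega>) \<partial>\<Omega>)) = norm (\<integral>\<omega>. iexp (a \<bullet> X n \<omega>) - iexp (a \<bullet> Y n \<omega>) \<partial>\<Omega>)"
        using I[OF Xm] I[OF Ym] by simp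
      also have "\<dots> \<le> (\<integral>\<omega>. norm (iexp (a \<bullet> X n \<omega>) - iexp (a \<bullet> Y n \<omega>)) \<partial>\<Omega>)" by (rule integral_norm_bound)
      also have "\<dots> \<le> (\<integral>\<omega>. ?f n \<omega> \<partial>\<Omega>)"
      proof (rule integral_mono_AE)
        show "integrable \<Omega> (\<lambda>\<omega>. norm (iexp (a \<bullet> X n \<omega>) - iexp (a \<bullet> Y n \<omega>)))"
          by (intro integrable_norm Bochner_Integration.integrable_diff I Xm Ym)
        show "AE \<omega> in \<Omega>. norm (iexp (a \<bullet> X n \<omega>) - iexp (a \<bullet> Y n \<omega>)) \<le> ?f n \<omega>"
          using XY[of a n]
        proof eventually_elim
          case (elim \<omega>)
          have "norm (iexp (a \<bullet> X n \<omega>) - iexp (a \<bullet> Y n \<omega>)) \<le> min 2 \<bar>a \<bullet> X n \<omega> - a \<bullet> Y n \<omega>\<bar>" by (rule iexp_diff_le)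
          also have "\<dots> \<le> ?f n \<omega>" using elim by (intro min.mono order_refl)
          finally show ?case .
        qed
      qed (rule fI)
      finally show ?thesis .
    qed
    then have "(\<lambda>n. (\<integral>\<omega>. iexp (a \<bullet> X n \<omega>) \<partial>\<Omega>) - (\<integral>\<omega>. iexp (a \<bullet> Y n \<omega>) \<partial>\<Omega>)) \<longlonglongrightarrow> 0"
      by (intro Lim_null_comparison[OF _ E.negligible_endpoints[OF fhv, of "\<bar>a $ None\<bar>"]] always_eventually) auto
    from tendsto_add[OF this lim] show ?thesis by simp
  qed
  define H :: "real^('d option) \<Rightarrow> real^'d" where "H = (\<lambda>z. z $ None *\<^sub>R (\<chi> i. z $ Some i))"
  have Hc: "continuous_on UNIV H"
    unfolding H_def by (intro continuous_intros)
  have Hm: "H \<in> borel_measurable borel" using Hc by (rule borel_measurable_continuous_onI)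
  \<comment> \<open>the factors \<open>sqrt n\<close> and \<open>1 / sqrt n\<close> cancel\<close>
  have prod: "(time_average f \<Phi> n \<omega> - ?\<alpha>) *\<^sub>R gradient (likelihood_ratio p \<Phi> n \<omega>) \<theta>\<^sub>0 = H (X n \<omega>)" if "1 \<le> n" for n \<omega>
    using that by (simp add: H_def X_def vec_eq_iff)
  have weak: "weakly_converges
         (\<lambda>n. distr \<Omega> borel (\<lambda>\<omega>. (time_average f \<Phi> n \<omega> - ?\<alpha>) *\<^sub>R gradient (likelihood_ratio p \<Phi> n \<omega>) \<theta>\<^sub>0))
         (distr N borel H)" if N: "multivariate_normal 0 \<Sigma> N" for N
  proof -
    have NP: "prob_space N" "sets N = sets borel" using N by (auto simp: multivariate_normal_def)
    have W: "weakly_converges (\<lambda>n. distr \<Omega> borel (X n)) N"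
    proof (rule weakly_converges_char[OF _ _ NP])
      show "prob_space (distr \<Omega> borel (X n))" for n by (rule \<Omega>.prob_space_distr[OF Xm])
      show "sets (distr \<Omega> borel (X n)) = sets borel" for n by simp
      show "(\<lambda>n. \<integral>z. iexp (a \<bullet> z) \<partial>distr \<Omega> borel (X n)) \<longlonglongrightarrow> (\<integral>z. iexp (a \<bullet> z) \<partial>N)" for a
        unfolding multivariate_normal_char[OF N] using charX[of a] by (simp add: integral_distr[OF Xm])
    qed
    show ?thesis
      unfolding weakly_converges_def
    proof (intro allI impI)
      fix \<phi> :: "real^'d \<Rightarrow> real" assume \<phi>: "continuous_on UNIV \<phi> \<and> bounded (range \<phi>)"
      have \<phi>m: "\<phi> \<in> borel_measurable borel" using \<phi> by (intro borel_measurable_continuous_onI) simp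
      have \<phi>Hm: "(\<lambda>z. \<phi> (H z)) \<in> borel_measurable borel" using Hm \<phi>m by measurable
      have "continuous_on UNIV (\<lambda>z. \<phi> (H z))" using \<phi> by (intro continuous_on_compose2[OF _ Hc]) auto
      moreover have "bounded (range (\<lambda>z. \<phi> (H z)))" using \<phi> by (auto intro: bounded_subset)
      ultimately have "(\<lambda>n. \<integral>z. \<phi> (H z) \<partial>distr \<Omega> borel (X n)) \<longlonglongrightarrow> (\<integral>z. \<phi> (H z) \<partial>N)"
        using W unfolding weakly_converges_def by blast
      moreover have "(\<integral>z. \<phi> z \<partial>distr N borel H) = (\<integral>z. \<phi> (H z) \<partial>N)"
        using Hm \<phi>m by (intro integral_distr) (simp_all add: measurable_cong_sets[OF NP(2) refl])
      moreover have "\<forall>\<^sub>F n in sequentially. (\<integral>z. \<phi> (H z) \<partial>distr \<Omega> borel (X n))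
          = (\<integral>z. \<phi> z \<partial>distr \<Omega> borel (\<lambda>\<omega>. (time_average f \<Phi> n \<omega> - ?\<alpha>) *\<^sub>R gradient (likelihood_ratio p \<Phi> n \<omega>) \<theta>\<^sub>0))"
      proof (rule eventually_sequentiallyI[of 1])
        fix n :: nat assume n: "1 \<le> n"
        have "(\<integral>z. \<phi> z \<partial>distr \<Omega> borel (\<lambda>\<omega>. H (X n \<omega>))) = (\<integral>\<omega>. \<phi> (H (X n \<omega>)) \<partial>\<Omega>)"
          by (rule integral_distr[OF measurable_compose[OF Xm Hm] \<phi>m])
        then show "(\<integral>z. \<phi> (H z) \<partial>distr \<Omega> borel (X n))
          = (\<integral>z. \<phi> z \<partial>distr \<Omega> borel (\<lambda>\<omega>. (time_average f \<Phi> n \<omega> - ?\<alpha>) *\<^sub>R gradient (likelihood_ratio p \<Phi> n \<omega>) \<theta>\<^sub>0))"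
          unfolding prod[OF n] by (simp add: integral_distr[OF Xm \<phi>Hm])
      qed
      ultimately show "(\<lambda>n. \<integral>z. \<phi> z \<partial>distr \<Omega> borel (\<lambda>\<omega>. (time_average f \<Phi> n \<omega> - ?\<alpha>) *\<^sub>R gradient (likelihood_ratio p \<Phi> n \<omega>) \<theta>\<^sub>0))
        \<longlonglongrightarrow> (\<integral>z. \<phi> z \<partial>distr N borel H)"
        by (simp add: Lim_transform_eventually)
    qed
  qed
  show ?thesis
    using exN weak unfolding H_def by blast
qed

end
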